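(* Let $(M,g)$ be a pointwise Osserman lightlike hypersurface of a semi-Riemannian manifold $(\overline{M}(c),\overline{g})$ of constant sectional curvature $c$. Then for an admissible screen distribution $S(TM)$, the lightlike hypersurface $(M,g,S(TM))$ is Ricci semi-symmetric.
   Context: $(\overline{M},\overline{g})$ is a semi-Riemannian manifold of constant index $\ge1$ with Levi-Civita connection $\overline{\nabla}$; constant curvature $c$ means $\overline{R}(X,Y)Z=c\{\overline{g}(Y,Z)X-\overline{g}(X,Z)Y\}$. A hypersurface $M$ with $g=\overline{g}|_{TM}$ is lightlike if $\mathrm{Rad}\,TM=TM\cap TM^{\perp}=TM^{\perp}$ is a smooth distribution of rank 1. A screen distribution $S(TM)$ is a semi-Riemannian (non-degenerate) complement of $\mathrm{Rad}\,TM$ in $TM$. For a local nowhere-zero section $\xi$ of $\mathrm{Rad}\,TM$ there is a unique local section $N$ of $S(TM)^{\perp}$ with $\overline{g}(\xi,N)=1$, $\overline{g}(N,N)=0$. The induced connection $\nabla$ on $M$ is defined by $\overline{\nabla}_XY=\nabla_XY+B(X,Y)N$ with $\nabla_XY\in\Gamma(TM)$. Induced curvature: $R(X,Y)Z=\nabla_X\nabla_YZ-\nabla_Y\nabla_XZ-\nabla_{[X,Y]}Z$, $R(X,Y,Z,U)=g(R(X,Y)Z,U)$; induced Ricci tensor: $Ric(X,Y)=\mathrm{trace}(Z\mapsto R(X,Z)Y)$ (the opposite sign convention gives the same statement). $R$ is an algebraic curvature tensor if at each point $R(x,y,z,w)=-R(y,x,z,w)=R(z,w,x,y)$ and $R(x,y,z,w)+R(y,z,x,w)+R(z,x,y,w)=0$.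 $S(TM)$ is admissible if its associated $R$ is an algebraic curvature tensor. With $\eta=\overline{g}(N,\cdot)$, $\tilde g=g+\eta\otimes\eta$ is a non-degenerate metric on $M$. Let $S_u^{\pm}(M)=\{x\in T_uM:g(x,x)=\pm1\}$. For algebraic $R$ and $x\in S_u^{\pm}(M)$ the pseudo-Jacobi operator $J_R(x)$ on $T_uM$ is given by $\tilde g(J_R(x)y,w)=R(y,x,x,w)$. $M$ is timelike (resp. spacelike) Osserman at $u$ if for each admissible screen distribution with associated $R$ the characteristic polynomial of $J_R(x)$ is independent of $x\in S_u^{-}(M)$ (resp. $S_u^{+}(M)$). The two conditions are treated as equivalent; Osserman at $u$ means that both hold, and pointwise Osserman means Osserman at every $u\in M$. $(M,g,S(TM))$ is Ricci semi-symmetric if for all $V_1,V_2,X,Y\in\Gamma(TM)$, $(R(V_1,V_2)\cdot Ric)(X,Y)=-Ric(R(V_1,V_2)X,Y)-Ric(X,R(V_1,V_2)Y)=0$. *)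

theory Defs
  imports "HOL-Analysis.Analysis" "Jordan_Normal_Form.Char_Poly"
begin

section \<open>Smooth maps between Euclidean spaces\<close>

text \<open>Intended for open sets \<open>S\<close>.\<close>

primrec Ck_on :: "nat \<Rightarrow> 'a::euclidean_space set \<Rightarrow> ('a \<Rightarrow> 'b::real_normed_vector) \<Rightarrow> bool" where
  "Ck_on 0 S f \<longleftrightarrow> continuous_on S f"
| "Ck_on (Suc k) S f \<longleftrightarrow>
     (\<forall>x\<in>S. f differentiable (at x)) \<and> (\<forall>v. Ck_on k S (\<lambda>x. frechet_derivative f (at x) v))"

definition smooth_on :: "'a::euclidean_space set \<Rightarrow> ('a \<Rightarrow> 'b::real_normed_vector) \<Rightarrow> bool" where
  "smooth_on S f \<longleftrightarrow> (\<forall>k. Ck_on k S f)"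


section \<open>Smooth manifolds\<close>

text \<open>The point set of the manifold is the whole type \<open>'m\<close>. A chart is a pair of its domain and
  its coordinate map, and the manifold has dimension \<open>DIM('b)\<close>.\<close>

type_synonym ('m, 'b) chart = "'m set \<times> ('m \<Rightarrow> 'b)"

definition chart_inv :: "('m, 'b) chart \<Rightarrow> 'b \<Rightarrow> 'm" where
  "chart_inv c = inv_into (fst c) (snd c)"

definition is_chart :: "('m::topological_space, 'b::euclidean_space) chart \<Rightarrow> bool" where
  "is_chart c \<longleftrightarrow> open (fst c) \<and> open (snd c ` fst c) \<and>
     homeomorphism (fst c) (snd c ` fst c) (snd c) (chart_inv c)"

definition compatible ::
  "('m::topological_space, 'b::euclidean_space) chart \<Rightarrow> ('m, 'b) chart \<Rightarrow> bool" where
  "compatible c d \<longleftrightarrow>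
     smooth_on (snd c ` (fst c \<inter> fst d)) (snd d \<circ> chart_inv c) \<and>
     smooth_on (snd d ` (fst c \<inter> fst d)) (snd c \<circ> chart_inv d)"

definition smooth_atlas :: "('m::topological_space, 'b::euclidean_space) chart set \<Rightarrow> bool" where
  "smooth_atlas A \<longleftrightarrow> (\<forall>c\<in>A. is_chart c) \<and> (\<Union>c\<in>A. fst c) = UNIV \<and>
     (\<forall>c\<in>A. \<forall>d\<in>A. compatible c d)"

text \<open>Every tangent space of the manifold is a copy of the model space \<open>'b\<close>: the element \<open>v\<close> of
  the tangent space at \<open>p\<close> stands for the tangent vector with components \<open>v\<close> in the chart
  \<open>chart_at A p\<close>. Its components in another chart \<open>c\<close> around \<open>p\<close> are \<open>components A c p v\<close>. A vector
  field is thus a function \<open>'m \<Rightarrow> 'b\<close>. Since \<open>chart_at A p\<close> varies with \<open>p\<close> in an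
  uncontrolled way, smoothness of a vector field must be tested on its components in a fixed chart;
  it is not smoothness of the function \<open>'m \<Rightarrow> 'b\<close>.\<close>

definition chart_at :: "('m, 'b) chart set \<Rightarrow> 'm \<Rightarrow> ('m, 'b) chart" where
  "chart_at A p = (SOME c. c \<in> A \<and> p \<in> fst c)"

definition components ::
  "('m, 'b::euclidean_space) chart set \<Rightarrow> ('m, 'b) chart \<Rightarrow> 'm \<Rightarrow> 'b \<Rightarrow> 'b" where
  "components A c p v =
     frechet_derivative (snd c \<circ> chart_inv (chart_at A p)) (at (snd (chart_at A p) p)) v"

definition vf_in_chart ::
  "('m, 'b::euclidean_space) chart set \<Rightarrow> ('m, 'b) chart \<Rightarrow> ('m \<Rightarrow> 'b) \<Rightarrow> 'b \<Rightarrow> 'b" where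
  "vf_in_chart A c X = (\<lambda>x. components A c (chart_inv c x) (X (chart_inv c x)))"

definition smooth_function_on ::
  "('m, 'b::euclidean_space) chart set \<Rightarrow> 'm set \<Rightarrow> ('m \<Rightarrow> real) \<Rightarrow> bool" where
  "smooth_function_on A W f \<longleftrightarrow> (\<forall>c\<in>A. smooth_on (snd c ` (fst c \<inter> W)) (f \<circ> chart_inv c))"

definition smooth_field_on ::
  "('m, 'b::euclidean_space) chart set \<Rightarrow> 'm set \<Rightarrow> ('m \<Rightarrow> 'b) \<Rightarrow> bool" where
  "smooth_field_on A W X \<longleftrightarrow> (\<forall>c\<in>A. smooth_on (snd c ` (fst c \<inter> W)) (vf_in_chart A c X))"

definition differential ::
  "('m, 'b::euclidean_space) chart set \<Rightarrow> ('m \<Rightarrow> real) \<Rightarrow> 'm \<Rightarrow> 'b \<Rightarrow> real" where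
  "differential A f p v =
     frechet_derivative (f \<circ> chart_inv (chart_at A p)) (at (snd (chart_at A p) p)) v"

definition lie_bracket ::
  "('m, 'b::euclidean_space) chart set \<Rightarrow> ('m \<Rightarrow> 'b) \<Rightarrow> ('m \<Rightarrow> 'b) \<Rightarrow> 'm \<Rightarrow> 'b" where
  "lie_bracket A X Y p =
     (let c = chart_at A p; x = snd c p
      in frechet_derivative (vf_in_chart A c Y) (at x) (X p)
         - frechet_derivative (vf_in_chart A c X) (at x) (Y p))"


section \<open>Semi-Riemannian manifolds\<close>

definition form_index :: "('b::euclidean_space \<Rightarrow> 'b \<Rightarrow> real) \<Rightarrow> nat" where
  "form_index b = Max {dim V |V. subspace V \<and> (\<forall>v\<in>V. v \<noteq> 0 \<longrightarrow> b v v < 0)}"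

definition semi_riemannian_manifold ::
  "('m::topological_space, 'b::euclidean_space) chart set \<Rightarrow> ('m \<Rightarrow> 'b \<Rightarrow> 'b \<Rightarrow> real) \<Rightarrow> bool" where
  "semi_riemannian_manifold A g \<longleftrightarrow> smooth_atlas A \<and>
     (\<forall>p. bilinear (g p)) \<and> (\<forall>p v w. g p v w = g p w v) \<and>
     (\<forall>p v. (\<forall>w. g p v w = 0) \<longrightarrow> v = 0) \<and>
     (\<forall>W X Y. open W \<and> smooth_field_on A W X \<and> smooth_field_on A W Y \<longrightarrow>
        smooth_function_on A W (\<lambda>p. g p (X p) (Y p))) \<and>
     (\<exists>q\<ge>1. \<forall>p. form_index (g p) = q)"

text \<open>Connections act on vector fields that are defined on arbitrary open sets \<open>W\<close>; the values
  outside \<open>W\<close> are irrelevant by the last clause. The usual operation on global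
  fields determines this one by locality.\<close>

definition affine_connection ::
  "('m::topological_space, 'b::euclidean_space) chart set
    \<Rightarrow> (('m \<Rightarrow> 'b) \<Rightarrow> ('m \<Rightarrow> 'b) \<Rightarrow> 'm \<Rightarrow> 'b) \<Rightarrow> bool" where
  "affine_connection A D \<longleftrightarrow>
    (\<forall>W X X' Y Y' f. open W \<and> smooth_field_on A W X \<and> smooth_field_on A W X' \<and>
       smooth_field_on A W Y \<and> smooth_field_on A W Y' \<and> smooth_function_on A W f \<longrightarrow>
       smooth_field_on A W (D X Y) \<and>
       (\<forall>p\<in>W. D (\<lambda>q. X q + X' q) Y p = D X Y p + D X' Y p) \<and>
       (\<forall>p\<in>W. D (\<lambda>q. f q *\<^sub>R X q) Y p = f p *\<^sub>R D X Y p) \<and>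
       (\<forall>p\<in>W. D X (\<lambda>q. Y q + Y' q) p = D X Y p + D X Y' p) \<and>
       (\<forall>p\<in>W. D X (\<lambda>q. f q *\<^sub>R Y q) p = differential A f p (X p) *\<^sub>R Y p + f p *\<^sub>R D X Y p) \<and>
       ((\<forall>p\<in>W. X p = X' p \<and> Y p = Y' p) \<longrightarrow> (\<forall>p\<in>W. D X Y p = D X' Y' p)))"

definition levi_civita ::
  "('m::topological_space, 'b::euclidean_space) chart set \<Rightarrow> ('m \<Rightarrow> 'b \<Rightarrow> 'b \<Rightarrow> real)
    \<Rightarrow> (('m \<Rightarrow> 'b) \<Rightarrow> ('m \<Rightarrow> 'b) \<Rightarrow> 'm \<Rightarrow> 'b) \<Rightarrow> bool" where
  "levi_civita A g D \<longleftrightarrow> affine_connection A D \<and>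
    (\<forall>W X Y Z. open W \<and> smooth_field_on A W X \<and> smooth_field_on A W Y \<and> smooth_field_on A W Z \<longrightarrow>
       (\<forall>p\<in>W. D X Y p - D Y X p = lie_bracket A X Y p) \<and>
       (\<forall>p\<in>W. differential A (\<lambda>q. g q (Y q) (Z q)) p (X p)
               = g p (D X Y p) (Z p) + g p (Y p) (D X Z p)))"

definition ambient_curvature ::
  "('m, 'b::euclidean_space) chart set \<Rightarrow> (('m \<Rightarrow> 'b) \<Rightarrow> ('m \<Rightarrow> 'b) \<Rightarrow> 'm \<Rightarrow> 'b)
    \<Rightarrow> ('m \<Rightarrow> 'b) \<Rightarrow> ('m \<Rightarrow> 'b) \<Rightarrow> ('m \<Rightarrow> 'b) \<Rightarrow> 'm \<Rightarrow> 'b" where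
  "ambient_curvature A D X Y Z p =
     D X (D Y Z) p - D Y (D X Z) p - D (lie_bracket A X Y) Z p"

definition constant_curvature ::
  "('m::topological_space, 'b::euclidean_space) chart set \<Rightarrow> ('m \<Rightarrow> 'b \<Rightarrow> 'b \<Rightarrow> real)
    \<Rightarrow> (('m \<Rightarrow> 'b) \<Rightarrow> ('m \<Rightarrow> 'b) \<Rightarrow> 'm \<Rightarrow> 'b) \<Rightarrow> real \<Rightarrow> bool" where
  "constant_curvature A g D c \<longleftrightarrow>
    (\<forall>W X Y Z. open W \<and> smooth_field_on A W X \<and> smooth_field_on A W Y \<and> smooth_field_on A W Z \<longrightarrow>
       (\<forall>p\<in>W. ambient_curvature A D X Y Z p
               = c *\<^sub>R (g p (Y p) (Z p) *\<^sub>R X p - g p (X p) (Z p) *\<^sub>R Y p)))"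


section \<open>Hypersurfaces\<close>

text \<open>A hypersurface is a space \<open>'h\<close> with a map \<open>\<iota>\<close> into the manifold that is locally a
  homeomorphism onto a hyperplane slice of a chart of the maximal atlas. These are the immersed
  hypersurfaces, with the smooth structure induced by the slices; embedded ones are those
  where \<open>\<iota>\<close> is a topological embedding.\<close>

definition hypersurface ::
  "('m::topological_space, 'b::euclidean_space) chart set \<Rightarrow> ('h::topological_space \<Rightarrow> 'm) \<Rightarrow> bool" where
  "hypersurface A \<iota> \<longleftrightarrow>
     (\<forall>u. \<exists>U c n. open U \<and> u \<in> U \<and> is_chart c \<and> (\<forall>d\<in>A. compatible c d) \<and> n \<noteq> 0 \<and>
        \<iota> ` U = {p \<in> fst c. inner (snd c p) n = 0} \<and> (\<exists>k. homeomorphism U (\<iota> ` U) \<iota> k))"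

text \<open>The tangent space of the hypersurface at \<open>u\<close> is identified with its image in the tangent
  space of the ambient manifold at \<open>\<iota> u\<close>. This is the common kernel of the differentials of the
  functions vanishing on the hypersurface near \<open>u\<close>.\<close>

definition tangent ::
  "('m::topological_space, 'b::euclidean_space) chart set \<Rightarrow> ('h::topological_space \<Rightarrow> 'm)
    \<Rightarrow> 'h \<Rightarrow> 'b set" where
  "tangent A \<iota> u =
     {v. \<forall>W U F. open W \<and> open U \<and> u \<in> U \<and> \<iota> ` U \<subseteq> W \<and> smooth_function_on A W F \<and>
           (\<forall>q\<in>U. F (\<iota> q) = 0) \<longrightarrow> differential A F (\<iota> u) v = 0}"

text \<open>Vector fields along the hypersurface are functions \<open>'h \<Rightarrow> 'b\<close>; they are smooth if they
  locally extend to smooth fields of the ambient manifold.\<close>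

definition extends_near ::
  "('m::topological_space, 'b::euclidean_space) chart set \<Rightarrow> ('h::topological_space \<Rightarrow> 'm)
    \<Rightarrow> 'h \<Rightarrow> ('h \<Rightarrow> 'b) \<Rightarrow> ('m \<Rightarrow> 'b) \<Rightarrow> bool" where
  "extends_near A \<iota> u X X' \<longleftrightarrow>
     (\<exists>W U. open W \<and> open U \<and> u \<in> U \<and> \<iota> ` U \<subseteq> W \<and> smooth_field_on A W X' \<and>
        (\<forall>q\<in>U. X q = X' (\<iota> q)))"

definition smooth_along ::
  "('m::topological_space, 'b::euclidean_space) chart set \<Rightarrow> ('h::topological_space \<Rightarrow> 'm)
    \<Rightarrow> 'h set \<Rightarrow> ('h \<Rightarrow> 'b) \<Rightarrow> bool" where
  "smooth_along A \<iota> U X \<longleftrightarrow> (\<forall>u\<in>U. \<exists>X'. extends_near A \<iota> u X X')"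

definition sections ::
  "('m::topological_space, 'b::euclidean_space) chart set \<Rightarrow> ('h::topological_space \<Rightarrow> 'm)
    \<Rightarrow> ('h \<Rightarrow> 'b set) \<Rightarrow> 'h set \<Rightarrow> ('h \<Rightarrow> 'b) set" where
  "sections A \<iota> E U = {X. smooth_along A \<iota> U X \<and> (\<forall>q\<in>U. X q \<in> E q)}"

definition smooth_distribution ::
  "('m::topological_space, 'b::euclidean_space) chart set \<Rightarrow> ('h::topological_space \<Rightarrow> 'm)
    \<Rightarrow> nat \<Rightarrow> ('h \<Rightarrow> 'b set) \<Rightarrow> bool" where
  "smooth_distribution A \<iota> k E \<longleftrightarrow>
     (\<forall>u. subspace (E u) \<and> dim (E u) = k \<and> E u \<subseteq> tangent A \<iota> u) \<and>
     (\<forall>u. \<exists>U F. open U \<and> u \<in> U \<and> (\<forall>i<k. F i \<in> sections A \<iota> E U) \<and>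
        (\<forall>q\<in>U. E q = span {F i q |i. i < k}))"

definition normal ::
  "('m::topological_space, 'b::euclidean_space) chart set \<Rightarrow> ('m \<Rightarrow> 'b \<Rightarrow> 'b \<Rightarrow> real)
    \<Rightarrow> ('h::topological_space \<Rightarrow> 'm) \<Rightarrow> 'h \<Rightarrow> 'b set" where
  "normal A g \<iota> u = {v. \<forall>w\<in>tangent A \<iota> u. g (\<iota> u) v w = 0}"

definition rad ::
  "('m::topological_space, 'b::euclidean_space) chart set \<Rightarrow> ('m \<Rightarrow> 'b \<Rightarrow> 'b \<Rightarrow> real)
    \<Rightarrow> ('h::topological_space \<Rightarrow> 'm) \<Rightarrow> 'h \<Rightarrow> 'b set" where
  "rad A g \<iota> u = tangent A \<iota> u \<inter> normal A g \<iota> u"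

definition lightlike_hypersurface ::
  "('m::topological_space, 'b::euclidean_space) chart set \<Rightarrow> ('m \<Rightarrow> 'b \<Rightarrow> 'b \<Rightarrow> real)
    \<Rightarrow> ('h::topological_space \<Rightarrow> 'm) \<Rightarrow> bool" where
  "lightlike_hypersurface A g \<iota> \<longleftrightarrow> hypersurface A \<iota> \<and>
     (\<forall>u. rad A g \<iota> u = normal A g \<iota> u) \<and> smooth_distribution A \<iota> 1 (rad A g \<iota>)"

definition screen_distribution ::
  "('m::topological_space, 'b::euclidean_space) chart set \<Rightarrow> ('m \<Rightarrow> 'b \<Rightarrow> 'b \<Rightarrow> real)
    \<Rightarrow> ('h::topological_space \<Rightarrow> 'm) \<Rightarrow> ('h \<Rightarrow> 'b set) \<Rightarrow> bool" where
  "screen_distribution A g \<iota> S \<longleftrightarrow>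
     (\<exists>k. smooth_distribution A \<iota> k S) \<and>
     (\<forall>u. S u \<inter> rad A g \<iota> u = {0} \<and>
          {s + r |s r. s \<in> S u \<and> r \<in> rad A g \<iota> u} = tangent A \<iota> u) \<and>
     (\<forall>u. \<forall>v\<in>S u. (\<forall>w\<in>S u. g (\<iota> u) v w = 0) \<longrightarrow> v = 0)"

text \<open>\<open>rad_frame A g \<iota> U \<xi>\<close>: \<open>\<xi>\<close> is a nowhere-zero section of the radical over the open set \<open>U\<close>.
  The corresponding field \<open>N\<close> is \<open>transversal g \<iota> S \<xi>\<close>.\<close>

definition rad_frame ::
  "('m::topological_space, 'b::euclidean_space) chart set \<Rightarrow> ('m \<Rightarrow> 'b \<Rightarrow> 'b \<Rightarrow> real)
    \<Rightarrow> ('h::topological_space \<Rightarrow> 'm) \<Rightarrow> 'h set \<Rightarrow> ('h \<Rightarrow> 'b) \<Rightarrow> bool" where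
  "rad_frame A g \<iota> U \<xi> \<longleftrightarrow>
     open U \<and> \<xi> \<in> sections A \<iota> (rad A g \<iota>) U \<and> (\<forall>q\<in>U. \<xi> q \<noteq> 0)"

definition transversal ::
  "('m \<Rightarrow> 'b::euclidean_space \<Rightarrow> 'b \<Rightarrow> real) \<Rightarrow> ('h \<Rightarrow> 'm) \<Rightarrow> ('h \<Rightarrow> 'b set)
    \<Rightarrow> ('h \<Rightarrow> 'b) \<Rightarrow> 'h \<Rightarrow> 'b" where
  "transversal g \<iota> S \<xi> u =
     (THE N. (\<forall>w\<in>S u. g (\<iota> u) N w = 0) \<and> g (\<iota> u) (\<xi> u) N = 1 \<and> g (\<iota> u) N N = 0)"


section \<open>The induced connection and its curvature\<close>

text \<open>For tangent fields \<open>X\<close>, \<open>Y\<close> of the hypersurface the ambient derivative of \<open>Y\<close> along \<open>X\<close> and the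
  bracket are computed with arbitrary local extensions, on whose choice they do not depend.\<close>

definition ambient_derivative ::
  "('m::topological_space, 'b::euclidean_space) chart set
    \<Rightarrow> (('m \<Rightarrow> 'b) \<Rightarrow> ('m \<Rightarrow> 'b) \<Rightarrow> 'm \<Rightarrow> 'b) \<Rightarrow> ('h::topological_space \<Rightarrow> 'm)
    \<Rightarrow> ('h \<Rightarrow> 'b) \<Rightarrow> ('h \<Rightarrow> 'b) \<Rightarrow> 'h \<Rightarrow> 'b" where
  "ambient_derivative A D \<iota> X Y u =
     (THE w. \<exists>X' Y'. extends_near A \<iota> u X X' \<and> extends_near A \<iota> u Y Y' \<and> w = D X' Y' (\<iota> u))"

definition tangent_bracket ::
  "('m::topological_space, 'b::euclidean_space) chart set \<Rightarrow> ('h::topological_space \<Rightarrow> 'm)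
    \<Rightarrow> ('h \<Rightarrow> 'b) \<Rightarrow> ('h \<Rightarrow> 'b) \<Rightarrow> 'h \<Rightarrow> 'b" where
  "tangent_bracket A \<iota> X Y u =
     (THE w. \<exists>X' Y'. extends_near A \<iota> u X X' \<and> extends_near A \<iota> u Y Y' \<and>
        w = lie_bracket A X' Y' (\<iota> u))"

text \<open>The Gauss formula; \<open>b\<close> is the value of the second fundamental form, and the resulting tangent
  vector is the same for every \<open>\<xi>\<close>.\<close>

definition induced_connection ::
  "('m::topological_space, 'b::euclidean_space) chart set \<Rightarrow> ('m \<Rightarrow> 'b \<Rightarrow> 'b \<Rightarrow> real)
    \<Rightarrow> (('m \<Rightarrow> 'b) \<Rightarrow> ('m \<Rightarrow> 'b) \<Rightarrow> 'm \<Rightarrow> 'b) \<Rightarrow> ('h::topological_space \<Rightarrow> 'm) \<Rightarrow> ('h \<Rightarrow> 'b set)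
    \<Rightarrow> ('h \<Rightarrow> 'b) \<Rightarrow> ('h \<Rightarrow> 'b) \<Rightarrow> 'h \<Rightarrow> 'b" where
  "induced_connection A g D \<iota> S X Y u =
     (THE v. v \<in> tangent A \<iota> u \<and>
        (\<exists>U \<xi> b. rad_frame A g \<iota> U \<xi> \<and> u \<in> U \<and>
           ambient_derivative A D \<iota> X Y u = v + b *\<^sub>R transversal g \<iota> S \<xi> u))"

definition induced_curvature_field ::
  "('m::topological_space, 'b::euclidean_space) chart set \<Rightarrow> ('m \<Rightarrow> 'b \<Rightarrow> 'b \<Rightarrow> real)
    \<Rightarrow> (('m \<Rightarrow> 'b) \<Rightarrow> ('m \<Rightarrow> 'b) \<Rightarrow> 'm \<Rightarrow> 'b) \<Rightarrow> ('h::topological_space \<Rightarrow> 'm) \<Rightarrow> ('h \<Rightarrow> 'b set)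
    \<Rightarrow> ('h \<Rightarrow> 'b) \<Rightarrow> ('h \<Rightarrow> 'b) \<Rightarrow> ('h \<Rightarrow> 'b) \<Rightarrow> 'h \<Rightarrow> 'b" where
  "induced_curvature_field A g D \<iota> S X Y Z u =
     (let nabla = induced_connection A g D \<iota> S
      in nabla X (nabla Y Z) u - nabla Y (nabla X Z) u - nabla (tangent_bracket A \<iota> X Y) Z u)"

text \<open>The curvature is tensorial; its value on tangent vectors is obtained by extending them to
  local tangent fields.\<close>

definition induced_curvature ::
  "('m::topological_space, 'b::euclidean_space) chart set \<Rightarrow> ('m \<Rightarrow> 'b \<Rightarrow> 'b \<Rightarrow> real)
    \<Rightarrow> (('m \<Rightarrow> 'b) \<Rightarrow> ('m \<Rightarrow> 'b) \<Rightarrow> 'm \<Rightarrow> 'b) \<Rightarrow> ('h::topological_space \<Rightarrow> 'm) \<Rightarrow> ('h \<Rightarrow> 'b set)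
    \<Rightarrow> 'h \<Rightarrow> 'b \<Rightarrow> 'b \<Rightarrow> 'b \<Rightarrow> 'b" where
  "induced_curvature A g D \<iota> S u x y z =
     (THE w. \<exists>U X Y Z. open U \<and> u \<in> U \<and> {X, Y, Z} \<subseteq> sections A \<iota> (tangent A \<iota>) U \<and>
        X u = x \<and> Y u = y \<and> Z u = z \<and> w = induced_curvature_field A g D \<iota> S X Y Z u)"

definition induced_curvature4 ::
  "('m::topological_space, 'b::euclidean_space) chart set \<Rightarrow> ('m \<Rightarrow> 'b \<Rightarrow> 'b \<Rightarrow> real)
    \<Rightarrow> (('m \<Rightarrow> 'b) \<Rightarrow> ('m \<Rightarrow> 'b) \<Rightarrow> 'm \<Rightarrow> 'b) \<Rightarrow> ('h::topological_space \<Rightarrow> 'm) \<Rightarrow> ('h \<Rightarrow> 'b set)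
    \<Rightarrow> 'h \<Rightarrow> 'b \<Rightarrow> 'b \<Rightarrow> 'b \<Rightarrow> 'b \<Rightarrow> real" where
  "induced_curvature4 A g D \<iota> S u x y z w = g (\<iota> u) (induced_curvature A g D \<iota> S u x y z) w"


section \<open>Endomorphisms of a subspace\<close>

text \<open>The trace and the characteristic polynomial do not depend on the basis.\<close>

definition basis_list :: "'b::euclidean_space set \<Rightarrow> 'b list" where
  "basis_list T = (SOME bs. distinct bs \<and> independent (set bs) \<and> span (set bs) = T)"

definition matrix_on :: "'b::euclidean_space set \<Rightarrow> ('b \<Rightarrow> 'b) \<Rightarrow> real Matrix.mat" where
  "matrix_on T L =
     (let bs = basis_list T; m = length bs
      in Matrix.mat m m (\<lambda>(i, j). representation (set bs) (L (bs ! j)) (bs ! i)))"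

definition trace_on :: "'b::euclidean_space set \<Rightarrow> ('b \<Rightarrow> 'b) \<Rightarrow> real" where
  "trace_on T L = (\<Sum>i < dim_row (matrix_on T L). matrix_on T L $$ (i, i))"

definition char_poly_on :: "'b::euclidean_space set \<Rightarrow> ('b \<Rightarrow> 'b) \<Rightarrow> real poly" where
  "char_poly_on T L = char_poly (matrix_on T L)"


section \<open>Admissible screens, the Osserman condition and Ricci semi-symmetry\<close>

definition ricci ::
  "('m::topological_space, 'b::euclidean_space) chart set \<Rightarrow> ('m \<Rightarrow> 'b \<Rightarrow> 'b \<Rightarrow> real)
    \<Rightarrow> (('m \<Rightarrow> 'b) \<Rightarrow> ('m \<Rightarrow> 'b) \<Rightarrow> 'm \<Rightarrow> 'b) \<Rightarrow> ('h::topological_space \<Rightarrow> 'm) \<Rightarrow> ('h \<Rightarrow> 'b set)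
    \<Rightarrow> 'h \<Rightarrow> 'b \<Rightarrow> 'b \<Rightarrow> real" where
  "ricci A g D \<iota> S u x y = trace_on (tangent A \<iota> u) (\<lambda>z. induced_curvature A g D \<iota> S u x z y)"

definition admissible_screen ::
  "('m::topological_space, 'b::euclidean_space) chart set \<Rightarrow> ('m \<Rightarrow> 'b \<Rightarrow> 'b \<Rightarrow> real)
    \<Rightarrow> (('m \<Rightarrow> 'b) \<Rightarrow> ('m \<Rightarrow> 'b) \<Rightarrow> 'm \<Rightarrow> 'b) \<Rightarrow> ('h::topological_space \<Rightarrow> 'm) \<Rightarrow> ('h \<Rightarrow> 'b set)
    \<Rightarrow> bool" where
  "admissible_screen A g D \<iota> S \<longleftrightarrow> screen_distribution A g \<iota> S \<and>
     (\<forall>u. \<forall>x\<in>tangent A \<iota> u. \<forall>y\<in>tangent A \<iota> u. \<forall>z\<in>tangent A \<iota> u. \<forall>w\<in>tangent A \<iota> u.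
        let R = induced_curvature4 A g D \<iota> S u
        in R x y z w = - R y x z w \<and> R x y z w = R z w x y \<and>
           R x y z w + R y z x w + R z x y w = 0)"

definition g_tilde ::
  "('m \<Rightarrow> 'b::euclidean_space \<Rightarrow> 'b \<Rightarrow> real) \<Rightarrow> ('h \<Rightarrow> 'm) \<Rightarrow> ('h \<Rightarrow> 'b set)
    \<Rightarrow> ('h \<Rightarrow> 'b) \<Rightarrow> 'h \<Rightarrow> 'b \<Rightarrow> 'b \<Rightarrow> real" where
  "g_tilde g \<iota> S \<xi> u x y =
     (let \<eta> = g (\<iota> u) (transversal g \<iota> S \<xi> u) in g (\<iota> u) x y + \<eta> x * \<eta> y)"

definition pseudo_jacobi ::
  "('m::topological_space, 'b::euclidean_space) chart set \<Rightarrow> ('m \<Rightarrow> 'b \<Rightarrow> 'b \<Rightarrow> real)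
    \<Rightarrow> (('m \<Rightarrow> 'b) \<Rightarrow> ('m \<Rightarrow> 'b) \<Rightarrow> 'm \<Rightarrow> 'b) \<Rightarrow> ('h::topological_space \<Rightarrow> 'm) \<Rightarrow> ('h \<Rightarrow> 'b set)
    \<Rightarrow> ('h \<Rightarrow> 'b) \<Rightarrow> 'h \<Rightarrow> 'b \<Rightarrow> 'b \<Rightarrow> 'b" where
  "pseudo_jacobi A g D \<iota> S \<xi> u x y =
     (THE v. v \<in> tangent A \<iota> u \<and>
        (\<forall>w\<in>tangent A \<iota> u. g_tilde g \<iota> S \<xi> u v w = induced_curvature4 A g D \<iota> S u y x x w))"

text \<open>The Osserman condition on the vectors with \<open>g(x,x) = \<epsilon>\<close>: timelike for \<open>\<epsilon> = -1\<close>, spacelike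
  for \<open>\<epsilon> = 1\<close>.\<close>

definition osserman_sign_at ::
  "('m::topological_space, 'b::euclidean_space) chart set \<Rightarrow> ('m \<Rightarrow> 'b \<Rightarrow> 'b \<Rightarrow> real)
    \<Rightarrow> (('m \<Rightarrow> 'b) \<Rightarrow> ('m \<Rightarrow> 'b) \<Rightarrow> 'm \<Rightarrow> 'b) \<Rightarrow> ('h::topological_space \<Rightarrow> 'm) \<Rightarrow> real \<Rightarrow> 'h
    \<Rightarrow> bool" where
  "osserman_sign_at A g D \<iota> \<epsilon> u \<longleftrightarrow>
     (\<forall>S U \<xi>. admissible_screen A g D \<iota> S \<and> rad_frame A g \<iota> U \<xi> \<and> u \<in> U \<longrightarrow>
        (\<forall>x\<in>tangent A \<iota> u. \<forall>y\<in>tangent A \<iota> u. g (\<iota> u) x x = \<epsilon> \<and> g (\<iota> u) y y = \<epsilon> \<longrightarrow>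
           char_poly_on (tangent A \<iota> u) (pseudo_jacobi A g D \<iota> S \<xi> u x)
           = char_poly_on (tangent A \<iota> u) (pseudo_jacobi A g D \<iota> S \<xi> u y)))"

definition pointwise_osserman ::
  "('m::topological_space, 'b::euclidean_space) chart set \<Rightarrow> ('m \<Rightarrow> 'b \<Rightarrow> 'b \<Rightarrow> real)
    \<Rightarrow> (('m \<Rightarrow> 'b) \<Rightarrow> ('m \<Rightarrow> 'b) \<Rightarrow> 'm \<Rightarrow> 'b) \<Rightarrow> ('h::topological_space \<Rightarrow> 'm) \<Rightarrow> bool" where
  "pointwise_osserman A g D \<iota> \<longleftrightarrow>
     (\<forall>u. osserman_sign_at A g D \<iota> (-1) u \<and> osserman_sign_at A g D \<iota> 1 u)"

definition ricci_semi_symmetric ::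
  "('m::topological_space, 'b::euclidean_space) chart set \<Rightarrow> ('m \<Rightarrow> 'b \<Rightarrow> 'b \<Rightarrow> real)
    \<Rightarrow> (('m \<Rightarrow> 'b) \<Rightarrow> ('m \<Rightarrow> 'b) \<Rightarrow> 'm \<Rightarrow> 'b) \<Rightarrow> ('h::topological_space \<Rightarrow> 'm) \<Rightarrow> ('h \<Rightarrow> 'b set)
    \<Rightarrow> bool" where
  "ricci_semi_symmetric A g D \<iota> S \<longleftrightarrow>
     (\<forall>U V\<^sub>1 V\<^sub>2 X Y. open U \<and> {V\<^sub>1, V\<^sub>2, X, Y} \<subseteq> sections A \<iota> (tangent A \<iota>) U \<longrightarrow>
        (\<forall>u\<in>U. let R = induced_curvature_field A g D \<iota> S V\<^sub>1 V\<^sub>2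
                in - ricci A g D \<iota> S u (R X u) (Y u) - ricci A g D \<iota> S u (X u) (R Y u) = 0))"

end

theory Submission
  imports Defs
begin

text \<open>Fix a point \<open>u\<close>. Write \<open>T\<close> for the tangent space of the hypersurface at \<open>u\<close>, \<open>\<xi>\<close> for a vector
  spanning the radical and \<open>N\<close> for the transversal vector belonging to \<open>\<xi>\<close>. Once the induced
  curvature \<open>R\<close> is known to be a tensor, the theorem is linear algebra on \<open>T\<close>.

  The Gauss equation (\<open>gauss_equation\<close>) for an ambient space of constant curvature \<open>c\<close> reads
  \<open>R(x,y)z = c(g(y,z)x - g(x,z)y) + h(y,z)Bx - h(x,z)By\<close>, where \<open>h\<close> is the second fundamental form
  and \<open>B\<close> the shape operator of \<open>N\<close>. Since \<open>g(N,N) = 0\<close> all along the hypersurface, \<open>B\<close> takes its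
  values in the screen space (\<open>shape_operator_screen\<close>). Hence \<open>R\<close> has the same component along \<open>\<xi>\<close>
  as the curvature of the space form, and in particular \<open>g(N, R(x,\<xi>)y) = - c g(x,y)\<close>.

  Compute traces on \<open>T\<close> with \<open>\<xi>\<close> and an orthogonal basis \<open>E\<close> of the screen space
  (\<open>trace_on_tangent\<close>), and put \<open>r(x,y) = (\<Sum>e\<in>E. g(R(x,e)y,e) / g(e,e))\<close>. Then
  \<open>Ric(x,y) = r(x,y) - c g(x,y)\<close>. The pseudo-Jacobi operator \<open>J(x)\<close> sends \<open>y\<close> to the projection of
  \<open>R(y,x)x\<close> onto the screen along \<open>\<xi>\<close> (\<open>pseudo_jacobi_eq\<close>), so \<open>trace J(x) = - r(x,x)\<close>. The trace
  is a coefficient of the characteristic polynomial. Therefore the Osserman condition implies that the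
  quadratic form \<open>r(x,x)\<close> is constant on the vectors with \<open>g(x,x) = 1\<close> and on those with
  \<open>g(x,x) = -1\<close>. Admissibility makes \<open>r\<close> symmetric, and a quadratic form that is constant on
  one nonempty such level is proportional to \<open>g\<close> (\<open>proportional_if_constant_on_level\<close>). So
  \<open>Ric = \<kappa> g\<close> on \<open>T\<close> (\<open>ricci_proportional\<close>), and
  \<open>- Ric(R(v,w)x, y) - Ric(x, R(v,w)y) = - \<kappa> (g(R(v,w)x, y) + g(x, R(v,w)y))\<close> vanishes, since the
  symmetries of an algebraic curvature tensor make \<open>R(v,w)\<close> skew.

  The longer part of the development shows that the induced objects, which are specified through
  arbitrary local extensions, exist and obey the Gauss equation. The covariant derivative
  \<open>D X Y\<close> depends on \<open>X\<close> only through its value at the point (\<open>D_tensorial\<close>), and on \<open>Y\<close> only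
  along the hypersurface if \<open>X\<close> is tangent (\<open>D_along\<close>). The bracket of tangent fields is tangent
  (\<open>lie_bracket_tangent\<close>), which rests on the symmetry of second derivatives. Finally, \<open>\<xi>\<close> and \<open>N\<close>
  extend to smooth ambient fields (\<open>adapted_frame_exists\<close>); here \<open>N\<close> is found by the Gram-Schmidt
  process for the indefinite metric.\<close>

section \<open>Calculus of smooth maps\<close>

lemma Ck_on_cong:
  assumes "open S" "\<And>x. x \<in> S \<Longrightarrow> f x = g x" "Ck_on k S f"
  shows "Ck_on k S g"
  using assms(2,3)
proof (induction k arbitrary: f g)
  case 0
  then show ?case by (simp cong: continuous_on_cong)
next
  case (Suc k)
  have d: "(g has_derivative frechet_derivative f (at x)) (at x)" if "x \<in> S" for x
  proof -
    have "(f has_derivative frechet_derivative f (at x)) (at x)"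
      using frechet_derivative_works Suc.prems(2) that by auto
    then show ?thesis
      by (rule has_derivative_transform_within_open[OF _ assms(1) that Suc.prems(1)])
  qed
  then have e: "frechet_derivative g (at x) = frechet_derivative f (at x)" if "x \<in> S" for x
    using that frechet_derivative_at by metis
  show ?case
    using Suc.IH[of "\<lambda>x. frechet_derivative f (at x) v" "\<lambda>x. frechet_derivative g (at x) v" for v]
      Suc.prems d e by (auto simp: differentiable_def)
qed

lemma Ck_on_subset: "Ck_on k T f \<Longrightarrow> S \<subseteq> T \<Longrightarrow> Ck_on k S f"
  by (induction k arbitrary: f) (auto intro: continuous_on_subset)

lemma Ck_on_SucD: "Ck_on (Suc k) S f \<Longrightarrow> Ck_on k S f"
proof (induction k arbitrary: f)
  case 0
  then show ?case
    by (auto intro!: continuous_at_imp_continuous_on differentiable_imp_continuous_within)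
next
  case (Suc k)
  then show ?case by (metis Ck_on.simps(2))
qed

lemma Ck_on_SucI:
  assumes "open S" "\<And>x. x \<in> S \<Longrightarrow> (f has_derivative D x) (at x)" "\<And>v. Ck_on k S (\<lambda>x. D x v)"
  shows "Ck_on (Suc k) S f"
proof -
  have "frechet_derivative f (at x) = D x" if "x \<in> S" for x
    using assms(2)[OF that] frechet_derivative_at by metis
  then show ?thesis
    using assms by (auto simp: differentiable_def intro!: Ck_on_cong[OF assms(1) _ assms(3)])
qed

lemma Ck_on_SucE:
  assumes "Ck_on (Suc k) S f"
  shows "\<And>x. x \<in> S \<Longrightarrow> (f has_derivative frechet_derivative f (at x)) (at x)"
    "\<And>v. Ck_on k S (\<lambda>x. frechet_derivative f (at x) v)" "Ck_on k S f"
  using assms Ck_on_SucD[OF assms] by (auto simp: frechet_derivative_works)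

lemma Ck_on_const: "open S \<Longrightarrow> Ck_on k S (\<lambda>x. a)"
proof (induction k arbitrary: a)
  case (Suc k)
  show ?case by (rule Ck_on_SucI[where D="\<lambda>x v. 0"]) (use Suc in auto)
qed auto

lemma Ck_on_add:
  assumes "open S" "Ck_on k S f" "Ck_on k S g"
  shows "Ck_on k S (\<lambda>x. f x + g x)"
  using assms(2,3)
proof (induction k arbitrary: f g)
  case (Suc k)
  note f = Ck_on_SucE[OF Suc.prems(1)] and g = Ck_on_SucE[OF Suc.prems(2)]
  show ?case
    by (rule Ck_on_SucI[OF assms(1) has_derivative_add[OF f(1) g(1)]]) (auto intro!: Suc.IH f g)
qed (auto intro: continuous_intros)

lemma Ck_on_bilinear:
  assumes "bounded_bilinear h" "open S" "Ck_on k S f" "Ck_on k S g"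
  shows "Ck_on k S (\<lambda>x. h (f x) (g x))"
  using assms(3,4)
proof (induction k arbitrary: f g)
  case 0
  then show ?case using bounded_bilinear.continuous_on[OF assms(1)] by auto
next
  case (Suc k)
  note f = Ck_on_SucE[OF Suc.prems(1)] and g = Ck_on_SucE[OF Suc.prems(2)]
  show ?case
    by (rule Ck_on_SucI[OF assms(2) bounded_bilinear.FDERIV[OF assms(1) f(1) g(1)]])
      (auto intro!: Ck_on_add assms(2) Suc.IH f g)
qed

lemmas Ck_on_scaleR = Ck_on_bilinear[OF bounded_bilinear_scaleR]
  and Ck_on_mult = Ck_on_bilinear[OF bounded_bilinear_mult]

lemma Ck_on_linear:
  assumes "bounded_linear h" "open S" "Ck_on k S f"
  shows "Ck_on k S (\<lambda>x. h (f x))"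
  using assms(3)
proof (induction k arbitrary: f)
  case 0
  then show ?case using bounded_linear.continuous_on[OF assms(1)] by auto
next
  case (Suc k)
  note f = Ck_on_SucE[OF Suc.prems(1)]
  show ?case
    by (rule Ck_on_SucI[OF assms(2) bounded_linear.has_derivative[OF assms(1) f(1)]])
      (auto intro!: Suc.IH f)
qed

lemma Ck_on_sum:
  assumes "open S" "\<And>i. i \<in> I \<Longrightarrow> Ck_on k S (f i)"
  shows "Ck_on k S (\<lambda>x. \<Sum>i\<in>I. f i x)"
proof (cases "finite I")
  case True
  from this assms(2) show ?thesis
    by (induction I rule: finite_induct) (auto intro!: Ck_on_add Ck_on_const assms(1))
qed (simp add: Ck_on_const assms(1))

lemma Ck_on_inverse:
  fixes f :: "'a::euclidean_space \<Rightarrow> real"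
  assumes "open S" "Ck_on k S f" "\<And>x. x \<in> S \<Longrightarrow> f x \<noteq> 0"
  shows "Ck_on k S (\<lambda>x. inverse (f x))"
  using assms(2)
proof (induction k)
  case 0
  then show ?case using assms(3) by (auto intro: continuous_intros)
next
  case (Suc k)
  note f = Ck_on_SucE[OF Suc.prems(1)]
  have "Ck_on k S (\<lambda>x. inverse (f x))" by (rule Suc.IH[OF f(3)])
  then show ?case
    using f(2) assms
    by (intro Ck_on_SucI[OF assms(1) Deriv.has_derivative_inverse[OF assms(3) f(1)]])
      (auto intro!: Ck_on_mult Ck_on_linear[OF bounded_linear_minus[OF bounded_linear_ident]])
qed

lemma has_derivative_sum_Basis:
  assumes "(f has_derivative f') F"
  shows "f' v = (\<Sum>i\<in>Basis. inner v i *\<^sub>R f' i)"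
proof -
  have "linear f'" using assms has_derivative_linear by blast
  then have "f' (\<Sum>i\<in>Basis. inner v i *\<^sub>R i) = (\<Sum>i\<in>Basis. inner v i *\<^sub>R f' i)"
    by (simp add: linear_sum linear_scale)
  then show ?thesis by (simp add: euclidean_representation)
qed

lemma Ck_on_inner_const: "open S \<Longrightarrow> Ck_on k S f \<Longrightarrow> Ck_on k S (\<lambda>x. inner (f x) b)"
  using Ck_on_linear[OF bounded_linear_inner_left] .

text \<open>The chain rule, written in the standard basis, expresses the derivative of \<open>f \<circ> g\<close> through the
  compositions of the partial derivatives of \<open>f\<close> with the same \<open>g\<close>. The induction therefore runs
  over all \<open>f\<close> at once, with \<open>g\<close> fixed.\<close>

lemma Ck_on_compose:
  fixes g :: "'a::euclidean_space \<Rightarrow> 'b::euclidean_space"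
  assumes "open S" "open T" "g ` S \<subseteq> T" "Ck_on k T f" "Ck_on k S g"
  shows "Ck_on k S (\<lambda>x. f (g x))"
  using assms(4,5)
proof (induction k arbitrary: f)
  case 0
  then show ?case using continuous_on_compose2 assms(3) by auto
next
  case (Suc k)
  note f = Ck_on_SucE[OF Suc.prems(1)] and g = Ck_on_SucE[OF Suc.prems(2)]
  have d: "((\<lambda>x. f (g x)) has_derivative
      (\<lambda>v. \<Sum>i\<in>Basis. inner (frechet_derivative g (at x) v) i *\<^sub>R frechet_derivative f (at (g x)) i)) (at x)"
    if "x \<in> S" for x
  proof -
    have fg: "(f has_derivative frechet_derivative f (at (g x))) (at (g x))" using f(1) assms(3) that by auto
    have "(\<lambda>v. frechet_derivative f (at (g x)) (frechet_derivative g (at x) v)) =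
      (\<lambda>v. \<Sum>i\<in>Basis. inner (frechet_derivative g (at x) v) i *\<^sub>R frechet_derivative f (at (g x)) i)"
      by (rule ext, rule has_derivative_sum_Basis[OF fg])
    with has_derivative_compose[OF g(1)[OF that] fg] show ?thesis by argo
  qed
  show ?case
    by (rule Ck_on_SucI[OF assms(1) d])
      (assumption, rule Ck_on_sum[OF assms(1)], rule Ck_on_scaleR[OF assms(1)],
        rule Ck_on_inner_const[OF assms(1) g(2)], rule Suc.IH[OF f(2) g(3)])
qed

lemma Ck_on_derivative_along:
  assumes "open S" "Ck_on (Suc k) S f" "Ck_on k S v"
  shows "Ck_on k S (\<lambda>x. frechet_derivative f (at x) (v x))"
proof (rule Ck_on_cong[OF assms(1)])
  note f = Ck_on_SucE[OF assms(2)]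
  show "(\<Sum>i\<in>Basis. inner (v x) i *\<^sub>R frechet_derivative f (at x) i) = frechet_derivative f (at x) (v x)"
    if "x \<in> S" for x using has_derivative_sum_Basis[OF f(1)[OF that]] by metis
  show "Ck_on k S (\<lambda>x. \<Sum>i\<in>Basis. inner (v x) i *\<^sub>R frechet_derivative f (at x) i)"
    by (intro Ck_on_sum Ck_on_scaleR Ck_on_inner_const assms f)
qed

lemma smooth_on_cong: "open S \<Longrightarrow> (\<And>x. x \<in> S \<Longrightarrow> f x = g x) \<Longrightarrow> smooth_on S f \<Longrightarrow> smooth_on S g"
  unfolding smooth_on_def by (meson Ck_on_cong)

lemma smooth_on_subset: "smooth_on T f \<Longrightarrow> S \<subseteq> T \<Longrightarrow> smooth_on S f"
  unfolding smooth_on_def by (meson Ck_on_subset)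

lemma smooth_on_const: "open S \<Longrightarrow> smooth_on S (\<lambda>x. a)"
  unfolding smooth_on_def by (simp add: Ck_on_const)

lemma smooth_on_add: "open S \<Longrightarrow> smooth_on S f \<Longrightarrow> smooth_on S g \<Longrightarrow> smooth_on S (\<lambda>x. f x + g x)"
  unfolding smooth_on_def by (simp add: Ck_on_add)

lemma smooth_on_bilinear:
  "bounded_bilinear h \<Longrightarrow> open S \<Longrightarrow> smooth_on S f \<Longrightarrow> smooth_on S g \<Longrightarrow> smooth_on S (\<lambda>x. h (f x) (g x))"
  unfolding smooth_on_def by (simp add: Ck_on_bilinear)

lemmas smooth_on_scaleR = smooth_on_bilinear[OF bounded_bilinear_scaleR]
  and smooth_on_mult = smooth_on_bilinear[OF bounded_bilinear_mult]

lemma smooth_on_inner_const: "open S \<Longrightarrow> smooth_on S f \<Longrightarrow> smooth_on S (\<lambda>x. inner (f x) b)"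
  unfolding smooth_on_def by (simp add: Ck_on_inner_const)

lemma smooth_on_inverse:
  fixes f :: "'a::euclidean_space \<Rightarrow> real"
  shows "open S \<Longrightarrow> smooth_on S f \<Longrightarrow> (\<And>x. x \<in> S \<Longrightarrow> f x \<noteq> 0) \<Longrightarrow> smooth_on S (\<lambda>x. inverse (f x))"
  unfolding smooth_on_def by (intro allI Ck_on_inverse) auto

lemma smooth_on_compose:
  fixes g :: "'a::euclidean_space \<Rightarrow> 'b::euclidean_space"
  shows "open S \<Longrightarrow> open T \<Longrightarrow> g ` S \<subseteq> T \<Longrightarrow> smooth_on T f \<Longrightarrow> smooth_on S g \<Longrightarrow> smooth_on S (\<lambda>x. f (g x))"
  unfolding smooth_on_def by (rule allI, rule Ck_on_compose[where T=T]) auto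

lemma smooth_on_derivative_along:
  "open S \<Longrightarrow> smooth_on S f \<Longrightarrow> smooth_on S v \<Longrightarrow> smooth_on S (\<lambda>x. frechet_derivative f (at x) (v x))"
  unfolding smooth_on_def by (rule allI, rule Ck_on_derivative_along) auto

lemma smooth_on_has_derivative:
  "smooth_on S f \<Longrightarrow> x \<in> S \<Longrightarrow> (f has_derivative frechet_derivative f (at x)) (at x)"
  unfolding smooth_on_def using Ck_on_SucE(1) by blast

lemma smooth_on_continuous_on: "smooth_on S f \<Longrightarrow> continuous_on S f"
  unfolding smooth_on_def by (metis Ck_on.simps(1))

text \<open>The left-hand side of the equation is unchanged when \<open>u\<close> and \<open>v\<close> are interchanged, whereas the
  right-hand side turns into the other mixed derivative. It comes from the mean value theorem in
  the direction \<open>u\<close> and then in the direction \<open>v\<close>.\<close>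

lemma second_difference_mean_value:
  fixes f :: "'a::euclidean_space \<Rightarrow> real"
  assumes "r > 0" and B: "\<And>s t. 0 \<le> s \<Longrightarrow> s \<le> r \<Longrightarrow> 0 \<le> t \<Longrightarrow> t \<le> r \<Longrightarrow> x + s *\<^sub>R u + t *\<^sub>R v \<in> S"
    and f: "\<And>y. y \<in> S \<Longrightarrow> (f has_derivative f' y) (at y)"
    and f': "\<And>y. y \<in> S \<Longrightarrow> ((\<lambda>y. f' y u) has_derivative f'' y) (at y)"
  shows "\<exists>s t. 0 < s \<and> s < r \<and> 0 < t \<and> t < r \<and>
    f (x + r *\<^sub>R u + r *\<^sub>R v) - f (x + r *\<^sub>R u) - f (x + r *\<^sub>R v) + f x
      = r * r * f'' (x + s *\<^sub>R u + t *\<^sub>R v) v"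
proof -
  let ?h = "\<lambda>s. f (x + s *\<^sub>R u + r *\<^sub>R v) - f (x + s *\<^sub>R u)"
  have fl: "((\<lambda>s. f (x + s *\<^sub>R u + t *\<^sub>R v)) has_real_derivative f' (x + s *\<^sub>R u + t *\<^sub>R v) u) (at s)"
    if "0 \<le> s" "s \<le> r" "0 \<le> t" "t \<le> r" for s t
  proof -
    have g: "((\<lambda>s. x + s *\<^sub>R u + t *\<^sub>R v) has_derivative (\<lambda>h. h *\<^sub>R u)) (at s)"
      by (auto intro!: derivative_eq_intros)
    have "linear (f' (x + s *\<^sub>R u + t *\<^sub>R v))"
      using f[OF B[OF that]] has_derivative_linear by blast
    then show ?thesis
      using has_derivative_compose[OF g f[OF B[OF that]]]
      by (simp add: has_field_derivative_def linear_scale) (simp add: mult_commute_abs)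
  qed
  have "(?h has_real_derivative f' (x + s *\<^sub>R u + r *\<^sub>R v) u - f' (x + s *\<^sub>R u) u) (at s)"
    if "0 \<le> s" "s \<le> r" for s
    using DERIV_diff[OF fl[OF that] fl[OF that], of r 0] assms(1) by simp
  from MVT2[OF assms(1) this] obtain s where s: "0 < s" "s < r"
    "?h r - ?h 0 = r * (f' (x + s *\<^sub>R u + r *\<^sub>R v) u - f' (x + s *\<^sub>R u) u)" by auto
  have "((\<lambda>t. f' (x + s *\<^sub>R u + t *\<^sub>R v) u) has_real_derivative f'' (x + s *\<^sub>R u + t *\<^sub>R v) v) (at t)"
    if "0 \<le> t" "t \<le> r" for t
  proof -
    have g: "((\<lambda>t. x + s *\<^sub>R u + t *\<^sub>R v) has_derivative (\<lambda>h. h *\<^sub>R v)) (at t)"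
      by (auto intro!: derivative_eq_intros)
    have m: "x + s *\<^sub>R u + t *\<^sub>R v \<in> S" using B s that by auto
    have "linear (f'' (x + s *\<^sub>R u + t *\<^sub>R v))"
      using f'[OF m] has_derivative_linear by blast
    then show ?thesis
      using has_derivative_compose[OF g f'[OF m]]
      by (simp add: has_field_derivative_def linear_scale) (simp add: mult_commute_abs)
  qed
  from MVT2[OF assms(1) this] obtain t where "0 < t" "t < r"
    "f' (x + s *\<^sub>R u + r *\<^sub>R v) u - f' (x + s *\<^sub>R u) u = r * f'' (x + s *\<^sub>R u + t *\<^sub>R v) v" by auto
  with s show ?thesis by (intro exI[of _ s] exI[of _ t]) auto
qed

text \<open>If the two mixed derivatives differed at \<open>x\<close>, then by continuity their values on a whole
  neighbourhood would be separated; but the second difference over a small parallelogram at \<open>x\<close> is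
  a multiple of a nearby value of each of them.\<close>

lemma second_derivative_symmetric:
  fixes f :: "'a::euclidean_space \<Rightarrow> real"
  assumes "open S" "smooth_on S f" "x \<in> S"
  shows "frechet_derivative (\<lambda>y. frechet_derivative f (at y) u) (at x) v
    = frechet_derivative (\<lambda>y. frechet_derivative f (at y) v) (at x) u"
proof (rule ccontr)
  let ?D = "\<lambda>u v y. frechet_derivative (\<lambda>y. frechet_derivative f (at y) u) (at y) v"
  assume ne: "\<not> ?thesis"
  have sm1: "smooth_on S (\<lambda>y. frechet_derivative f (at y) u)" for u
    by (intro smooth_on_derivative_along smooth_on_const assms)
  have sm: "continuous_on S (?D u v)" for u v
    by (intro smooth_on_continuous_on smooth_on_derivative_along smooth_on_const sm1 assms(1))
  define d where "d = \<bar>?D u v x - ?D v u x\<bar> / 2"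
  have "d > 0" using ne by (simp add: d_def)
  then obtain e1 e2 where e: "e1 > 0" "\<And>y. y \<in> S \<Longrightarrow> dist y x < e1 \<Longrightarrow> dist (?D u v y) (?D u v x) < d"
    "e2 > 0" "\<And>y. y \<in> S \<Longrightarrow> dist y x < e2 \<Longrightarrow> dist (?D v u y) (?D v u x) < d"
    using sm[of u v] sm[of v u] assms(3) unfolding continuous_on_iff by metis
  obtain e3 where e3: "e3 > 0" "ball x e3 \<subseteq> S" using assms open_contains_ball by blast
  define e0 where "e0 = min e3 (min e1 e2)"
  have e0: "e0 > 0" "e0 \<le> e3" "e0 \<le> e1" "e0 \<le> e2" using e e3 by (auto simp: e0_def)
  \<comment> \<open>the parallelogram with sides \<open>r u\<close> and \<open>r v\<close> stays within distance \<open>e0\<close> of \<open>x\<close>\<close>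
  define K where "K = norm u + norm v + 1"
  define r where "r = e0 / (2 * K)"
  have np: "K > 0" unfolding K_def using norm_ge_zero[of u] norm_ge_zero[of v] by linarith
  have "r > 0" using e0 np by (simp add: r_def)
  have near: "dist (x + s *\<^sub>R u + t *\<^sub>R v) x < e0" if "0 \<le> s" "s \<le> r" "0 \<le> t" "t \<le> r" for s t
  proof -
    have "dist (x + s *\<^sub>R u + t *\<^sub>R v) x = norm (s *\<^sub>R u + t *\<^sub>R v)"
      by (simp add: dist_norm algebra_simps)
    also have "\<dots> \<le> s * norm u + t * norm v"
      using norm_triangle_ineq[of "s *\<^sub>R u" "t *\<^sub>R v"] that by simp
    also have "\<dots> \<le> r * norm u + r * norm v"
      by (intro add_mono mult_right_mono) (use that in auto)
    also have "\<dots> \<le> r * K"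
      using \<open>r > 0\<close> by (simp add: K_def algebra_simps)
    also have "\<dots> = e0 / 2" using np by (simp add: r_def)
    finally show ?thesis using e0 by simp
  qed
  then have inS: "x + s *\<^sub>R u + t *\<^sub>R v \<in> S" if "0 \<le> s" "s \<le> r" "0 \<le> t" "t \<le> r" for s t
  proof -
    have "x + s *\<^sub>R u + t *\<^sub>R v \<in> ball x e3"
      using near[OF that] e0(2) by (simp add: dist_commute)
    then show ?thesis using e3 by blast
  qed
  note hd = smooth_on_has_derivative[OF assms(2)] and hd1 = smooth_on_has_derivative[OF sm1]
  obtain s t where st: "0 < s" "s < r" "0 < t" "t < r"
    "f (x + r *\<^sub>R u + r *\<^sub>R v) - f (x + r *\<^sub>R u) - f (x + r *\<^sub>R v) + f x
      = r * r * ?D u v (x + s *\<^sub>R u + t *\<^sub>R v)"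
    using second_difference_mean_value[OF \<open>r > 0\<close> inS hd hd1] by blast
  have inS': "x + s *\<^sub>R v + t *\<^sub>R u \<in> S" if "0 \<le> s" "s \<le> r" "0 \<le> t" "t \<le> r" for s t
    using inS[of t s] that by (simp add: add_ac)
  obtain s' t' where st': "0 < s'" "s' < r" "0 < t'" "t' < r"
    "f (x + r *\<^sub>R v + r *\<^sub>R u) - f (x + r *\<^sub>R v) - f (x + r *\<^sub>R u) + f x
      = r * r * ?D v u (x + s' *\<^sub>R v + t' *\<^sub>R u)"
    using second_difference_mean_value[OF \<open>r > 0\<close> inS' hd hd1] by blast
  have "r * r * ?D u v (x + s *\<^sub>R u + t *\<^sub>R v) = r * r * ?D v u (x + s' *\<^sub>R v + t' *\<^sub>R u)"
  proof -
    have c: "x + r *\<^sub>R v + r *\<^sub>R u = x + r *\<^sub>R u + r *\<^sub>R v" by (simp add: add_ac)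
    show ?thesis using st(5) st'(5) unfolding c by linarith
  qed
  then have eq: "?D u v (x + s *\<^sub>R u + t *\<^sub>R v) = ?D v u (x + t' *\<^sub>R u + s' *\<^sub>R v)"
    using \<open>r > 0\<close> by (simp add: add_ac)
  have "dist (?D u v (x + s *\<^sub>R u + t *\<^sub>R v)) (?D u v x) < d"
    using st near[of s t] inS[of s t] e(2) e0 by auto
  moreover have "dist (?D v u (x + t' *\<^sub>R u + s' *\<^sub>R v)) (?D v u x) < d"
    using st' near[of t' s'] inS[of t' s'] e(4) e0 by auto
  ultimately show False using eq unfolding d_def dist_real_def by argo
qed

text \<open>The product rule for \<open>y \<mapsto> f'(y)(Y y)\<close>. In the second-order term the arguments are interchanged,
  so that antisymmetrising in two fields leaves only the terms with the derivatives of the fields.\<close>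

lemma frechet_derivative_derivative_along:
  fixes f :: "'a::euclidean_space \<Rightarrow> real"
  assumes "open S" "smooth_on S f" "smooth_on S Y" "x \<in> S"
  shows "frechet_derivative (\<lambda>y. frechet_derivative f (at y) (Y y)) (at x) v
    = frechet_derivative f (at x) (frechet_derivative Y (at x) v)
      + frechet_derivative (\<lambda>y. frechet_derivative f (at y) v) (at x) (Y x)"
proof -
  let ?f = "\<lambda>y. frechet_derivative f (at y)"
  let ?H = "\<lambda>u. frechet_derivative (\<lambda>y. ?f y u) (at x)"
  have sm: "smooth_on S (\<lambda>y. ?f y u)" for u
    by (intro smooth_on_derivative_along smooth_on_const assms)
  have f: "(f has_derivative ?f y) (at y)" if "y \<in> S" for y
    using smooth_on_has_derivative[OF assms(2) that] .
  have H: "((\<lambda>y. ?f y u) has_derivative ?H u) (at x)" for u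
    using smooth_on_has_derivative[OF sm assms(4)] .
  have Y: "(Y has_derivative frechet_derivative Y (at x)) (at x)"
    using smooth_on_has_derivative[OF assms(3,4)] .
  have "((\<lambda>y. \<Sum>i\<in>Basis. inner (Y y) i * ?f y i) has_derivative
      (\<lambda>v. \<Sum>i\<in>Basis. inner (Y x) i * ?H i v + inner (frechet_derivative Y (at x) v) i * ?f x i)) (at x)"
    by (intro has_derivative_sum has_derivative_mult has_derivative_inner_left Y H)
  moreover have "(\<Sum>i\<in>Basis. inner (Y y) i * ?f y i) = ?f y (Y y)" if "y \<in> S" for y
    using has_derivative_sum_Basis[OF f[OF that], of "Y y"] by simp
  ultimately have "((\<lambda>y. ?f y (Y y)) has_derivative
      (\<lambda>v. \<Sum>i\<in>Basis. inner (Y x) i * ?H i v + inner (frechet_derivative Y (at x) v) i * ?f x i)) (at x)"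
    by (rule has_derivative_transform_within_open[OF _ assms(1,4)])
  from frechet_derivative_at[OF this, symmetric]
  have "frechet_derivative (\<lambda>y. ?f y (Y y)) (at x) v =
      (\<Sum>i\<in>Basis. inner (Y x) i * ?H i v) + (\<Sum>i\<in>Basis. inner (frechet_derivative Y (at x) v) i * ?f x i)"
    by (simp add: sum.distrib)
  also have "(\<Sum>i\<in>Basis. inner (Y x) i * ?H i v) = (\<Sum>i\<in>Basis. inner (Y x) i * ?H v i)"
    using second_derivative_symmetric[OF assms(1,2,4), of _ v] by simp
  also have "\<dots> = ?H v (Y x)"
    using has_derivative_sum_Basis[OF H[of v], of "Y x"] by simp
  also have "(\<Sum>i\<in>Basis. inner (frechet_derivative Y (at x) v) i * ?f x i)
      = ?f x (frechet_derivative Y (at x) v)"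
    using has_derivative_sum_Basis[OF f[OF assms(4)], of "frechet_derivative Y (at x) v"] by simp
  finally show ?thesis by simp
qed

section \<open>Charts, vector fields and functions\<close>

definition transition_deriv :: "('m, 'b::euclidean_space) chart \<Rightarrow> ('m, 'b) chart \<Rightarrow> 'm \<Rightarrow> 'b \<Rightarrow> 'b" where
  "transition_deriv c d p = frechet_derivative (snd d \<circ> chart_inv c) (at (snd c p))"

text \<open>The field with the constant components \<open>e\<close> in the chart \<open>c\<close>: its value at \<open>p\<close> has to be translated
  to the preferred chart at \<open>p\<close>. These fields are the coordinate frame on the domain of \<open>c\<close>.\<close>

definition coord_field ::
  "('m, 'b::euclidean_space) chart set \<Rightarrow> ('m, 'b) chart \<Rightarrow> 'b \<Rightarrow> 'm \<Rightarrow> 'b" where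
  "coord_field A c e p = transition_deriv c (chart_at A p) p e"

lemma components_transition_deriv: "components A c p v = transition_deriv (chart_at A p) c p v"
  by (simp add: components_def transition_deriv_def)

locale smooth_manifold =
  fixes A :: "('m::t2_space, 'b::euclidean_space) chart set"
  assumes atlas: "smooth_atlas A"
begin

lemma chart: "c \<in> A \<Longrightarrow> is_chart c"
  using atlas by (auto simp: smooth_atlas_def)

lemma chart_at: "chart_at A p \<in> A" "p \<in> fst (chart_at A p)"
proof -
  have "\<exists>c. c \<in> A \<and> p \<in> fst c" using atlas unfolding smooth_atlas_def by blast
  then have "chart_at A p \<in> A \<and> p \<in> fst (chart_at A p)"
    unfolding chart_at_def by (rule someI_ex)
  then show "chart_at A p \<in> A" "p \<in> fst (chart_at A p)" by auto
qed

lemma chart_homeomorphism: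
  "c \<in> A \<Longrightarrow> homeomorphism (fst c) (snd c ` fst c) (snd c) (chart_inv c)"
  using chart by (auto simp: is_chart_def)

lemma chart_inv_left [simp]: "c \<in> A \<Longrightarrow> p \<in> fst c \<Longrightarrow> chart_inv c (snd c p) = p"
  using chart_homeomorphism homeomorphism_apply1 by blast

lemma open_chart_domain: "c \<in> A \<Longrightarrow> open (fst c)"
  using chart by (auto simp: is_chart_def)

lemma open_chart_image:
  assumes "c \<in> A" "open W" shows "open (snd c ` (fst c \<inter> W))"
proof -
  have "openin (top_of_set (snd c ` fst c)) (snd c ` (fst c \<inter> W))"
    using homeomorphism_imp_open_map[OF chart_homeomorphism[OF assms(1)]] assms(2) by blast
  then show ?thesis
    using chart[OF assms(1)] openin_open_trans unfolding is_chart_def by blast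
qed

lemma transition_smooth:
  "c \<in> A \<Longrightarrow> d \<in> A \<Longrightarrow> smooth_on (snd c ` (fst c \<inter> fst d)) (snd d \<circ> chart_inv c)"
  using atlas unfolding smooth_atlas_def compatible_def by blast

lemma transition_has_derivative:
  assumes "c \<in> A" "d \<in> A" "p \<in> fst c" "p \<in> fst d"
  shows "(snd d \<circ> chart_inv c has_derivative transition_deriv c d p) (at (snd c p))"
  unfolding transition_deriv_def by (rule smooth_on_has_derivative[OF transition_smooth]) (use assms in auto)

lemma linear_transition_deriv:
  "c \<in> A \<Longrightarrow> d \<in> A \<Longrightarrow> p \<in> fst c \<Longrightarrow> p \<in> fst d \<Longrightarrow> linear (transition_deriv c d p)"
  using transition_has_derivative has_derivative_linear by blast

text \<open>The cocycle rule. It makes \<open>components A c p\<close> an isomorphism of the tangent space at \<open>p\<close> for each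
  chart \<open>c\<close> around \<open>p\<close>.\<close>

lemma transition_deriv_compose:
  assumes "c \<in> A" "d \<in> A" "e \<in> A" "p \<in> fst c" "p \<in> fst d" "p \<in> fst e"
  shows "transition_deriv d e p (transition_deriv c d p v) = transition_deriv c e p v"
proof -
  let ?O = "snd c ` (fst c \<inter> (fst d \<inter> fst e))"
  have O: "open ?O" using assms by (intro open_chart_image) (auto intro: open_chart_domain)
  have p: "(snd d \<circ> chart_inv c) (snd c p) = snd d p" using assms by simp
  have e: "((\<lambda>a. snd e (chart_inv d a)) has_derivative transition_deriv d e p) (at (snd d p))"
    using transition_has_derivative[of d e p] assms by (simp add: o_def)
  have "((snd e \<circ> chart_inv d) \<circ> (snd d \<circ> chart_inv c) has_derivative (\<lambda>v. transition_deriv d e p (transition_deriv c d p v)))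
      (at (snd c p))"
    unfolding o_def[of "snd e \<circ> chart_inv d"]
    by (rule has_derivative_compose[OF transition_has_derivative])
      (use assms e p in auto)
  then have "(snd e \<circ> chart_inv c has_derivative (\<lambda>v. transition_deriv d e p (transition_deriv c d p v))) (at (snd c p))"
    by (rule has_derivative_transform_within_open[OF _ O]) (use assms in auto)
  from has_derivative_unique[OF this transition_has_derivative] assms show ?thesis by metis
qed

lemma transition_deriv_self: "c \<in> A \<Longrightarrow> p \<in> fst c \<Longrightarrow> transition_deriv c c p v = v"
proof -
  assume a: "c \<in> A" "p \<in> fst c"
  have "open (snd c ` fst c)" using open_chart_image[OF a(1), of UNIV] by simp
  then have "(snd c \<circ> chart_inv c has_derivative (\<lambda>v. v)) (at (snd c p))"
    by (rule has_derivative_transform_within_open[OF has_derivative_ident]) (use a in auto)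
  from has_derivative_unique[OF this transition_has_derivative] a show ?thesis by metis
qed

lemma linear_components: "c \<in> A \<Longrightarrow> p \<in> fst c \<Longrightarrow> linear (components A c p)"
  using linear_transition_deriv[OF chart_at(1) _ chart_at(2)] components_transition_deriv
  by (metis ext)

lemma components_change:
  "c \<in> A \<Longrightarrow> d \<in> A \<Longrightarrow> p \<in> fst c \<Longrightarrow> p \<in> fst d \<Longrightarrow>
    components A d p v = transition_deriv c d p (components A c p v)"
  by (simp add: components_transition_deriv transition_deriv_compose chart_at)

lemma components_chart_at [simp]: "components A (chart_at A p) p v = v"
  by (simp add: components_transition_deriv transition_deriv_self chart_at)

lemma components_coord_field [simp]:
  "c \<in> A \<Longrightarrow> p \<in> fst c \<Longrightarrow> components A c p (coord_field A c e p) = e"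
  by (simp add: components_transition_deriv coord_field_def transition_deriv_compose transition_deriv_self chart_at)

lemma coord_field_components [simp]:
  "c \<in> A \<Longrightarrow> p \<in> fst c \<Longrightarrow> coord_field A c (components A c p v) p = v"
  by (simp add: components_transition_deriv coord_field_def transition_deriv_compose transition_deriv_self chart_at)

lemma linear_coord_field: "c \<in> A \<Longrightarrow> p \<in> fst c \<Longrightarrow> linear (\<lambda>e. coord_field A c e p)"
  unfolding coord_field_def by (simp add: linear_transition_deriv chart_at)

lemma coord_expansion:
  assumes "c \<in> A" "p \<in> fst c"
  shows "v = (\<Sum>b\<in>Basis. inner (components A c p v) b *\<^sub>R coord_field A c b p)"
proof -
  have "coord_field A c (\<Sum>b\<in>Basis. inner (components A c p v) b *\<^sub>R b) p
      = (\<Sum>b\<in>Basis. inner (components A c p v) b *\<^sub>R coord_field A c b p)"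
    by (simp add: linear_sum[OF linear_coord_field[OF assms]] linear_scale[OF linear_coord_field[OF assms]])
  then show ?thesis using assms by (simp add: euclidean_representation)
qed

lemma vf_in_chart_at: "c \<in> A \<Longrightarrow> p \<in> fst c \<Longrightarrow> vf_in_chart A c X (snd c p) = components A c p (X p)"
  by (simp add: vf_in_chart_def)

text \<open>On a set inside one chart domain, smoothness in that chart is enough, because the
  transition maps are smooth.\<close>

lemma smooth_function_onI:
  assumes "c \<in> A" "open W" "W \<subseteq> fst c" "smooth_on (snd c ` W) (f \<circ> chart_inv c)"
  shows "smooth_function_on A W f"
  unfolding smooth_function_on_def
proof
  fix d assume d: "d \<in> A"
  have "snd d ` (fst d \<inter> W) \<subseteq> snd d ` (fst d \<inter> fst c)" using assms by auto
  then have sm: "smooth_on (snd d ` (fst d \<inter> W)) (snd c \<circ> chart_inv d)"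
    using transition_smooth[OF d assms(1)] smooth_on_subset by blast
  have oc: "open (snd c ` W)" using open_chart_image[OF assms(1,2)] assms(3) by (simp add: Int_absorb1)
  have "smooth_on (snd d ` (fst d \<inter> W)) (\<lambda>y. (f \<circ> chart_inv c) ((snd c \<circ> chart_inv d) y))"
    by (rule smooth_on_compose[OF open_chart_image[OF d assms(2)] oc _ assms(4) sm]) (use d in auto)
  then show "smooth_on (snd d ` (fst d \<inter> W)) (f \<circ> chart_inv d)"
    by (rule smooth_on_cong[OF open_chart_image[OF d assms(2)], rotated]) (use d assms in auto)
qed

text \<open>The components in another chart arise by applying the derivative of the transition map, which is
  again smooth; so one chart is enough for fields as well.\<close>

lemma smooth_field_onI:
  assumes "c \<in> A" "open W" "W \<subseteq> fst c" "smooth_on (snd c ` W) (vf_in_chart A c X)"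
  shows "smooth_field_on A W X"
  unfolding smooth_field_on_def
proof
  fix d assume d: "d \<in> A"
  let ?O = "snd d ` (fst d \<inter> W)" and ?P = "snd c ` (fst c \<inter> (fst d \<inter> W))"
  have O: "open ?O" "open ?P"
    using assms d by (auto intro!: open_chart_image open_chart_domain)
  have "?O \<subseteq> snd d ` (fst d \<inter> fst c)" using assms by auto
  then have sm: "smooth_on ?O (snd c \<circ> chart_inv d)"
    using transition_smooth[OF d assms(1)] smooth_on_subset by blast
  have "smooth_on ?P (snd d \<circ> chart_inv c)"
    by (rule smooth_on_subset[OF transition_smooth[OF assms(1) d]]) auto
  moreover have "smooth_on ?P (vf_in_chart A c X)"
    by (rule smooth_on_subset[OF assms(4)]) auto
  ultimately have h: "smooth_on ?P (\<lambda>x. frechet_derivative (snd d \<circ> chart_inv c) (at x) (vf_in_chart A c X x))"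
    by (rule smooth_on_derivative_along[OF O(2)])
  have "smooth_on ?O (\<lambda>y. frechet_derivative (snd d \<circ> chart_inv c) (at ((snd c \<circ> chart_inv d) y))
      (vf_in_chart A c X ((snd c \<circ> chart_inv d) y)))"
    by (rule smooth_on_compose[OF O _ h sm]) (use d assms in auto)
  then show "smooth_on ?O (vf_in_chart A d X)"
  proof (rule smooth_on_cong[OF O(1), rotated])
    fix y assume "y \<in> ?O"
    then obtain p where p: "p \<in> fst d" "p \<in> W" "y = snd d p" by auto
    then have "p \<in> fst c" using assms by auto
    with p d assms(1) show "frechet_derivative (snd d \<circ> chart_inv c) (at ((snd c \<circ> chart_inv d) y))
      (vf_in_chart A c X ((snd c \<circ> chart_inv d) y)) = vf_in_chart A d X y"
      by (simp add: vf_in_chart_at) (simp add: components_change[of c d] transition_deriv_def)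
  qed
qed

lemma smooth_function_on_subset:
  "smooth_function_on A W f \<Longrightarrow> V \<subseteq> W \<Longrightarrow> smooth_function_on A V f"
  unfolding smooth_function_on_def by (meson Int_mono image_mono order_refl smooth_on_subset)

lemma smooth_field_on_subset:
  "smooth_field_on A W X \<Longrightarrow> V \<subseteq> W \<Longrightarrow> smooth_field_on A V X"
  unfolding smooth_field_on_def by (meson Int_mono image_mono order_refl smooth_on_subset)

lemma smooth_field_on_cong:
  assumes "open W" "\<And>p. p \<in> W \<Longrightarrow> X p = Y p" "smooth_field_on A W X"
  shows "smooth_field_on A W Y"
  unfolding smooth_field_on_def
proof
  fix c assume c: "c \<in> A"
  with assms(3) have "smooth_on (snd c ` (fst c \<inter> W)) (vf_in_chart A c X)" by (simp add: smooth_field_on_def)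
  then show "smooth_on (snd c ` (fst c \<inter> W)) (vf_in_chart A c Y)"
    by (rule smooth_on_cong[OF open_chart_image[OF c assms(1)], rotated])
      (use c assms(2) in \<open>auto simp: vf_in_chart_def\<close>)
qed

lemma smooth_function_on_const: "open W \<Longrightarrow> smooth_function_on A W (\<lambda>p. a)"
  unfolding smooth_function_on_def o_def by (auto intro: smooth_on_const open_chart_image)

lemma smooth_function_on_mult:
  "open W \<Longrightarrow> smooth_function_on A W f \<Longrightarrow> smooth_function_on A W g
    \<Longrightarrow> smooth_function_on A W (\<lambda>p. f p * g p)"
  unfolding smooth_function_on_def o_def by (auto intro: smooth_on_mult open_chart_image)

lemma smooth_function_on_inverse:
  assumes "open W" "smooth_function_on A W f" "\<And>p. p \<in> W \<Longrightarrow> f p \<noteq> 0"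
  shows "smooth_function_on A W (\<lambda>p. inverse (f p))"
  unfolding smooth_function_on_def
proof
  fix c assume c: "c \<in> A"
  show "smooth_on (snd c ` (fst c \<inter> W)) ((\<lambda>p. inverse (f p)) \<circ> chart_inv c)"
    unfolding o_def using assms c
    by (intro smooth_on_inverse open_chart_image) (auto simp: smooth_function_on_def o_def)
qed

lemma smooth_field_on_add:
  assumes "open W" "smooth_field_on A W X" "smooth_field_on A W Y"
  shows "smooth_field_on A W (\<lambda>p. X p + Y p)"
  unfolding smooth_field_on_def
proof
  fix c assume c: "c \<in> A"
  have "smooth_on (snd c ` (fst c \<inter> W)) (\<lambda>x. vf_in_chart A c X x + vf_in_chart A c Y x)"
    using assms c by (auto intro!: smooth_on_add open_chart_image simp: smooth_field_on_def)
  then show "smooth_on (snd c ` (fst c \<inter> W)) (vf_in_chart A c (\<lambda>p. X p + Y p))"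
    by (rule smooth_on_cong[OF open_chart_image[OF c assms(1)], rotated])
      (use c in \<open>auto simp: vf_in_chart_def linear_add[OF linear_components]\<close>)
qed

lemma smooth_field_on_scale:
  assumes "open W" "smooth_function_on A W f" "smooth_field_on A W X"
  shows "smooth_field_on A W (\<lambda>p. f p *\<^sub>R X p)"
  unfolding smooth_field_on_def
proof
  fix c assume c: "c \<in> A"
  have "smooth_on (snd c ` (fst c \<inter> W)) (\<lambda>x. (f \<circ> chart_inv c) x *\<^sub>R vf_in_chart A c X x)"
    using assms c
    by (intro smooth_on_scaleR open_chart_image) (auto simp: smooth_field_on_def smooth_function_on_def o_def)
  then show "smooth_on (snd c ` (fst c \<inter> W)) (vf_in_chart A c (\<lambda>p. f p *\<^sub>R X p))"
    by (rule smooth_on_cong[OF open_chart_image[OF c assms(1)], rotated])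
      (use c in \<open>auto simp: vf_in_chart_def linear_scale[OF linear_components]\<close>)
qed

lemma smooth_field_on_cscale:
  "open W \<Longrightarrow> smooth_field_on A W X \<Longrightarrow> smooth_field_on A W (\<lambda>p. a *\<^sub>R X p)"
  using smooth_field_on_scale[OF _ smooth_function_on_const] .

lemma smooth_field_on_diff:
  assumes "open W" "smooth_field_on A W X" "smooth_field_on A W Y"
  shows "smooth_field_on A W (\<lambda>p. X p - Y p)"
  using smooth_field_on_add[OF assms(1,2) smooth_field_on_cscale[OF assms(1,3), of "-1"]] by simp

lemma smooth_field_on_zero: "open W \<Longrightarrow> smooth_field_on A W (\<lambda>p. 0)"
proof -
  assume W: "open W"
  have "smooth_on (snd c ` (fst c \<inter> W)) (vf_in_chart A c (\<lambda>p. 0))" if c: "c \<in> A" for c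
    by (rule smooth_on_cong[OF open_chart_image[OF c W] _ smooth_on_const[OF open_chart_image[OF c W], of 0]])
      (use c in \<open>auto simp: vf_in_chart_def linear_0[OF linear_components]\<close>)
  then show ?thesis by (simp add: smooth_field_on_def)
qed

lemma smooth_field_on_sum:
  assumes "open W" "finite I" "\<And>i. i \<in> I \<Longrightarrow> smooth_field_on A W (X i)"
  shows "smooth_field_on A W (\<lambda>p. \<Sum>i\<in>I. X i p)"
  using assms(2,3)
  by (induction I rule: finite_induct) (auto intro: smooth_field_on_zero smooth_field_on_add assms(1))

lemma smooth_coord_field: "c \<in> A \<Longrightarrow> smooth_field_on A (fst c) (coord_field A c e)"
proof (rule smooth_field_onI[OF _ open_chart_domain order_refl])
  assume c: "c \<in> A"
  have O: "open (snd c ` fst c)" using open_chart_image[OF c, of UNIV] by simp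
  show "smooth_on (snd c ` fst c) (vf_in_chart A c (coord_field A c e))"
    by (rule smooth_on_cong[OF O _ smooth_on_const[OF O, of e]])
      (use c in \<open>auto simp: vf_in_chart_def\<close>)
qed

lemma smooth_coefficient:
  assumes "c \<in> A" "open W" "W \<subseteq> fst c" "smooth_field_on A W X"
  shows "smooth_function_on A W (\<lambda>p. inner (components A c p (X p)) b)"
proof (rule smooth_function_onI[OF assms(1-3)])
  have O: "open (snd c ` W)" using open_chart_image[OF assms(1,2)] assms(3) by (simp add: Int_absorb1)
  have "smooth_on (snd c ` W) (vf_in_chart A c X)"
    using assms by (auto simp: smooth_field_on_def Int_absorb1)
  from smooth_on_inner_const[OF O this, of b]
  show "smooth_on (snd c ` W) ((\<lambda>p. inner (components A c p (X p)) b) \<circ> chart_inv c)"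
    by (simp add: vf_in_chart_def o_def)
qed

lemma smooth_function_isCont:
  assumes "open W" "smooth_function_on A W f" "p \<in> W"
  shows "isCont f p"
proof -
  define c where "c = chart_at A p"
  have c: "c \<in> A" "p \<in> fst c" using chart_at by (auto simp: c_def)
  have "continuous_on (fst c \<inter> W) (snd c)"
    using homeomorphism_cont1[OF chart_homeomorphism[OF c(1)]] continuous_on_subset by blast
  moreover have "continuous_on (snd c ` (fst c \<inter> W)) (f \<circ> chart_inv c)"
    using assms(2) c by (intro smooth_on_continuous_on) (simp add: smooth_function_on_def)
  ultimately have "continuous_on (fst c \<inter> W) ((f \<circ> chart_inv c) \<circ> snd c)"
    by (rule continuous_on_compose)
  then have "continuous_on (fst c \<inter> W) f"
    by (rule continuous_on_eq) (use c in auto)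
  then show ?thesis
    using c assms open_chart_domain by (metis IntI continuous_on_eq_continuous_at open_Int)
qed

lemma open_nonzero:
  fixes f :: "'m \<Rightarrow> real"
  assumes "open W" "smooth_function_on A W f"
  shows "open {p \<in> W. f p \<noteq> 0}"
proof -
  have "continuous_on W f"
    using smooth_function_isCont[OF assms] continuous_at_imp_continuous_on by blast
  then have "open (W \<inter> f -` (- {0}))"
    by (rule continuous_open_preimage) (use assms in auto)
  moreover have "W \<inter> f -` (- {0}) = {p \<in> W. f p \<noteq> 0}" by auto
  ultimately show ?thesis by simp
qed

text \<open>The differential is defined in the preferred chart at each point, which may jump from point to point.
  In a fixed chart it becomes the derivative of one smooth function.\<close>

lemma differential_in_chart:
  assumes "c \<in> A" "p \<in> fst c" "open W" "p \<in> W" "smooth_function_on A W f"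
  shows "differential A f p v = frechet_derivative (f \<circ> chart_inv c) (at (snd c p)) (components A c p v)"
    "(f \<circ> chart_inv c has_derivative frechet_derivative (f \<circ> chart_inv c) (at (snd c p))) (at (snd c p))"
proof -
  have hd: "(f \<circ> chart_inv c has_derivative frechet_derivative (f \<circ> chart_inv c) (at (snd c p))) (at (snd c p))"
    if "c \<in> A" "p \<in> fst c" for c
  proof (rule smooth_on_has_derivative)
    show "smooth_on (snd c ` (fst c \<inter> W)) (f \<circ> chart_inv c)" using assms that by (simp add: smooth_function_on_def)
  qed (use that assms in auto)
  show "(f \<circ> chart_inv c has_derivative frechet_derivative (f \<circ> chart_inv c) (at (snd c p))) (at (snd c p))"
    using hd assms by auto
  define a where "a = chart_at A p"
  have a: "a \<in> A" "p \<in> fst a" using chart_at by (auto simp: a_def)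
  let ?O = "snd a ` (fst a \<inter> fst c)"
  have O: "open ?O" using assms a by (intro open_chart_image open_chart_domain)
  have p: "(snd c \<circ> chart_inv a) (snd a p) = snd c p" using a by simp
  have fc: "((\<lambda>x. f (chart_inv c x)) has_derivative frechet_derivative (f \<circ> chart_inv c) (at (snd c p)))
      (at (snd c p))"
    using hd[OF assms(1,2)] by (simp add: o_def)
  have "((f \<circ> chart_inv c) \<circ> (snd c \<circ> chart_inv a) has_derivative
      (\<lambda>v. frechet_derivative (f \<circ> chart_inv c) (at (snd c p)) (transition_deriv a c p v))) (at (snd a p))"
    unfolding o_def[of "f \<circ> chart_inv c"]
    by (rule has_derivative_compose[OF transition_has_derivative]) (use a assms fc p in \<open>simp_all add: o_def\<close>)
  then have "(f \<circ> chart_inv a has_derivative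
      (\<lambda>v. frechet_derivative (f \<circ> chart_inv c) (at (snd c p)) (transition_deriv a c p v))) (at (snd a p))"
    by (rule has_derivative_transform_within_open[OF _ O]) (use assms a in auto)
  from has_derivative_unique[OF this hd[OF a]]
  show "differential A f p v = frechet_derivative (f \<circ> chart_inv c) (at (snd c p)) (components A c p v)"
    unfolding differential_def components_transition_deriv a_def by metis
qed

lemma linear_differential:
  assumes "open W" "p \<in> W" "smooth_function_on A W f"
  shows "linear (differential A f p)"
  using differential_in_chart[OF chart_at assms] has_derivative_linear
  by (metis (no_types, lifting) components_chart_at ext)

lemma smooth_function_on_differential:
  assumes "open W" "smooth_function_on A W f" "smooth_field_on A W Y"
  shows "smooth_function_on A W (\<lambda>q. differential A f q (Y q))"
  unfolding smooth_function_on_def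
proof
  fix c assume c: "c \<in> A"
  have O: "open (snd c ` (fst c \<inter> W))" using open_chart_image[OF c assms(1)] .
  have "smooth_on (snd c ` (fst c \<inter> W))
      (\<lambda>x. frechet_derivative (f \<circ> chart_inv c) (at x) (vf_in_chart A c Y x))"
    using assms c by (intro smooth_on_derivative_along O) (auto simp: smooth_function_on_def smooth_field_on_def)
  then show "smooth_on (snd c ` (fst c \<inter> W)) ((\<lambda>q. differential A f q (Y q)) \<circ> chart_inv c)"
    by (rule smooth_on_cong[OF O, rotated])
      (use c assms in \<open>auto simp: differential_in_chart(1)[OF c _ assms(1) _ assms(2)] vf_in_chart_def\<close>)
qed

text \<open>The bracket acts on functions as the commutator of the two fields. It is computed in the preferred
  chart at \<open>p\<close>; the second derivatives of \<open>F\<close> cancel by symmetry.\<close>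

lemma differential_lie_bracket:
  assumes "open W" "p \<in> W" "smooth_function_on A W F" "smooth_field_on A W X" "smooth_field_on A W Y"
  shows "differential A F p (lie_bracket A X Y p)
    = differential A (\<lambda>q. differential A F q (Y q)) p (X p)
      - differential A (\<lambda>q. differential A F q (X q)) p (Y p)"
proof -
  define c where "c = chart_at A p"
  have c: "c \<in> A" "p \<in> fst c" using chart_at by (auto simp: c_def)
  define x where "x = snd c p"
  let ?O = "snd c ` (fst c \<inter> W)"
  have O: "open ?O" using open_chart_image[OF c(1) assms(1)] .
  have x: "x \<in> ?O" using c assms by (auto simp: x_def)
  let ?f = "F \<circ> chart_inv c"
  have f: "smooth_on ?O ?f" using assms c by (auto simp: smooth_function_on_def)
  have vf: "vf_in_chart A c Z x = Z p" for Z
    using c by (simp add: x_def vf_in_chart_at) (simp add: c_def)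
  have dd: "differential A (\<lambda>q. differential A F q (Z q)) p v
      = frechet_derivative ?f (at x) (frechet_derivative (vf_in_chart A c Z) (at x) v)
        + frechet_derivative (\<lambda>y. frechet_derivative ?f (at y) v) (at x) (Z p)"
    if Z: "smooth_field_on A W Z" for Z v
  proof -
    have sZ: "smooth_on ?O (vf_in_chart A c Z)" using Z c by (auto simp: smooth_field_on_def)
    let ?h = "(\<lambda>q. differential A F q (Z q)) \<circ> chart_inv c"
    let ?k = "\<lambda>x. frechet_derivative ?f (at x) (vf_in_chart A c Z x)"
    have hk: "?h y = ?k y" if "y \<in> ?O" for y
      using that c by (auto simp: differential_in_chart(1)[OF c(1) _ assms(1) _ assms(3)] vf_in_chart_def)
    have "(?k has_derivative frechet_derivative ?k (at x)) (at x)"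
      by (rule smooth_on_has_derivative[OF smooth_on_derivative_along[OF O f sZ] x])
    then have "(?h has_derivative frechet_derivative ?k (at x)) (at x)"
      by (rule has_derivative_transform_within_open[OF _ O x]) (use hk in auto)
    then have "frechet_derivative ?h (at x) = frechet_derivative ?k (at x)"
      using frechet_derivative_at by metis
    then have "differential A (\<lambda>q. differential A F q (Z q)) p v = frechet_derivative ?k (at x) v"
      unfolding differential_def c_def x_def by simp
    then show ?thesis
      using frechet_derivative_derivative_along[OF O f sZ x, of v] vf by simp
  qed
  have lin: "linear (frechet_derivative ?f (at x))"
    using smooth_on_has_derivative[OF f x] has_derivative_linear by blast
  have "differential A F p (lie_bracket A X Y p) = frechet_derivative ?f (at x)
      (frechet_derivative (vf_in_chart A c Y) (at x) (X p) - frechet_derivative (vf_in_chart A c X) (at x) (Y p))"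
    unfolding differential_def lie_bracket_def Let_def c_def x_def ..
  then show ?thesis
    using second_derivative_symmetric[OF O f x, of "X p" "Y p"]
    by (simp add: dd assms linear_diff[OF lin])
qed

end

section \<open>Connections and metrics\<close>

locale affine_manifold = smooth_manifold A
  for A :: "('m::t2_space, 'b::euclidean_space) chart set" +
  fixes D :: "('m \<Rightarrow> 'b) \<Rightarrow> ('m \<Rightarrow> 'b) \<Rightarrow> 'm \<Rightarrow> 'b"
  assumes connection: "affine_connection A D"
begin

lemma connection_rules:
  assumes "open W" "smooth_field_on A W X" "smooth_field_on A W X'" "smooth_field_on A W Y"
    "smooth_field_on A W Y'" "smooth_function_on A W f"
  shows "smooth_field_on A W (D X Y)"
    "p \<in> W \<Longrightarrow> D (\<lambda>q. X q + X' q) Y p = D X Y p + D X' Y p"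
    "p \<in> W \<Longrightarrow> D (\<lambda>q. f q *\<^sub>R X q) Y p = f p *\<^sub>R D X Y p"
    "p \<in> W \<Longrightarrow> D X (\<lambda>q. Y q + Y' q) p = D X Y p + D X Y' p"
    "p \<in> W \<Longrightarrow> D X (\<lambda>q. f q *\<^sub>R Y q) p = differential A f p (X p) *\<^sub>R Y p + f p *\<^sub>R D X Y p"
    "(\<forall>p\<in>W. X p = X' p \<and> Y p = Y' p) \<Longrightarrow> p \<in> W \<Longrightarrow> D X Y p = D X' Y' p"
  using connection[unfolded affine_connection_def, THEN spec[of _ W], THEN spec[of _ X],
      THEN spec[of _ X'], THEN spec[of _ Y], THEN spec[of _ Y'], THEN spec[of _ f], THEN mp] assms
  by simp_all

lemma D_smooth: "open W \<Longrightarrow> smooth_field_on A W X \<Longrightarrow> smooth_field_on A W Y \<Longrightarrow> smooth_field_on A W (D X Y)"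
  by (rule connection_rules(1)[OF _ _ _ _ _ smooth_function_on_const])

lemma D_cong:
  assumes "open W" "p \<in> W" "smooth_field_on A W X" "smooth_field_on A W Y"
    "\<And>q. q \<in> W \<Longrightarrow> X q = X' q" "\<And>q. q \<in> W \<Longrightarrow> Y q = Y' q"
  shows "D X Y p = D X' Y' p"
proof (rule connection_rules(6)[OF assms(1,3) _ assms(4) _ smooth_function_on_const[OF assms(1)] _ assms(2)])
  show "smooth_field_on A W X'" by (rule smooth_field_on_cong[OF assms(1,5,3)])
  show "smooth_field_on A W Y'" by (rule smooth_field_on_cong[OF assms(1,6,4)])
qed (use assms in simp)

lemma D_add_left:
  "open W \<Longrightarrow> p \<in> W \<Longrightarrow> smooth_field_on A W X \<Longrightarrow> smooth_field_on A W X' \<Longrightarrow> smooth_field_on A W Y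
    \<Longrightarrow> D (\<lambda>q. X q + X' q) Y p = D X Y p + D X' Y p"
  by (rule connection_rules(2)[OF _ _ _ _ _ smooth_function_on_const])

lemma D_scale_left:
  "open W \<Longrightarrow> p \<in> W \<Longrightarrow> smooth_function_on A W f \<Longrightarrow> smooth_field_on A W X \<Longrightarrow> smooth_field_on A W Y
    \<Longrightarrow> D (\<lambda>q. f q *\<^sub>R X q) Y p = f p *\<^sub>R D X Y p"
  by (rule connection_rules(3))

lemma D_add_right:
  "open W \<Longrightarrow> p \<in> W \<Longrightarrow> smooth_field_on A W X \<Longrightarrow> smooth_field_on A W Y \<Longrightarrow> smooth_field_on A W Y'
    \<Longrightarrow> D X (\<lambda>q. Y q + Y' q) p = D X Y p + D X Y' p"
  by (rule connection_rules(4)[OF _ _ _ _ _ smooth_function_on_const])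

lemma D_leibniz:
  "open W \<Longrightarrow> p \<in> W \<Longrightarrow> smooth_function_on A W f \<Longrightarrow> smooth_field_on A W X \<Longrightarrow> smooth_field_on A W Y
    \<Longrightarrow> D X (\<lambda>q. f q *\<^sub>R Y q) p = differential A f p (X p) *\<^sub>R Y p + f p *\<^sub>R D X Y p"
  by (rule connection_rules(5))

lemma D_zero_left:
  assumes "open W" "p \<in> W" "smooth_field_on A W Y" shows "D (\<lambda>q. 0) Y p = 0"
  using D_scale_left[OF assms(1,2) smooth_function_on_const[OF assms(1), of 0] smooth_field_on_zero[OF assms(1)] assms(3)]
  by simp

lemma D_zero_right:
  assumes "open W" "p \<in> W" "smooth_field_on A W X" shows "D X (\<lambda>q. 0) p = 0"
proof -
  have "D X (\<lambda>q. 0 + 0) p = D X (\<lambda>q. 0) p + D X (\<lambda>q. 0) p"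
    by (rule D_add_right[OF assms]) (use assms in \<open>auto intro: smooth_field_on_zero\<close>)
  then show ?thesis by simp
qed

lemma D_sum_left:
  assumes "open W" "p \<in> W" "finite I" "smooth_field_on A W Y"
    "\<And>i. i \<in> I \<Longrightarrow> smooth_function_on A W (f i)" "\<And>i. i \<in> I \<Longrightarrow> smooth_field_on A W (E i)"
  shows "D (\<lambda>q. \<Sum>i\<in>I. f i q *\<^sub>R E i q) Y p = (\<Sum>i\<in>I. f i p *\<^sub>R D (E i) Y p)"
  using assms(3,5,6)
proof (induction I rule: finite_induct)
  case empty
  then show ?case using D_zero_left assms by simp
next
  case (insert i I)
  have "D (\<lambda>q. f i q *\<^sub>R E i q + (\<Sum>i\<in>I. f i q *\<^sub>R E i q)) Y p
      = D (\<lambda>q. f i q *\<^sub>R E i q) Y p + D (\<lambda>q. \<Sum>i\<in>I. f i q *\<^sub>R E i q) Y p"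
    using insert assms
    by (intro D_add_left[OF assms(1,2)] smooth_field_on_sum smooth_field_on_scale) auto
  then show ?case using insert D_scale_left[OF assms(1,2) _ _ assms(4)] by simp
qed

lemma D_sum_right:
  assumes "open W" "p \<in> W" "finite I" "smooth_field_on A W X"
    "\<And>i. i \<in> I \<Longrightarrow> smooth_function_on A W (f i)" "\<And>i. i \<in> I \<Longrightarrow> smooth_field_on A W (E i)"
  shows "D X (\<lambda>q. \<Sum>i\<in>I. f i q *\<^sub>R E i q) p
    = (\<Sum>i\<in>I. differential A (f i) p (X p) *\<^sub>R E i p + f i p *\<^sub>R D X (E i) p)"
  using assms(3,5,6)
proof (induction I rule: finite_induct)
  case empty
  then show ?case using D_zero_right assms by simp
next
  case (insert i I)
  have "D X (\<lambda>q. f i q *\<^sub>R E i q + (\<Sum>i\<in>I. f i q *\<^sub>R E i q)) p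
      = D X (\<lambda>q. f i q *\<^sub>R E i q) p + D X (\<lambda>q. \<Sum>i\<in>I. f i q *\<^sub>R E i q) p"
    using insert assms
    by (intro D_add_right[OF assms(1,2)] smooth_field_on_sum smooth_field_on_scale) auto
  then show ?case using insert D_leibniz[OF assms(1,2) _ assms(4)] by simp
qed

text \<open>Expanding \<open>X\<close> in the coordinate frame, linearity over functions in the first argument leaves
  only the coefficients of \<open>X\<close> at \<open>p\<close>.\<close>

lemma D_tensorial:
  assumes "open W" "p \<in> W" "smooth_field_on A W X" "smooth_field_on A W X'" "smooth_field_on A W Y"
    "X p = X' p"
  shows "D X Y p = D X' Y p"
proof -
  define c where "c = chart_at A p"
  have c: "c \<in> A" "p \<in> fst c" using chart_at by (auto simp: c_def)
  define V where "V = W \<inter> fst c"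
  have V: "open V" "p \<in> V" "V \<subseteq> W" "V \<subseteq> fst c"
    using assms c open_chart_domain[OF c(1)] by (auto simp: V_def)
  have "D X Y p = (\<Sum>b\<in>Basis. inner (components A c p (X p)) b *\<^sub>R D (coord_field A c b) Y p)"
    if X: "smooth_field_on A W X" for X
  proof -
    have "D X Y p = D (\<lambda>q. \<Sum>b\<in>Basis. inner (components A c q (X q)) b *\<^sub>R coord_field A c b q) Y p"
      by (rule D_cong[OF V(1,2)])
        (use V X assms coord_expansion[OF c(1)] in \<open>auto intro: smooth_field_on_subset\<close>)
    also have "\<dots> = (\<Sum>b\<in>Basis. inner (components A c p (X p)) b *\<^sub>R D (coord_field A c b) Y p)"
      by (rule D_sum_left[OF V(1,2) finite_Basis])
        (use V X assms c in \<open>auto intro: smooth_field_on_subset smooth_coefficient smooth_coord_field\<close>)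
    finally show ?thesis .
  qed
  then show ?thesis using assms by simp
qed

text \<open>Expand \<open>Z\<close> in the coordinate frame. By the Leibniz rule \<open>D X Z p\<close> involves the coefficients of \<open>Z\<close>
  at \<open>p\<close>, which vanish, and their derivatives in the direction \<open>X p\<close>, which vanish if that
  direction is tangential to \<open>M\<close>.\<close>

lemma D_zero_along:
  assumes "open W" "p \<in> W" "smooth_field_on A W X" "smooth_field_on A W Z" "p \<in> M"
    and Z: "\<And>q. q \<in> M \<Longrightarrow> q \<in> W \<Longrightarrow> Z q = 0"
    and tangential: "\<And>V f. open V \<Longrightarrow> p \<in> V \<Longrightarrow> V \<subseteq> W \<Longrightarrow> smooth_function_on A V f
      \<Longrightarrow> (\<And>q. q \<in> M \<Longrightarrow> q \<in> V \<Longrightarrow> f q = 0) \<Longrightarrow> differential A f p (X p) = 0"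
  shows "D X Z p = 0"
proof -
  define c where "c = chart_at A p"
  have c: "c \<in> A" "p \<in> fst c" using chart_at by (auto simp: c_def)
  define V where "V = W \<inter> fst c"
  have V: "open V" "p \<in> V" "V \<subseteq> W" "V \<subseteq> fst c"
    using assms c open_chart_domain[OF c(1)] by (auto simp: V_def)
  let ?f = "\<lambda>b q. inner (components A c q (Z q)) b"
  have f: "smooth_function_on A V (?f b)" for b
    using V assms c by (auto intro: smooth_field_on_subset smooth_coefficient)
  have f0: "?f b q = 0" if "q \<in> M" "q \<in> V" for b q
  proof -
    have "Z q = 0" "q \<in> fst c" using Z[of q] that V by blast+
    then show ?thesis using linear_0[OF linear_components[OF c(1)]] by simp
  qed
  have "D X Z p = D X (\<lambda>q. \<Sum>b\<in>Basis. ?f b q *\<^sub>R coord_field A c b q) p"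
    by (rule D_cong[OF V(1,2)])
      (use V assms coord_expansion[OF c(1)] in \<open>auto intro: smooth_field_on_subset\<close>)
  also have "\<dots> = (\<Sum>b\<in>Basis. differential A (?f b) p (X p) *\<^sub>R coord_field A c b p
      + ?f b p *\<^sub>R D X (coord_field A c b) p)"
    by (rule D_sum_right[OF V(1,2) finite_Basis])
      (use V f assms c in \<open>auto intro: smooth_field_on_subset smooth_coord_field\<close>)
  also have "\<dots> = 0"
    using tangential[OF V(1-3) f f0] f0[OF assms(5) V(2)] by simp
  finally show ?thesis .
qed

lemma D_diff_right:
  assumes "open W" "p \<in> W" "smooth_field_on A W X" "smooth_field_on A W Y" "smooth_field_on A W Y'"
  shows "D X (\<lambda>q. Y q - Y' q) p = D X Y p - D X Y' p"
proof -
  have "D X Y p = D X (\<lambda>q. (Y q - Y' q) + Y' q) p"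
    by simp
  also have "\<dots> = D X (\<lambda>q. Y q - Y' q) p + D X Y' p"
    by (rule D_add_right) (use assms in \<open>auto intro: smooth_field_on_diff\<close>)
  finally show ?thesis by simp
qed

lemma D_along:
  assumes "open W" "p \<in> W" "smooth_field_on A W X" "smooth_field_on A W Y" "smooth_field_on A W Y'" "p \<in> M"
    and "\<And>q. q \<in> M \<Longrightarrow> q \<in> W \<Longrightarrow> Y q = Y' q"
    and "\<And>V f. open V \<Longrightarrow> p \<in> V \<Longrightarrow> V \<subseteq> W \<Longrightarrow> smooth_function_on A V f
      \<Longrightarrow> (\<And>q. q \<in> M \<Longrightarrow> q \<in> V \<Longrightarrow> f q = 0) \<Longrightarrow> differential A f p (X p) = 0"
  shows "D X Y p = D X Y' p"
  using D_zero_along[OF assms(1-3) smooth_field_on_diff[OF assms(1,4,5)] assms(6)] assms(7,8)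
    D_diff_right[OF assms(1-5)] by simp

text \<open>Every vector at \<open>p\<close> is the value of a field that depends linearly on it. In this way the covariant
  derivative at \<open>p\<close> becomes a linear function of a single vector instead of a field.\<close>

definition constant_field :: "'m \<Rightarrow> 'b \<Rightarrow> 'm \<Rightarrow> 'b" where
  "constant_field p v = coord_field A (chart_at A p) v"

lemma constant_field_at [simp]: "constant_field p v p = v"
  unfolding constant_field_def using coord_field_components[OF chart_at, of p v] by simp

lemma smooth_constant_field: "smooth_field_on A (fst (chart_at A p)) (constant_field p v)"
  unfolding constant_field_def by (rule smooth_coord_field[OF chart_at(1)])

definition vector_derivative_at :: "'m \<Rightarrow> 'b \<Rightarrow> ('m \<Rightarrow> 'b) \<Rightarrow> 'b" where
  "vector_derivative_at p v Y = D (constant_field p v) Y p"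

lemma D_eq_vector_derivative_at:
  assumes "open W" "p \<in> W" "smooth_field_on A W X" "smooth_field_on A W Y"
  shows "D X Y p = vector_derivative_at p (X p) Y"
  unfolding vector_derivative_at_def
proof (rule D_tensorial)
  show "open (W \<inter> fst (chart_at A p))" using assms chart_at open_chart_domain by blast
  show "p \<in> W \<inter> fst (chart_at A p)" using assms chart_at by blast
qed (use assms smooth_constant_field in \<open>auto intro: smooth_field_on_subset\<close>)

lemma linear_vector_derivative_at:
  assumes "open W" "p \<in> W" "smooth_field_on A W Y"
  shows "linear (\<lambda>v. vector_derivative_at p v Y)"
proof -
  let ?c = "chart_at A p"
  let ?V = "W \<inter> fst ?c"
  have V: "open ?V" "p \<in> ?V" using assms chart_at open_chart_domain by blast+
  have Y: "smooth_field_on A ?V Y" and F: "smooth_field_on A ?V (constant_field p v)" for v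
    using assms smooth_constant_field by (auto intro: smooth_field_on_subset)
  have lin: "linear (\<lambda>v. constant_field p v q)" if "q \<in> fst ?c" for q
    unfolding constant_field_def by (rule linear_coord_field[OF chart_at(1) that])
  show ?thesis
  proof (rule linearI)
    fix v w
    have "D (constant_field p (v + w)) Y p = D (\<lambda>q. constant_field p v q + constant_field p w q) Y p"
      by (rule D_cong[OF V F Y]) (auto simp: linear_add[OF lin])
    then show "vector_derivative_at p (v + w) Y = vector_derivative_at p v Y + vector_derivative_at p w Y"
      unfolding vector_derivative_at_def using D_add_left[OF V F F Y] by simp
  next
    fix a v
    have "D (constant_field p (a *\<^sub>R v)) Y p = D (\<lambda>q. a *\<^sub>R constant_field p v q) Y p"
      by (rule D_cong[OF V F Y]) (auto simp: linear_scale[OF lin])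
    then show "vector_derivative_at p (a *\<^sub>R v) Y = a *\<^sub>R vector_derivative_at p v Y"
      unfolding vector_derivative_at_def using D_scale_left[OF V smooth_function_on_const[OF V(1)] F Y] by simp
  qed
qed

end

locale levi_civita_manifold = affine_manifold A D
  for A :: "('m::t2_space, 'b::euclidean_space) chart set"
    and D :: "('m \<Rightarrow> 'b) \<Rightarrow> ('m \<Rightarrow> 'b) \<Rightarrow> 'm \<Rightarrow> 'b" +
  fixes g :: "'m \<Rightarrow> 'b \<Rightarrow> 'b \<Rightarrow> real"
  assumes metric: "semi_riemannian_manifold A g" and levi_civita: "levi_civita A g D"
begin

lemma g_bilinear: "bilinear (g p)"
  using metric by (auto simp: semi_riemannian_manifold_def)

lemma g_sym: "g p v w = g p w v"
  using metric by (auto simp: semi_riemannian_manifold_def)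

lemma g_nondegenerate: "(\<And>w. g p v w = 0) \<Longrightarrow> v = 0"
  using metric unfolding semi_riemannian_manifold_def by blast

lemmas g_simps [simp] =
  bilinear_ladd[OF g_bilinear] bilinear_radd[OF g_bilinear] bilinear_lmul[OF g_bilinear]
  bilinear_rmul[OF g_bilinear] bilinear_lneg[OF g_bilinear] bilinear_rneg[OF g_bilinear]
  bilinear_lzero[OF g_bilinear] bilinear_rzero[OF g_bilinear] bilinear_lsub[OF g_bilinear]
  bilinear_rsub[OF g_bilinear]

lemma g_smooth:
  "open W \<Longrightarrow> smooth_field_on A W X \<Longrightarrow> smooth_field_on A W Y \<Longrightarrow> smooth_function_on A W (\<lambda>p. g p (X p) (Y p))"
  using metric by (auto simp: semi_riemannian_manifold_def)

lemma levi_civita_rules: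
  assumes "open W" "p \<in> W" "smooth_field_on A W X" "smooth_field_on A W Y" "smooth_field_on A W Z"
  shows "D X Y p - D Y X p = lie_bracket A X Y p"
    and "differential A (\<lambda>q. g q (Y q) (Z q)) p (X p) = g p (D X Y p) (Z p) + g p (Y p) (D X Z p)"
  using levi_civita[unfolded levi_civita_def, THEN conjunct2, THEN spec[of _ W], THEN spec[of _ X],
      THEN spec[of _ Y], THEN spec[of _ Z], THEN mp] assms
  by auto

lemma torsion_free:
  "open W \<Longrightarrow> p \<in> W \<Longrightarrow> smooth_field_on A W X \<Longrightarrow> smooth_field_on A W Y
    \<Longrightarrow> lie_bracket A X Y p = D X Y p - D Y X p"
  using levi_civita_rules(1)[of W p X Y Y] by simp

lemmas metric_compatible = levi_civita_rules(2)

lemma lie_bracket_smooth: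
  assumes "open W" "smooth_field_on A W X" "smooth_field_on A W Y"
  shows "smooth_field_on A W (lie_bracket A X Y)"
proof (rule smooth_field_on_cong[OF assms(1)])
  show "smooth_field_on A W (\<lambda>p. D X Y p - D Y X p)"
    using assms by (intro smooth_field_on_diff D_smooth)
qed (use torsion_free assms in simp)

end

section \<open>Immersed hypersurfaces\<close>

lemma bilinear_sum_left: "bilinear b \<Longrightarrow> b (\<Sum>i\<in>I. f i) w = (\<Sum>i\<in>I. b (f i) w)"
  unfolding bilinear_def using linear_sum[of "\<lambda>x. b x w" f I] by simp

text \<open>The map from vectors to functionals is injective, hence surjective by dimension.\<close>

lemma nondegenerate_represents_functionals:
  fixes b :: "'b::euclidean_space \<Rightarrow> 'b \<Rightarrow> real"
  assumes "bilinear b" "\<And>v. (\<And>w. b v w = 0) \<Longrightarrow> v = 0"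
  shows "\<exists>w. \<forall>x. b w x = inner z x"
proof -
  define L where "L = (\<lambda>w. \<Sum>i\<in>Basis. b w i *\<^sub>R i)"
  have bL: "b w x = inner (L w) x" for w x
  proof -
    have "linear (b w)" using assms(1) by (simp add: bilinear_def)
    then have "b w (\<Sum>i\<in>Basis. inner x i *\<^sub>R i) = (\<Sum>i\<in>Basis. inner x i * b w i)"
      by (simp add: linear_sum linear_scale)
    then have "b w x = (\<Sum>i\<in>Basis. inner x i * b w i)" by (simp add: euclidean_representation)
    then show ?thesis
      by (simp add: L_def inner_sum_left inner_sum_right inner_commute mult.commute)
  qed
  have lin: "linear L" unfolding L_def
    by (rule linearI)
      (simp_all add: bilinear_ladd[OF assms(1)] bilinear_lmul[OF assms(1)] scaleR_add_left sum.distrib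
        scaleR_sum_right)
  have "inj L"
    unfolding linear_injective_0[OF lin] using assms(2) bL by (metis inner_zero_left)
  then have "surj L" using linear_injective_imp_surjective[OF lin] by blast
  then obtain w where "z = L w" by (metis surjD)
  then show ?thesis using bL by blast
qed

lemma orthogonal_family:
  fixes b :: "'b::euclidean_space \<Rightarrow> 'b \<Rightarrow> real"
  assumes "bilinear b" "finite I"
    "\<And>i j. i \<in> I \<Longrightarrow> j \<in> I \<Longrightarrow> i \<noteq> j \<Longrightarrow> b (F i) (F j) = 0" "\<And>i. i \<in> I \<Longrightarrow> b (F i) (F i) \<noteq> 0"
  shows "inj_on F I" "independent (F ` I)"
    "x \<in> span (F ` I) \<Longrightarrow> x = (\<Sum>i\<in>I. (b x (F i) / b (F i) (F i)) *\<^sub>R F i)"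
proof -
  show inj: "inj_on F I" unfolding inj_on_def using assms(3,4) by metis
  have coeff: "a j = b (\<Sum>i\<in>I. a i *\<^sub>R F i) (F j) / b (F j) (F j)" if "j \<in> I" for a j
  proof -
    have "b (\<Sum>i\<in>I. a i *\<^sub>R F i) (F j) = (\<Sum>i\<in>I. if i = j then a j * b (F j) (F j) else 0)"
      unfolding bilinear_sum_left[OF assms(1)]
      by (rule sum.cong) (use assms that in \<open>auto simp: bilinear_lmul\<close>)
    also have "\<dots> = a j * b (F j) (F j)" using that assms(2) by simp
    finally show ?thesis using assms(4)[OF that] by simp
  qed
  have rep: "\<exists>a. x = (\<Sum>i\<in>I. a i *\<^sub>R F i)" if x: "x \<in> span (F ` I)" for x
  proof -
    obtain c where "x = (\<Sum>v\<in>F ` I. c v *\<^sub>R v)"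
      using x unfolding span_finite[OF finite_imageI[OF assms(2)]] by blast
    then show ?thesis by (intro exI[of _ "c \<circ> F"]) (simp add: sum.reindex[OF inj])
  qed
  show "x \<in> span (F ` I) \<Longrightarrow> x = (\<Sum>i\<in>I. (b x (F i) / b (F i) (F i)) *\<^sub>R F i)"
  proof -
    assume "x \<in> span (F ` I)"
    then obtain a where a: "x = (\<Sum>i\<in>I. a i *\<^sub>R F i)" using rep by blast
    have "x = (\<Sum>i\<in>I. a i *\<^sub>R F i)" by (fact a)
    also have "\<dots> = (\<Sum>i\<in>I. (b x (F i) / b (F i) (F i)) *\<^sub>R F i)"
      by (rule sum.cong[OF refl]) (use coeff[of _ a] a in simp)
    finally show ?thesis .
  qed
  show "independent (F ` I)"
  proof
    assume "dependent (F ` I)"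
    then obtain c v where c: "(\<Sum>v\<in>F ` I. c v *\<^sub>R v) = 0" "v \<in> F ` I" "c v \<noteq> 0"
      using dependent_finite[of "F ` I"] assms(2) by auto
    then obtain j where j: "j \<in> I" "v = F j" by blast
    have "(\<Sum>i\<in>I. (c \<circ> F) i *\<^sub>R F i) = 0" using c(1) by (simp add: sum.reindex[OF inj])
    then have "(c \<circ> F) j = 0" using coeff[OF j(1), of "c \<circ> F"] assms(1) by (simp add: bilinear_lzero)
    then show False using c j by simp
  qed
qed

text \<open>If the quadratic form is not identically zero on \<open>V\<close>, choose \<open>v\<close> with \<open>b v v \<noteq> 0\<close> and continue with
  the orthogonal complement of \<open>v\<close> in \<open>V\<close>, on which the form is again nondegenerate. If it is
  identically zero, then so is the bilinear form, by polarisation, and \<open>V\<close> is trivial.\<close>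

lemma orthogonal_basis_exists:
  fixes b :: "'b::euclidean_space \<Rightarrow> 'b \<Rightarrow> real"
  assumes "bilinear b" "\<And>v w. b v w = b w v" "subspace V"
    "\<And>v. v \<in> V \<Longrightarrow> (\<And>w. w \<in> V \<Longrightarrow> b v w = 0) \<Longrightarrow> v = 0"
  shows "\<exists>E. finite E \<and> E \<subseteq> V \<and> V \<subseteq> span E \<and> (\<forall>e\<in>E. b e e \<noteq> 0) \<and>
    (\<forall>e\<in>E. \<forall>f\<in>E. e \<noteq> f \<longrightarrow> b e f = 0)"
  using assms(3,4)
proof (induction "dim V" arbitrary: V rule: less_induct)
  case less
  note lin = bilinear_ladd[OF assms(1)] bilinear_radd[OF assms(1)] bilinear_lmul[OF assms(1)]
    bilinear_rmul[OF assms(1)] bilinear_lsub[OF assms(1)] bilinear_rsub[OF assms(1)]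
    bilinear_rzero[OF assms(1)]
  show ?case
  proof (cases "\<exists>v\<in>V. b v v \<noteq> 0")
    case False
    have "b v w = 0" if "v \<in> V" "w \<in> V" for v w
    proof -
      have "b (v + w) (v + w) = 0" "b v v = 0" "b w w = 0"
        using False that subspace_add[OF less.prems(1)] by auto
      then show ?thesis using assms(2)[of v w] by (simp add: lin)
    qed
    then have "V \<subseteq> {0}" using less.prems(2) by blast
    then show ?thesis by (intro exI[of _ "{}"]) auto
  next
    case True
    then obtain v where v: "v \<in> V" "b v v \<noteq> 0" by blast
    define V' where "V' = {w \<in> V. b v w = 0}"
    have sub: "subspace V'"
      using less.prems(1) by (auto simp: V'_def subspace_def lin)
    have split: "x - (b v x / b v v) *\<^sub>R v \<in> V'" if "x \<in> V" for x
      using that v less.prems(1) by (auto simp: V'_def lin subspace_diff subspace_scale)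
    have "V' \<subset> V" using v by (auto simp: V'_def)
    then have "dim V' < dim V"
      using dim_psubset[of V' V] sub less.prems(1) by (metis span_eq_iff)
    moreover have "w = 0" if w: "w \<in> V'" "\<And>x. x \<in> V' \<Longrightarrow> b w x = 0" for w
    proof (rule less.prems(2))
      show "w \<in> V" using w by (auto simp: V'_def)
      fix x assume "x \<in> V"
      have "b w v = 0" using w assms(2)[of w v] by (auto simp: V'_def)
      then show "b w x = 0" using w(2)[OF split[OF \<open>x \<in> V\<close>]] by (simp add: lin)
    qed
    ultimately obtain E where E: "finite E" "E \<subseteq> V'" "V' \<subseteq> span E" "\<forall>e\<in>E. b e e \<noteq> 0"
      "\<forall>e\<in>E. \<forall>f\<in>E. e \<noteq> f \<longrightarrow> b e f = 0"
      using less.hyps[of V'] sub by blast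
    show ?thesis
    proof (intro exI[of _ "insert v E"] conjI)
      show "V \<subseteq> span (insert v E)"
      proof
        fix x assume "x \<in> V"
        then have "x - (b v x / b v v) *\<^sub>R v \<in> span (insert v E)"
          using split E(3) span_mono[of E "insert v E"] by blast
        then have "(x - (b v x / b v v) *\<^sub>R v) + (b v x / b v v) *\<^sub>R v \<in> span (insert v E)"
          by (rule span_add) (auto intro: span_scale span_base)
        then show "x \<in> span (insert v E)" by (simp only: diff_add_cancel)
      qed
      have "b v e = 0" "b e v = 0" if "e \<in> E" for e
        using that E(2) assms(2)[of e v] by (auto simp: V'_def)
      then show "\<forall>e\<in>insert v E. \<forall>f\<in>insert v E. e \<noteq> f \<longrightarrow> b e f = 0" using E(5) by auto
    qed (use E v in \<open>auto simp: V'_def\<close>)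
  qed
qed

locale immersed_hypersurface = levi_civita_manifold A D g
  for A :: "('m::t2_space, 'b::euclidean_space) chart set"
    and D :: "('m \<Rightarrow> 'b) \<Rightarrow> ('m \<Rightarrow> 'b) \<Rightarrow> 'm \<Rightarrow> 'b"
    and g :: "'m \<Rightarrow> 'b \<Rightarrow> 'b \<Rightarrow> real" +
  fixes \<iota> :: "'h::topological_space \<Rightarrow> 'm"
  assumes hypersurface: "hypersurface A \<iota>"
begin

lemma open_preimage: assumes "open V" shows "open (\<iota> -` V)"
proof (subst open_subopen, intro ballI)
  fix u assume u: "u \<in> \<iota> -` V"
  obtain U c n k where U: "open U" "u \<in> U" "homeomorphism U (\<iota> ` U) \<iota> k"
    using hypersurface unfolding hypersurface_def by meson
  have "open (U \<inter> \<iota> -` V)"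
    by (rule continuous_open_preimage[OF homeomorphism_cont1[OF U(3)] U(1) assms])
  then show "\<exists>T. open T \<and> u \<in> T \<and> T \<subseteq> \<iota> -` V" using u U by (intro exI[of _ "U \<inter> \<iota> -` V"]) auto
qed

text \<open>Here \<open>F\<close> need not be defined on all of the image of \<open>U\<close>: continuity of \<open>\<iota>\<close> allows shrinking \<open>U\<close>.\<close>

lemma tangentD:
  assumes "v \<in> tangent A \<iota> u" "open V" "\<iota> u \<in> V" "smooth_function_on A V F" "open U" "u \<in> U"
    "\<And>q. q \<in> U \<Longrightarrow> \<iota> q \<in> V \<Longrightarrow> F (\<iota> q) = 0"
  shows "differential A F (\<iota> u) v = 0"
proof -
  have "open (U \<inter> \<iota> -` V)" using assms open_preimage by blast
  moreover have "u \<in> U \<inter> \<iota> -` V" "\<iota> ` (U \<inter> \<iota> -` V) \<subseteq> V" using assms by auto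
  ultimately show ?thesis
    using assms(1,2,4,7) unfolding tangent_def by blast
qed

lemma subspace_tangent: "subspace (tangent A \<iota> u)"
proof -
  have lin: "linear (differential A F (\<iota> u))"
    if "open W" "u \<in> U" "\<iota> ` U \<subseteq> W" "smooth_function_on A W F" for F W U
    using linear_differential[of W "\<iota> u" F] that by blast
  show ?thesis
    unfolding subspace_def tangent_def
  proof (intro conjI ballI allI)
    show "0 \<in> {v. \<forall>W U F. open W \<and> open U \<and> u \<in> U \<and> \<iota> ` U \<subseteq> W \<and> smooth_function_on A W F \<and>
           (\<forall>q\<in>U. F (\<iota> q) = 0) \<longrightarrow> differential A F (\<iota> u) v = 0}"
      using lin linear_0 by blast
  qed (use lin in \<open>auto simp: linear_add linear_scale\<close>)
qed

text \<open>The neighbourhoods from \<open>extends_near\<close> are kept as arguments, because the induced connection has to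
  be differentiated once more, which needs one extension that is valid at all points of \<open>U\<close>.\<close>

definition extends_on :: "'m set \<Rightarrow> 'h set \<Rightarrow> ('h \<Rightarrow> 'b) \<Rightarrow> ('m \<Rightarrow> 'b) \<Rightarrow> bool" where
  "extends_on W U X X' \<longleftrightarrow> open W \<and> open U \<and> \<iota> ` U \<subseteq> W \<and> smooth_field_on A W X' \<and> (\<forall>q\<in>U. X q = X' (\<iota> q))"

lemma extends_near_iff: "extends_near A \<iota> u X X' \<longleftrightarrow> (\<exists>W U. u \<in> U \<and> extends_on W U X X')"
  unfolding extends_near_def extends_on_def by auto

lemma extends_on_near: "extends_on W U X X' \<Longrightarrow> u \<in> U \<Longrightarrow> extends_near A \<iota> u X X'"
  using extends_near_iff by blast

text \<open>The choice of the extension of \<open>X\<close> is irrelevant since the covariant derivative is tensorial in it;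
  that of \<open>Y\<close> is irrelevant since \<open>X u\<close> is tangent and two extensions of \<open>Y\<close> agree on the image of
  the hypersurface.\<close>

lemma ambient_derivative_eq:
  assumes X: "extends_on W U X X'" and Y: "extends_on W U Y Y'" and u: "u \<in> U" "X u \<in> tangent A \<iota> u"
  shows "ambient_derivative A D \<iota> X Y u = D X' Y' (\<iota> u)"
  unfolding ambient_derivative_def
proof (rule the_equality)
  show "\<exists>X'' Y''. extends_near A \<iota> u X X'' \<and> extends_near A \<iota> u Y Y'' \<and> D X' Y' (\<iota> u) = D X'' Y'' (\<iota> u)"
    using assms extends_on_near by blast
  fix w assume "\<exists>X' Y'. extends_near A \<iota> u X X' \<and> extends_near A \<iota> u Y Y' \<and> w = D X' Y' (\<iota> u)"
  then obtain X'' Y'' W1 U1 W2 U2 where w: "w = D X'' Y'' (\<iota> u)"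
    and X2: "u \<in> U1" "extends_on W1 U1 X X''" and Y2: "u \<in> U2" "extends_on W2 U2 Y Y''"
    unfolding extends_near_iff by blast
  define V where "V = W \<inter> W1 \<inter> W2"
  define U' where "U' = U \<inter> U1 \<inter> U2"
  have V: "open V" "open U'" "u \<in> U'" "\<iota> u \<in> V" "\<iota> ` U' \<subseteq> V"
    using X X2 Y Y2 u by (auto simp: extends_on_def V_def U'_def)
  have sm: "smooth_field_on A V X'" "smooth_field_on A V X''" "smooth_field_on A V Y'" "smooth_field_on A V Y''"
    using X X2 Y Y2 by (auto simp: extends_on_def V_def intro: smooth_field_on_subset)
  have "X'' (\<iota> u) = X' (\<iota> u)" using X X2 u by (auto simp: extends_on_def)
  then have "w = D X' Y'' (\<iota> u)" unfolding w by (rule D_tensorial[OF V(1,4) sm(2,1,4)])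
  also have "\<dots> = D X' Y' (\<iota> u)"
  proof (rule D_along[OF V(1,4) sm(1,4,3)])
    show "\<iota> u \<in> \<iota> ` U'" using V by blast
    show "Y'' q = Y' q" if "q \<in> \<iota> ` U'" for q using that Y Y2 by (auto simp: extends_on_def U'_def)
    fix V' f assume V': "open V'" "\<iota> u \<in> V'" "smooth_function_on A V' f"
      "\<And>q. q \<in> \<iota> ` U' \<Longrightarrow> q \<in> V' \<Longrightarrow> f q = 0"
    have "X' (\<iota> u) \<in> tangent A \<iota> u" using X u by (auto simp: extends_on_def)
    then show "differential A f (\<iota> u) (X' (\<iota> u)) = 0"
      by (rule tangentD[OF _ V'(1-3) V(2,3)]) (use V' in auto)
  qed
  finally show "w = D X' Y' (\<iota> u)" .
qed

text \<open>By vanishing torsion the bracket is a difference of two covariant derivatives, for which the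
  independence of the extensions is known.\<close>

lemma tangent_bracket_eq:
  assumes X: "extends_on W U X X'" and Y: "extends_on W U Y Y'"
    and u: "u \<in> U" "X u \<in> tangent A \<iota> u" "Y u \<in> tangent A \<iota> u"
  shows "tangent_bracket A \<iota> X Y u = lie_bracket A X' Y' (\<iota> u)"
proof -
  have br: "lie_bracket A X' Y' (\<iota> u) = ambient_derivative A D \<iota> X Y u - ambient_derivative A D \<iota> Y X u"
    if "extends_on W U X X'" "extends_on W U Y Y'" "u \<in> U" for W U X' Y'
  proof -
    have "lie_bracket A X' Y' (\<iota> u) = D X' Y' (\<iota> u) - D Y' X' (\<iota> u)"
      by (rule torsion_free[of W]) (use that in \<open>auto simp: extends_on_def\<close>)
    then show ?thesis
      using ambient_derivative_eq[OF that u(2)] ambient_derivative_eq[OF that(2,1,3) u(3)] by simp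
  qed
  show ?thesis
    unfolding tangent_bracket_def
  proof (rule the_equality)
    show "\<exists>X'' Y''. extends_near A \<iota> u X X'' \<and> extends_near A \<iota> u Y Y'' \<and>
        lie_bracket A X' Y' (\<iota> u) = lie_bracket A X'' Y'' (\<iota> u)"
      using assms extends_on_near by blast
    fix w assume "\<exists>X' Y'. extends_near A \<iota> u X X' \<and> extends_near A \<iota> u Y Y' \<and> w = lie_bracket A X' Y' (\<iota> u)"
    then obtain X'' Y'' W1 U1 W2 U2 where w: "w = lie_bracket A X'' Y'' (\<iota> u)"
      and X2: "u \<in> U1" "extends_on W1 U1 X X''" and Y2: "u \<in> U2" "extends_on W2 U2 Y Y''"
      unfolding extends_near_iff by blast
    have "extends_on (W1 \<inter> W2) (U1 \<inter> U2) X X''" "extends_on (W1 \<inter> W2) (U1 \<inter> U2) Y Y''"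
      using X2 Y2 by (auto simp: extends_on_def intro: smooth_field_on_subset)
    from br[OF this] show "w = lie_bracket A X' Y' (\<iota> u)"
      using br[OF X Y u(1)] X2 Y2 w by auto
  qed
qed

text \<open>A tangent field differentiates a function that vanishes on the hypersurface to another such
  function. Applied twice, both terms of the commutator vanish.\<close>

lemma lie_bracket_tangent:
  assumes X: "extends_on W U X X'" and Y: "extends_on W U Y Y'" and u: "u \<in> U"
    and tan: "\<And>q. q \<in> U \<Longrightarrow> X q \<in> tangent A \<iota> q" "\<And>q. q \<in> U \<Longrightarrow> Y q \<in> tangent A \<iota> q"
  shows "lie_bracket A X' Y' (\<iota> u) \<in> tangent A \<iota> u"
  unfolding tangent_def mem_Collect_eq
proof (intro allI impI)
  fix W1 U1 F
  assume F: "open W1 \<and> open U1 \<and> u \<in> U1 \<and> \<iota> ` U1 \<subseteq> W1 \<and> smooth_function_on A W1 F \<and> (\<forall>q\<in>U1. F (\<iota> q) = 0)"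
  define V where "V = W \<inter> W1"
  define U' where "U' = U \<inter> U1"
  have V: "open V" "open U'" "u \<in> U'" "\<iota> u \<in> V" "\<iota> ` U' \<subseteq> V"
    using X F u by (auto simp: extends_on_def V_def U'_def)
  have sm: "smooth_field_on A V X'" "smooth_field_on A V Y'" "smooth_function_on A V F"
    using X Y F by (auto simp: extends_on_def V_def intro: smooth_field_on_subset smooth_function_on_subset)
  have Zero: "differential A (\<lambda>q. differential A F q (Z' q)) (\<iota> u) v = 0"
    if Z: "smooth_field_on A V Z'" "\<And>q. q \<in> U' \<Longrightarrow> Z' (\<iota> q) \<in> tangent A \<iota> q" and v: "v \<in> tangent A \<iota> u" for Z' v
  proof (rule tangentD[OF v V(1,4) _ V(2,3)])
    show "smooth_function_on A V (\<lambda>q. differential A F q (Z' q))"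
      by (rule smooth_function_on_differential[OF V(1) sm(3) Z(1)])
    show "differential A F (\<iota> q) (Z' (\<iota> q)) = 0" if "q \<in> U'" for q
      by (rule tangentD[OF Z(2)[OF that] V(1) _ sm(3) V(2) that]) (use V that F in \<open>auto simp: U'_def\<close>)
  qed
  have X': "X' (\<iota> q) \<in> tangent A \<iota> q" if "q \<in> U'" for q
    using tan(1)[of q] X that by (auto simp: extends_on_def U'_def)
  have Y': "Y' (\<iota> q) \<in> tangent A \<iota> q" if "q \<in> U'" for q
    using tan(2)[of q] Y that by (auto simp: extends_on_def U'_def)
  show "differential A F (\<iota> u) (lie_bracket A X' Y' (\<iota> u)) = 0"
    unfolding differential_lie_bracket[OF V(1,4) sm(3,1,2)]
    using Zero[OF sm(2) Y' X'[OF V(3)]] Zero[OF sm(1) X' Y'[OF V(3)]] by simp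
qed

text \<open>The vector \<open>v\<close> is the value at \<open>u\<close> of an ambient field whose restriction is a section of \<open>E\<close>
  near \<open>u\<close>.\<close>

definition extendable :: "('h \<Rightarrow> 'b set) \<Rightarrow> 'h \<Rightarrow> 'b \<Rightarrow> bool" where
  "extendable E u v \<longleftrightarrow> (\<exists>W U X'. open W \<and> open U \<and> u \<in> U \<and> \<iota> ` U \<subseteq> W \<and> smooth_field_on A W X' \<and>
     X' (\<iota> u) = v \<and> (\<forall>q\<in>U. X' (\<iota> q) \<in> E q))"

lemma extendable_add:
  assumes "extendable E1 u v" "extendable E2 u w" "\<And>q x y. x \<in> E1 q \<Longrightarrow> y \<in> E2 q \<Longrightarrow> x + y \<in> E q"
  shows "extendable E u (v + w)"
proof -
  obtain W1 U1 X1 W2 U2 X2 where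
    1: "open W1" "open U1" "u \<in> U1" "\<iota> ` U1 \<subseteq> W1" "smooth_field_on A W1 X1" "X1 (\<iota> u) = v" "\<forall>q\<in>U1. X1 (\<iota> q) \<in> E1 q"
    and 2: "open W2" "open U2" "u \<in> U2" "\<iota> ` U2 \<subseteq> W2" "smooth_field_on A W2 X2" "X2 (\<iota> u) = w" "\<forall>q\<in>U2. X2 (\<iota> q) \<in> E2 q"
    using assms(1,2) unfolding extendable_def by blast
  have "smooth_field_on A (W1 \<inter> W2) (\<lambda>p. X1 p + X2 p)"
    using 1 2 by (intro smooth_field_on_add) (auto intro: smooth_field_on_subset)
  then show ?thesis
    unfolding extendable_def using 1 2 assms(3)
    by (intro exI[of _ "W1 \<inter> W2"] exI[of _ "U1 \<inter> U2"] exI[of _ "\<lambda>p. X1 p + X2 p"]) auto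
qed

text \<open>The extendable vectors form a subspace, and they include the values at \<open>u\<close> of a local frame.\<close>

lemma distribution_extendable:
  assumes E: "smooth_distribution A \<iota> k E" and v: "v \<in> E u"
  shows "extendable E u v"
proof -
  obtain U F where U: "open U" "u \<in> U" "\<And>i. i < k \<Longrightarrow> F i \<in> sections A \<iota> E U"
    "\<And>q. q \<in> U \<Longrightarrow> E q = span {F i q |i. i < k}"
    using E unfolding smooth_distribution_def by meson
  have sub: "subspace (E q)" for q using E by (simp add: smooth_distribution_def)
  have "v \<in> span {F i u |i. i < k}" using U v by simp
  then show ?thesis
  proof (induction rule: span_induct)
    case (step x)
    then obtain i where i: "i < k" "x = F i u" by blast
    from U(3)[OF i(1)] U(2) obtain X' where "extends_near A \<iota> u (F i) X'"
      unfolding sections_def smooth_along_def by blast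
    then obtain W U1 where W: "u \<in> U1" "extends_on W U1 (F i) X'" unfolding extends_near_iff by blast
    have "F i q \<in> E q" if "q \<in> U" for q using U(3)[OF i(1)] that by (simp add: sections_def)
    then have "\<forall>q\<in>U1 \<inter> U. X' (\<iota> q) \<in> E q" using W(2) unfolding extends_on_def by (metis IntE)
    then show ?case
      using W U(1,2) i unfolding extendable_def extends_on_def
      by (intro exI[of _ W] exI[of _ "U1 \<inter> U"] exI[of _ X']) auto
  next
    case base
    show ?case
      unfolding subspace_def
    proof (intro conjI ballI allI)
      have "smooth_field_on A UNIV (\<lambda>p. 0)" by (simp add: smooth_field_on_zero)
      then show "0 \<in> Collect (extendable E u)"
        unfolding extendable_def mem_Collect_eq using subspace_0[OF sub]
        by (intro exI[of _ UNIV] exI[of _ "\<lambda>p. 0"]) auto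
      show "x + y \<in> Collect (extendable E u)" if "x \<in> Collect (extendable E u)" "y \<in> Collect (extendable E u)" for x y
        using extendable_add[of E u x E y E, OF _ _ subspace_add[OF sub]] that by blast
      show "a *\<^sub>R x \<in> Collect (extendable E u)" if "x \<in> Collect (extendable E u)" for x a
      proof -
        from that have "extendable E u x" by simp
        then obtain W U X where X: "open W" "open U" "u \<in> U" "\<iota> ` U \<subseteq> W" "smooth_field_on A W X" "X (\<iota> u) = x"
          "\<forall>q\<in>U. X (\<iota> q) \<in> E q"
          unfolding extendable_def by blast
        then show ?thesis
          unfolding extendable_def mem_Collect_eq using subspace_scale[OF sub]
          by (intro exI[of _ W] exI[of _ U] exI[of _ "\<lambda>p. a *\<^sub>R X p"]) (auto intro: smooth_field_on_cscale)
      qed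
    qed
  qed
qed

end

section \<open>Frames adapted to a screen distribution\<close>

context levi_civita_manifold
begin

lemma g_sum_left: "g p (\<Sum>i\<in>I. f i) w = (\<Sum>i\<in>I. g p (f i) w)"
  by (rule bilinear_sum_left[OF g_bilinear])

text \<open>One Gram-Schmidt step: the component of \<open>X\<close> orthogonal to the fields \<open>F i\<close>, which have to be
  mutually orthogonal and nowhere null.\<close>

definition orthogonal_part :: "'i set \<Rightarrow> ('i \<Rightarrow> 'm \<Rightarrow> 'b) \<Rightarrow> ('m \<Rightarrow> 'b) \<Rightarrow> 'm \<Rightarrow> 'b" where
  "orthogonal_part I F X p = X p - (\<Sum>i\<in>I. (g p (X p) (F i p) * inverse (g p (F i p) (F i p))) *\<^sub>R F i p)"

lemma orthogonal_part_smooth: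
  assumes "open W" "finite I" "smooth_field_on A W X" "\<And>i. i \<in> I \<Longrightarrow> smooth_field_on A W (F i)"
    "\<And>i p. i \<in> I \<Longrightarrow> p \<in> W \<Longrightarrow> g p (F i p) (F i p) \<noteq> 0"
  shows "smooth_field_on A W (orthogonal_part I F X)"
  unfolding orthogonal_part_def
  using assms
  by (intro smooth_field_on_diff smooth_field_on_sum smooth_field_on_scale smooth_function_on_mult
      smooth_function_on_inverse g_smooth) auto

lemma orthogonal_part_orthogonal:
  assumes "finite I" "\<And>i. i \<in> I \<Longrightarrow> g p (F i p) (F i p) \<noteq> 0"
    "\<And>i j. i \<in> I \<Longrightarrow> j \<in> I \<Longrightarrow> i \<noteq> j \<Longrightarrow> g p (F i p) (F j p) = 0" "j \<in> I"
  shows "g p (orthogonal_part I F X p) (F j p) = 0"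
proof -
  have "(\<Sum>i\<in>I. g p (X p) (F i p) * inverse (g p (F i p) (F i p)) * g p (F i p) (F j p))
      = (\<Sum>i\<in>I. if i = j then g p (X p) (F j p) else 0)"
    by (rule sum.cong) (use assms in auto)
  also have "\<dots> = g p (X p) (F j p)" using assms by simp
  finally show ?thesis by (simp add: orthogonal_part_def g_sum_left)
qed

end

locale screened_hypersurface = immersed_hypersurface A D g \<iota>
  for A :: "('m::t2_space, 'b::euclidean_space) chart set"
    and D :: "('m \<Rightarrow> 'b) \<Rightarrow> ('m \<Rightarrow> 'b) \<Rightarrow> 'm \<Rightarrow> 'b"
    and g :: "'m \<Rightarrow> 'b \<Rightarrow> 'b \<Rightarrow> real"
    and \<iota> :: "'h::topological_space \<Rightarrow> 'm" +
  fixes S :: "'h \<Rightarrow> 'b set"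
  assumes lightlike: "lightlike_hypersurface A g \<iota>" and screen: "screen_distribution A g \<iota> S"
begin

abbreviation "T \<equiv> tangent A \<iota>"
abbreviation "Rad \<equiv> rad A g \<iota>"

lemma rad_normal: "Rad u = normal A g \<iota> u"
  using lightlike by (simp add: lightlike_hypersurface_def)

lemma rad_distribution: "smooth_distribution A \<iota> 1 Rad"
  using lightlike by (simp add: lightlike_hypersurface_def)

lemma dim_rad: "dim (Rad u) = 1"
  using rad_distribution by (simp add: smooth_distribution_def)

lemma subspace_screen: "subspace (S u)" and screen_tangent: "w \<in> S u \<Longrightarrow> w \<in> T u"
  using screen by (auto simp: smooth_distribution_def screen_distribution_def)

lemma rad_tangent: "x \<in> Rad u \<Longrightarrow> x \<in> T u"
  by (simp add: rad_def)

lemma rad_orthogonal: "x \<in> Rad u \<Longrightarrow> w \<in> T u \<Longrightarrow> g (\<iota> u) x w = 0"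
  by (simp add: rad_def normal_def)

lemma tangent_decompose: "x \<in> T u \<Longrightarrow> \<exists>s\<in>S u. \<exists>r\<in>Rad u. x = s + r"
  using screen unfolding screen_distribution_def by blast

lemma screen_nondegenerate: "v \<in> S u \<Longrightarrow> (\<And>w. w \<in> S u \<Longrightarrow> g (\<iota> u) v w = 0) \<Longrightarrow> v = 0"
  using screen unfolding screen_distribution_def by blast

lemma rad_nonzero: "\<exists>x\<in>Rad u. x \<noteq> 0"
proof (rule ccontr)
  assume "\<not> ?thesis"
  then have "Rad u \<subseteq> {0}" by blast
  then have "dim (Rad u) = 0" by (simp add: dim_eq_0)
  then show False using dim_rad by simp
qed

lemma rad_multiple:
  assumes "x \<in> Rad u" "x \<noteq> 0" "y \<in> Rad u" shows "\<exists>a. y = a *\<^sub>R x"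
proof -
  have "Rad u \<subseteq> span {x}"
    by (rule card_ge_dim_independent) (use assms dim_rad in auto)
  then show ?thesis using assms(3) by (auto simp: span_singleton)
qed

text \<open>The tangent space is the orthogonal complement of the radical, that is, the double orthogonal
  complement of itself. A vector outside it would be detected by a functional vanishing
  on \<open>T u\<close>; that functional is represented by a normal vector, which is a multiple of \<open>x\<close>.\<close>

lemma tangent_iff:
  assumes x: "x \<in> Rad u" "x \<noteq> 0"
  shows "v \<in> T u \<longleftrightarrow> g (\<iota> u) v x = 0"
proof
  show "v \<in> T u \<Longrightarrow> g (\<iota> u) v x = 0" using rad_orthogonal[OF x(1)] g_sym by metis
  assume 0: "g (\<iota> u) v x = 0"
  show "v \<in> T u"
  proof (rule ccontr)
    assume v: "v \<notin> T u"
    obtain y z where yz: "y \<in> span (T u)" "\<And>w. w \<in> span (T u) \<Longrightarrow> inner z w = 0" "v = y + z"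
      using orthogonal_subspace_decomp_exists[of "T u" v] unfolding Linear_Algebra.orthogonal_def by metis
    have sp: "span (T u) = T u" using subspace_tangent by (simp add: span_eq_iff)
    have "\<exists>w. \<forall>x. g (\<iota> u) w x = inner z x"
      by (rule nondegenerate_represents_functionals[OF g_bilinear]) (use g_nondegenerate in blast)
    then obtain w where w: "\<And>x. g (\<iota> u) w x = inner z x" by blast
    have "w \<in> normal A g \<iota> u"
      using yz(2) sp by (auto simp: normal_def w)
    then obtain a where "w = a *\<^sub>R x" using rad_multiple[OF x] rad_normal by auto
    then have "inner z v = 0" using w[of v] 0 g_sym[of "\<iota> u" v x] by simp
    moreover have "inner z y = 0" using yz(1,2) by simp
    ultimately have "z = 0" using yz(3) by (simp add: inner_add_right)
    then show False using v yz(1,3) sp by simp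
  qed
qed

definition is_transversal :: "'h \<Rightarrow> 'b \<Rightarrow> 'b \<Rightarrow> bool" where
  "is_transversal u x N \<longleftrightarrow> (\<forall>w\<in>S u. g (\<iota> u) N w = 0) \<and> g (\<iota> u) x N = 1 \<and> g (\<iota> u) N N = 0"

text \<open>The difference of two candidates is orthogonal to the screen and to \<open>x\<close>, so it is normal and a
  multiple \<open>t x\<close>; comparing the squares of the candidates gives \<open>t = 0\<close>.\<close>

lemma transversal_unique:
  assumes "x \<in> Rad u" "x \<noteq> 0" "is_transversal u x N" "is_transversal u x N'"
  shows "N = N'"
proof -
  have "g (\<iota> u) (N - N') w = 0" if w: "w \<in> T u" for w
  proof -
    obtain s r where sr: "s \<in> S u" "r \<in> Rad u" "w = s + r" using tangent_decompose[OF w] by blast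
    obtain a where a: "r = a *\<^sub>R x" using rad_multiple[OF assms(1,2) sr(2)] by blast
    have "g (\<iota> u) N x = 1" "g (\<iota> u) N' x = 1" using assms(3,4) g_sym unfolding is_transversal_def by metis+
    then show ?thesis using assms(3,4) sr a by (simp add: is_transversal_def)
  qed
  then have "N - N' \<in> Rad u" by (simp add: rad_normal normal_def)
  then obtain t where "N - N' = t *\<^sub>R x" using rad_multiple[OF assms(1,2)] by blast
  then have N: "N = N' + t *\<^sub>R x" by (simp add: algebra_simps)
  have "g (\<iota> u) N N = 2 * t"
    using assms(4) rad_orthogonal[OF assms(1) rad_tangent[OF assms(1)]] g_sym[of "\<iota> u" N' x]
    by (simp add: N is_transversal_def)
  then show ?thesis using assms(3) N by (simp add: is_transversal_def)
qed

lemma transversal_eq: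
  assumes "\<xi> u \<in> Rad u" "\<xi> u \<noteq> 0" "is_transversal u (\<xi> u) N"
  shows "transversal g \<iota> S \<xi> u = N"
  unfolding transversal_def
  by (rule the_equality) (use assms transversal_unique in \<open>auto simp: is_transversal_def\<close>)

text \<open>Orthogonality and nonvanishing squares are required on the ambient open set \<open>W\<close>, not only along the
  hypersurface, so that quotients of these functions are smooth there.\<close>

definition screen_frame :: "'m set \<Rightarrow> 'h set \<Rightarrow> 'i set \<Rightarrow> ('i \<Rightarrow> 'm \<Rightarrow> 'b) \<Rightarrow> bool" where
  "screen_frame W U I F \<longleftrightarrow> open W \<and> open U \<and> \<iota> ` U \<subseteq> W \<and>
    (\<forall>i\<in>I. smooth_field_on A W (F i) \<and> (\<forall>q\<in>U. F i (\<iota> q) \<in> S q) \<and> (\<forall>p\<in>W. g p (F i p) (F i p) \<noteq> 0)) \<and>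
    (\<forall>p\<in>W. \<forall>i\<in>I. \<forall>j\<in>I. i \<noteq> j \<longrightarrow> g p (F i p) (F j p) = 0)"

lemma screen_frameD:
  assumes "screen_frame W U I F"
  shows "open W" "open U" "\<iota> ` U \<subseteq> W" "\<And>i. i \<in> I \<Longrightarrow> smooth_field_on A W (F i)"
    "\<And>i q. i \<in> I \<Longrightarrow> q \<in> U \<Longrightarrow> F i (\<iota> q) \<in> S q"
    "\<And>i p. i \<in> I \<Longrightarrow> p \<in> W \<Longrightarrow> g p (F i p) (F i p) \<noteq> 0"
    "\<And>p i j. p \<in> W \<Longrightarrow> i \<in> I \<Longrightarrow> j \<in> I \<Longrightarrow> i \<noteq> j \<Longrightarrow> g p (F i p) (F j p) = 0"
  using assms by (simp_all add: screen_frame_def)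

text \<open>Gram-Schmidt, starting from sections through the vectors of \<open>E\<close>. Since \<open>E\<close> is already orthogonal,
  no step changes the value at \<open>u\<close>; in particular each new field has a nonzero square at \<open>u\<close>, hence
  near \<open>u\<close>. This is where an indefinite metric could otherwise break the process.\<close>

lemma screen_frame_through:
  assumes "finite E" "E \<subseteq> S u" "\<And>e. e \<in> E \<Longrightarrow> g (\<iota> u) e e \<noteq> 0"
    "\<And>e f. e \<in> E \<Longrightarrow> f \<in> E \<Longrightarrow> e \<noteq> f \<Longrightarrow> g (\<iota> u) e f = 0"
  shows "\<exists>W U F. u \<in> U \<and> screen_frame W U E F \<and> (\<forall>e\<in>E. F e (\<iota> u) = e)"
  using assms
proof (induction E rule: finite_induct)
  case empty
  show ?case by (intro exI[of _ UNIV]) (auto simp: screen_frame_def)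
next
  case (insert e E)
  have "\<exists>W U F. u \<in> U \<and> screen_frame W U E F \<and> (\<forall>e\<in>E. F e (\<iota> u) = e)"
    by (rule insert.IH) (use insert.prems in auto)
  then obtain W U F where u: "u \<in> U" and sf: "screen_frame W U E F" and F_at: "\<And>e. e \<in> E \<Longrightarrow> F e (\<iota> u) = e"
    by blast
  note W = screen_frameD(1-3)[OF sf] and F = screen_frameD(4-7)[OF sf]
  obtain k where "smooth_distribution A \<iota> k S" using screen by (auto simp: screen_distribution_def)
  then have "extendable S u e" using distribution_extendable insert.prems by blast
  then obtain W1 U1 X where X: "open W1" "open U1" "u \<in> U1" "\<iota> ` U1 \<subseteq> W1" "smooth_field_on A W1 X"
    "X (\<iota> u) = e" "\<And>q. q \<in> U1 \<Longrightarrow> X (\<iota> q) \<in> S q"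
    unfolding extendable_def by blast
  define G where "G = orthogonal_part E F X"
  define W2 where "W2 = W \<inter> W1"
  have W2: "open W2" using W X by (auto simp: W2_def)
  have G: "smooth_field_on A W2 G"
    unfolding G_def
    by (rule orthogonal_part_smooth[OF W2 insert.hyps(1)])
      (use F X in \<open>auto simp: W2_def intro: smooth_field_on_subset\<close>)
  define W3 where "W3 = {p \<in> W2. g p (G p) (G p) \<noteq> 0}"
  have W3: "open W3" unfolding W3_def by (rule open_nonzero[OF W2 g_smooth[OF W2 G G]])
  have G_at: "G (\<iota> u) = e"
  proof -
    have "(\<Sum>i\<in>E. (g (\<iota> u) (X (\<iota> u)) (F i (\<iota> u)) * inverse (g (\<iota> u) (F i (\<iota> u)) (F i (\<iota> u)))) *\<^sub>R F i (\<iota> u)) = 0"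
      by (rule sum.neutral) (use X(6) F_at insert.prems(3) insert.hyps(2) in auto)
    then show ?thesis by (simp add: G_def orthogonal_part_def X(6))
  qed
  have G_screen: "G (\<iota> q) \<in> S q" if "q \<in> U" "q \<in> U1" for q
    unfolding G_def orthogonal_part_def
    by (intro subspace_diff subspace_sum subspace_scale subspace_screen X(7) F(2) that)
  have G_orth: "g p (G p) (F f p) = 0" "g p (F f p) (G p) = 0" if "p \<in> W2" "f \<in> E" for p f
  proof -
    show "g p (G p) (F f p) = 0" unfolding G_def
      by (rule orthogonal_part_orthogonal[OF insert.hyps(1)]) (use F that in \<open>auto simp: W2_def\<close>)
    then show "g p (F f p) (G p) = 0" using g_sym by metis
  qed
  have u3: "\<iota> u \<in> W3" using u W X insert.prems G_at by (auto simp: W3_def W2_def)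
  define U3 where "U3 = U \<inter> U1 \<inter> \<iota> -` W3"
  have sub: "W3 \<subseteq> W" "W3 \<subseteq> W2" by (auto simp: W3_def W2_def)
  have eE: "f \<noteq> e" if "f \<in> E" for f using that insert.hyps by auto
  have "screen_frame W3 U3 (insert e E) (F(e := G))"
    unfolding screen_frame_def
  proof (intro conjI)
    show "open W3" by (fact W3)
    show "open U3" unfolding U3_def using W X open_preimage[OF W3] by auto
    show "\<iota> ` U3 \<subseteq> W3" by (auto simp: U3_def)
    show "\<forall>f\<in>insert e E. smooth_field_on A W3 ((F(e := G)) f) \<and>
       (\<forall>q\<in>U3. (F(e := G)) f (\<iota> q) \<in> S q) \<and> (\<forall>p\<in>W3. g p ((F(e := G)) f p) ((F(e := G)) f p) \<noteq> 0)"
      using F(2,3) sub eE smooth_field_on_subset[OF F(1) sub(1)] smooth_field_on_subset[OF G sub(2)] G_screen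
      by (auto simp: U3_def W3_def)
    show "\<forall>p\<in>W3. \<forall>f\<in>insert e E. \<forall>h\<in>insert e E. f \<noteq> h \<longrightarrow> g p ((F(e := G)) f p) ((F(e := G)) h p) = 0"
      using F(4) sub eE G_orth by auto
  qed
  moreover have "u \<in> U3" using u X u3 by (auto simp: U3_def)
  moreover have "\<forall>f\<in>insert e E. (F(e := G)) f (\<iota> u) = f" using G_at F_at by auto
  ultimately show ?case by blast
qed

text \<open>The fields through an orthogonal basis of \<open>S u\<close> remain independent near \<open>u\<close>, and the dimension of
  \<open>S\<close> is constant, so they span \<open>S\<close> near \<open>u\<close>.\<close>

lemma local_screen_frame:
  "\<exists>W U E F. u \<in> U \<and> screen_frame W U (E :: 'b set) F \<and> finite E \<and>
    (\<forall>q\<in>U. S q \<subseteq> span ((\<lambda>e. F e (\<iota> q)) ` E))"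
proof -
  have "\<exists>E. finite E \<and> E \<subseteq> S u \<and> S u \<subseteq> span E \<and> (\<forall>e\<in>E. g (\<iota> u) e e \<noteq> 0) \<and>
    (\<forall>e\<in>E. \<forall>f\<in>E. e \<noteq> f \<longrightarrow> g (\<iota> u) e f = 0)"
    by (rule orthogonal_basis_exists[OF g_bilinear g_sym subspace_screen screen_nondegenerate]) auto
  then obtain E where E: "finite E" "E \<subseteq> S u" "S u \<subseteq> span E" "\<And>e. e \<in> E \<Longrightarrow> g (\<iota> u) e e \<noteq> 0"
    "\<And>e f. e \<in> E \<Longrightarrow> f \<in> E \<Longrightarrow> e \<noteq> f \<Longrightarrow> g (\<iota> u) e f = 0"
    by blast
  obtain W U F where u: "u \<in> U" and sf: "screen_frame W U E F"
    using screen_frame_through[OF E(1,2,4,5)] by blast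
  note W = screen_frameD(1-3)[OF sf] and F = screen_frameD(4-7)[OF sf]
  obtain k where k: "\<And>q. dim (S q) = k"
    using screen by (auto simp: screen_distribution_def smooth_distribution_def)
  have "independent E"
    using orthogonal_family(2)[OF g_bilinear[of "\<iota> u"] E(1), of "\<lambda>e. e"] E(4,5) by simp
  then have card: "card E = k"
    using basis_card_eq_dim[OF E(2,3)] k by simp
  have "S q \<subseteq> span ((\<lambda>e. F e (\<iota> q)) ` E)" if q: "q \<in> U" for q
  proof (rule card_ge_dim_independent)
    have p: "\<iota> q \<in> W" using q W by blast
    note orth = orthogonal_family[OF g_bilinear[of "\<iota> q"] E(1), of "\<lambda>e. F e (\<iota> q)", OF F(4)[OF p] F(3)[OF _ p]]
    show "independent ((\<lambda>e. F e (\<iota> q)) ` E)" by (rule orth(2))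
    show "dim (S q) \<le> card ((\<lambda>e. F e (\<iota> q)) ` E)" using card_image[OF orth(1)] card k by simp
  qed (use F(2)[OF _ q] in auto)
  then show ?thesis using u sf E(1) by blast
qed

text \<open>Ambient extensions of a section of the radical and of the transversal field belonging to it.\<close>

definition adapted_frame :: "'m set \<Rightarrow> 'h set \<Rightarrow> ('m \<Rightarrow> 'b) \<Rightarrow> ('m \<Rightarrow> 'b) \<Rightarrow> bool" where
  "adapted_frame W U \<xi> N \<longleftrightarrow> open W \<and> open U \<and> \<iota> ` U \<subseteq> W \<and> smooth_field_on A W \<xi> \<and> smooth_field_on A W N \<and>
    (\<forall>q\<in>U. \<xi> (\<iota> q) \<in> Rad q \<and> \<xi> (\<iota> q) \<noteq> 0 \<and> is_transversal q (\<xi> (\<iota> q)) (N (\<iota> q)))"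

text \<open>Take a field with a nonzero product with \<open>\<xi>\<close>, make it orthogonal to the screen, normalise its
  product with \<open>\<xi>\<close> to 1 by scaling, and subtract the multiple of \<open>\<xi>\<close> that makes it null.\<close>

lemma adapted_frame_exists: "\<exists>W U \<xi> N. u \<in> U \<and> adapted_frame W U \<xi> N"
proof -
  obtain x where x: "x \<in> Rad u" "x \<noteq> 0" using rad_nonzero by blast
  obtain W0 U0 \<xi> where \<xi>: "open W0" "open U0" "u \<in> U0" "\<iota> ` U0 \<subseteq> W0" "smooth_field_on A W0 \<xi>" "\<xi> (\<iota> u) = x"
    "\<And>q. q \<in> U0 \<Longrightarrow> \<xi> (\<iota> q) \<in> Rad q"
    using distribution_extendable[OF rad_distribution x(1)] unfolding extendable_def by blast
  obtain v where v: "g (\<iota> u) x v \<noteq> 0" using g_nondegenerate x(2) by blast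
  obtain W1 U1 E F where u1: "u \<in> U1" and sf: "screen_frame W1 U1 (E :: 'b set) F" and E: "finite E"
    and span: "\<And>q. q \<in> U1 \<Longrightarrow> S q \<subseteq> span ((\<lambda>e. F e (\<iota> q)) ` E)"
    using local_screen_frame[of u] by blast
  note W1 = screen_frameD(1,2)[OF sf] u1 screen_frameD(3)[OF sf] and F = screen_frameD(4-7)[OF sf]
  define V where "V = constant_field (\<iota> u) v"
  \<comment> \<open>the product with \<open>\<xi>\<close> survives this step along the hypersurface, where \<open>\<xi>\<close> is orthogonal to the screen\<close>
  define G where "G = orthogonal_part E F V"
  define W2 where "W2 = W0 \<inter> W1 \<inter> fst (chart_at A (\<iota> u))"
  have W2: "open W2" "\<iota> u \<in> W2" "W2 \<subseteq> W1"
    using \<xi> W1 chart_at open_chart_domain[OF chart_at(1)] by (auto simp: W2_def)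
  have "smooth_field_on A W2 V"
    unfolding V_def by (rule smooth_field_on_subset[OF smooth_constant_field]) (simp add: W2_def)
  moreover have "smooth_field_on A W2 \<xi>" "\<And>e. e \<in> E \<Longrightarrow> smooth_field_on A W2 (F e)"
    using \<xi> F by (auto simp: W2_def intro: smooth_field_on_subset)
  ultimately have sm: "smooth_field_on A W2 \<xi>" "smooth_field_on A W2 V"
    "\<And>e. e \<in> E \<Longrightarrow> smooth_field_on A W2 (F e)" by blast+
  have G: "smooth_field_on A W2 G"
    unfolding G_def by (rule orthogonal_part_smooth[OF W2(1) E sm(2,3)]) (use F W2 in auto)
  define h where "h = (\<lambda>p. g p (\<xi> p) (G p))"
  have h: "smooth_function_on A W2 h" unfolding h_def by (rule g_smooth[OF W2(1) sm(1) G])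
  define W3 where "W3 = {p \<in> W2. h p \<noteq> 0}"
  have W3: "open W3" "W3 \<subseteq> W2" unfolding W3_def by (rule open_nonzero[OF W2(1) h]) auto
  define H where "H = (\<lambda>p. inverse (h p) *\<^sub>R G p)"
  have H: "smooth_field_on A W3 H"
    unfolding H_def
    by (intro smooth_field_on_scale smooth_function_on_inverse W3)
      (use h G W3 in \<open>auto simp: W3_def intro: smooth_field_on_subset smooth_function_on_subset\<close>)
  \<comment> \<open>the square of \<open>H - s \<xi>\<close> is \<open>g H H - 2 s\<close> where \<open>g H \<xi> = 1\<close> and \<open>g \<xi> \<xi> = 0\<close>\<close>
  define N where "N = (\<lambda>p. H p - ((1/2) * g p (H p) (H p)) *\<^sub>R \<xi> p)"
  have N: "smooth_field_on A W3 N"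
    unfolding N_def
    by (intro smooth_field_on_diff smooth_field_on_scale smooth_function_on_mult smooth_function_on_const
        g_smooth W3 H smooth_field_on_subset[OF sm(1) W3(2)])
  define U3 where "U3 = U0 \<inter> U1 \<inter> \<iota> -` W3"
  have orthS: "g (\<iota> q) (\<xi> (\<iota> q)) (F e (\<iota> q)) = 0" if "q \<in> U0" "q \<in> U1" "e \<in> E" for q e
    using rad_orthogonal \<xi>(7) screen_tangent F(2) that by blast
  have hu: "h (\<iota> u) = g (\<iota> u) x v"
  proof -
    have "g (\<iota> u) (G (\<iota> u)) x = g (\<iota> u) v x"
      using orthS[OF \<xi>(3) W1(3)] g_sym[of "\<iota> u" _ x]
      by (simp add: G_def orthogonal_part_def V_def g_sum_left \<xi>(6))
    then show ?thesis unfolding h_def \<xi>(6) using g_sym by metis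
  qed
  have "open U3" unfolding U3_def using \<xi> W1 open_preimage[OF W3(1)] by auto
  moreover have "u \<in> U3" using hu v \<xi> W1 W2 by (auto simp: U3_def W3_def)
  moreover have "\<iota> ` U3 \<subseteq> W3" by (auto simp: U3_def)
  moreover have "\<xi> (\<iota> q) \<in> Rad q \<and> \<xi> (\<iota> q) \<noteq> 0 \<and> is_transversal q (\<xi> (\<iota> q)) (N (\<iota> q))" if "q \<in> U3" for q
  proof -
    let ?p = "\<iota> q"
    have q: "q \<in> U0" "q \<in> U1" "?p \<in> W3" "?p \<in> W2" "?p \<in> W1" "h ?p \<noteq> 0"
      using that W3 W2 by (auto simp: U3_def W3_def)
    have rad: "\<xi> ?p \<in> Rad q" using \<xi>(7) q by blast
    have \<xi>\<xi>: "g ?p (\<xi> ?p) (\<xi> ?p) = 0" using rad_orthogonal[OF rad rad_tangent[OF rad]] .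
    have \<xi>H: "g ?p (\<xi> ?p) (H ?p) = 1" using q by (simp add: H_def h_def)
    then have H\<xi>: "g ?p (H ?p) (\<xi> ?p) = 1" using g_sym by metis
    have HF: "g ?p (H ?p) (F e ?p) = 0" if "e \<in> E" for e
    proof -
      have "g ?p (G ?p) (F e ?p) = 0" unfolding G_def
        by (rule orthogonal_part_orthogonal[OF E]) (use F q that in auto)
      then show ?thesis by (simp add: H_def)
    qed
    have "g ?p (N ?p) w = 0" if "w \<in> S q" for w
    proof -
      have "w \<in> span ((\<lambda>e. F e ?p) ` E)" using span[OF q(2)] that by blast
      then show ?thesis
      proof (induction rule: span_induct)
        case base
        show ?case by (auto simp: subspace_def)
      next
        case (step y)
        then show ?case using HF orthS[OF q(1,2)] by (auto simp: N_def)
      qed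
    qed
    moreover have "\<xi> ?p \<noteq> 0" using q by (auto simp: h_def)
    ultimately show ?thesis
      using rad \<xi>\<xi> \<xi>H H\<xi> by (simp add: is_transversal_def N_def)
  qed
  ultimately have "u \<in> U3 \<and> adapted_frame W3 U3 \<xi> N"
    unfolding adapted_frame_def using W3 N sm(1) by (auto intro: smooth_field_on_subset)
  then show ?thesis by blast
qed

lemma tangent_extendable: "x \<in> T u \<Longrightarrow> extendable T u x"
proof -
  assume "x \<in> T u"
  then obtain s r where sr: "s \<in> S u" "r \<in> Rad u" "x = s + r" using tangent_decompose by blast
  obtain k where k: "smooth_distribution A \<iota> k S" using screen by (auto simp: screen_distribution_def)
  show ?thesis unfolding sr(3)
    by (rule extendable_add[OF distribution_extendable[OF k sr(1)] distribution_extendable[OF rad_distribution sr(2)]])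
      (auto intro: subspace_add[OF subspace_tangent] screen_tangent rad_tangent)
qed

end

section \<open>The Gauss equation\<close>

context screened_hypersurface
begin

lemma adapted_frameD:
  assumes "adapted_frame W U \<xi> N"
  shows "open W" "open U" "\<iota> ` U \<subseteq> W" "smooth_field_on A W \<xi>" "smooth_field_on A W N"
    "\<And>q. q \<in> U \<Longrightarrow> \<xi> (\<iota> q) \<in> Rad q" "\<And>q. q \<in> U \<Longrightarrow> \<xi> (\<iota> q) \<noteq> 0"
    "\<And>q. q \<in> U \<Longrightarrow> is_transversal q (\<xi> (\<iota> q)) (N (\<iota> q))"
  using assms by (simp_all add: adapted_frame_def)

lemma adapted_frame_subset:
  "adapted_frame W U \<xi> N \<Longrightarrow> open W' \<Longrightarrow> open U' \<Longrightarrow> W' \<subseteq> W \<Longrightarrow> U' \<subseteq> U \<Longrightarrow> \<iota> ` U' \<subseteq> W' \<Longrightarrow> adapted_frame W' U' \<xi> N"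
  unfolding adapted_frame_def by (auto intro: smooth_field_on_subset)

lemma adapted_rad_frame:
  assumes "adapted_frame W U \<xi> N" shows "rad_frame A g \<iota> U (\<xi> \<circ> \<iota>)"
proof -
  note f = adapted_frameD[OF assms]
  have "extends_near A \<iota> u (\<xi> \<circ> \<iota>) \<xi>" if "u \<in> U" for u
    using f that unfolding extends_near_def by (intro exI[of _ W] exI[of _ U]) auto
  then show ?thesis
    using f unfolding rad_frame_def sections_def smooth_along_def by auto
qed

text \<open>The projection onto the complement of \<open>x\<close> along \<open>N\<close>, if \<open>g p N x = 1\<close>.\<close>

definition tangent_part :: "'m \<Rightarrow> 'b \<Rightarrow> 'b \<Rightarrow> 'b \<Rightarrow> 'b" where
  "tangent_part p x N w = w - g p w x *\<^sub>R N"

lemma linear_tangent_part: "linear (tangent_part p x N)"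
  unfolding tangent_part_def by (rule linearI) (simp_all add: algebra_simps)

text \<open>Another section of the radical is a multiple of \<open>\<xi>\<close> at \<open>u\<close>, and its transversal vector is the inverse
  multiple of \<open>N\<close>. So the direction along which the projection is taken does not change.\<close>

lemma induced_connection_eq:
  assumes "adapted_frame W U \<xi> N" "u \<in> U"
  shows "induced_connection A g D \<iota> S X Y u
    = tangent_part (\<iota> u) (\<xi> (\<iota> u)) (N (\<iota> u)) (ambient_derivative A D \<iota> X Y u)"
proof -
  note f = adapted_frameD[OF assms(1)]
  let ?p = "\<iota> u" let ?x = "\<xi> (\<iota> u)" let ?N = "N (\<iota> u)" let ?w = "ambient_derivative A D \<iota> X Y u"
  have x: "?x \<in> Rad u" "?x \<noteq> 0" "is_transversal u ?x ?N" using f assms(2) by auto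
  have N: "g ?p ?x ?N = 1" "g ?p ?N ?x = 1" using x(3) g_sym by (auto simp: is_transversal_def)
  show ?thesis
    unfolding induced_connection_def
  proof (rule the_equality)
    have "tangent_part ?p ?x ?N ?w \<in> T u"
      unfolding tangent_iff[OF x(1,2)] by (simp add: tangent_part_def N)
    moreover have "?w = tangent_part ?p ?x ?N ?w + g ?p ?w ?x *\<^sub>R transversal g \<iota> S (\<xi> \<circ> \<iota>) u"
      using transversal_eq[of "\<xi> \<circ> \<iota>" u ?N] x by (simp add: tangent_part_def)
    ultimately show "tangent_part ?p ?x ?N ?w \<in> T u \<and>
        (\<exists>U \<xi> b. rad_frame A g \<iota> U \<xi> \<and> u \<in> U \<and> ?w = tangent_part ?p ?x ?N ?w + b *\<^sub>R transversal g \<iota> S \<xi> u)"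
      using adapted_rad_frame[OF assms(1)] assms(2) by blast
  next
    fix v
    assume "v \<in> T u \<and> (\<exists>U \<xi> b. rad_frame A g \<iota> U \<xi> \<and> u \<in> U \<and> ?w = v + b *\<^sub>R transversal g \<iota> S \<xi> u)"
    then obtain U' \<xi>' b where v: "v \<in> T u" "rad_frame A g \<iota> U' \<xi>'" "u \<in> U'"
      "?w = v + b *\<^sub>R transversal g \<iota> S \<xi>' u" by blast
    have \<xi>': "\<xi>' u \<in> Rad u" "\<xi>' u \<noteq> 0" using v by (auto simp: rad_frame_def sections_def)
    then obtain a where a: "\<xi>' u = a *\<^sub>R ?x" using rad_multiple[OF x(1,2)] by blast
    have "is_transversal u (\<xi>' u) (inverse a *\<^sub>R ?N)"
      using x(3) \<xi>'(2) a by (auto simp: is_transversal_def)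
    then have "transversal g \<iota> S \<xi>' u = inverse a *\<^sub>R ?N" using transversal_eq \<xi>' by blast
    then have w: "?w = v + (b * inverse a) *\<^sub>R ?N" using v(4) by simp
    have "g ?p v ?x = 0" using tangent_iff[OF x(1,2)] v(1) by blast
    then have "g ?p ?w ?x = b * inverse a" unfolding w by (simp add: N)
    then show "v = tangent_part ?p ?x ?N ?w" unfolding tangent_part_def using w by simp
  qed
qed

lemma extends_onD:
  assumes "extends_on W U X X'"
  shows "open W" "open U" "\<iota> ` U \<subseteq> W" "smooth_field_on A W X'" "\<And>q. q \<in> U \<Longrightarrow> X' (\<iota> q) = X q"
  using assms by (simp_all add: extends_on_def)

lemma differential_zero_along:
  assumes "open W" "open U" "\<iota> ` U \<subseteq> W" "smooth_function_on A W f" "\<And>q. q \<in> U \<Longrightarrow> f (\<iota> q) = 0"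
    "u \<in> U" "x \<in> T u"
  shows "differential A f (\<iota> u) x = 0"
  by (rule tangentD[OF assms(7,1) _ assms(4,2,6,5)]) (use assms in auto)

lemma induced_connection_extends:
  assumes fr: "adapted_frame W U \<xi> N" and Y: "extends_on W U Y Y'" and Z: "extends_on W U Z Z'"
    and tan: "\<And>q. q \<in> U \<Longrightarrow> Y q \<in> T q"
  shows "extends_on W U (induced_connection A g D \<iota> S Y Z)
    (\<lambda>p. D Y' Z' p - g p (D Y' Z' p) (\<xi> p) *\<^sub>R N p)"
  unfolding extends_on_def
proof (intro conjI ballI)
  note f = adapted_frameD[OF fr] and Y' = extends_onD[OF Y] and Z' = extends_onD[OF Z]
  show "open W" "open U" "\<iota> ` U \<subseteq> W" by (fact f)+
  show "smooth_field_on A W (\<lambda>p. D Y' Z' p - g p (D Y' Z' p) (\<xi> p) *\<^sub>R N p)"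
    by (intro smooth_field_on_diff smooth_field_on_scale g_smooth D_smooth f Y' Z')
  show "induced_connection A g D \<iota> S Y Z q = D Y' Z' (\<iota> q) - g (\<iota> q) (D Y' Z' (\<iota> q)) (\<xi> (\<iota> q)) *\<^sub>R N (\<iota> q)"
    if "q \<in> U" for q
    unfolding induced_connection_eq[OF fr that] ambient_derivative_eq[OF Y Z that tan[OF that]] tangent_part_def ..
qed

text \<open>The tangential part of the derivative of \<open>N\<close>, with the sign of the Weingarten formula.\<close>

definition shape_operator :: "'h \<Rightarrow> ('m \<Rightarrow> 'b) \<Rightarrow> ('m \<Rightarrow> 'b) \<Rightarrow> 'b \<Rightarrow> 'b" where
  "shape_operator u \<xi> N x
    = - tangent_part (\<iota> u) (\<xi> (\<iota> u)) (N (\<iota> u)) (vector_derivative_at (\<iota> u) x N)"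

text \<open>The coefficient \<open>g (D Y Z) \<xi>\<close> of \<open>N\<close> in the Gauss formula, with the derivative moved from \<open>Z\<close> to \<open>\<xi>\<close>.
  This is possible because \<open>g Z \<xi> = 0\<close> along the hypersurface, and it makes the tensorial character
  visible: no derivative of \<open>Z\<close> occurs, and \<open>\<xi>\<close> is differentiated along a vector.\<close>

definition second_form :: "'h \<Rightarrow> ('m \<Rightarrow> 'b) \<Rightarrow> 'b \<Rightarrow> 'b \<Rightarrow> real" where
  "second_form u \<xi> y z = - g (\<iota> u) z (vector_derivative_at (\<iota> u) y \<xi>)"

text \<open>Let \<open>pr\<close> be the projection onto the tangent space along \<open>N\<close>. Differentiating
  \<open>\<nabla>\<^sub>Y Z = D Y Z - h(Y,Z) N\<close> along \<open>X\<close> and applying \<open>pr\<close> kills the derivative of the coefficient,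
  because \<open>pr N = 0\<close>, and leaves \<open>pr (D X (D Y Z)) + h(Y,Z) B X\<close>. The ambient parts combine to the
  projection of the ambient curvature, which is tangent already.\<close>

lemma gauss_equation:
  assumes cc: "constant_curvature A g D c" and fr: "adapted_frame W U \<xi> N" and u: "u \<in> U"
    and X: "extends_on W U X X'" and Y: "extends_on W U Y Y'" and Z: "extends_on W U Z Z'"
    and tan: "\<And>q. q \<in> U \<Longrightarrow> X q \<in> T q" "\<And>q. q \<in> U \<Longrightarrow> Y q \<in> T q" "\<And>q. q \<in> U \<Longrightarrow> Z q \<in> T q"
  shows "induced_curvature_field A g D \<iota> S X Y Z u =
    c *\<^sub>R (g (\<iota> u) (Y u) (Z u) *\<^sub>R X u - g (\<iota> u) (X u) (Z u) *\<^sub>R Y u)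
    + second_form u \<xi> (Y u) (Z u) *\<^sub>R shape_operator u \<xi> N (X u)
    - second_form u \<xi> (X u) (Z u) *\<^sub>R shape_operator u \<xi> N (Y u)"
proof -
  note f = adapted_frameD[OF fr] and X' = extends_onD[OF X] and Y' = extends_onD[OF Y] and Z' = extends_onD[OF Z]
  let ?p = "\<iota> u"
  have p: "?p \<in> W" using f u by blast
  let ?pr = "tangent_part ?p (\<xi> ?p) (N ?p)"
  note lin = linear_tangent_part[of ?p "\<xi> ?p" "N ?p"]
  have tr: "is_transversal u (\<xi> ?p) (N ?p)" using f u by blast
  have prN: "?pr (N ?p) = 0" using tr g_sym[of ?p "N ?p" "\<xi> ?p"] by (simp add: tangent_part_def is_transversal_def)
  have prT: "?pr x = x" if "x \<in> T u" for x
    using tangent_iff[of "\<xi> ?p" u x] f u that by (simp add: tangent_part_def)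
  have coefficient: "g ?p (D V' Z' ?p) (\<xi> ?p) = second_form u \<xi> (V u) (Z u)"
    if V: "extends_on W U V V'" and tV: "V u \<in> T u" for V V'
  proof -
    note V' = extends_onD[OF V]
    have "differential A (\<lambda>q. g q (Z' q) (\<xi> q)) ?p (V' ?p) = 0"
    proof (rule differential_zero_along[OF f(1-3) g_smooth[OF f(1) Z'(4) f(4)] _ u])
      show "g (\<iota> q) (Z' (\<iota> q)) (\<xi> (\<iota> q)) = 0" if "q \<in> U" for q
        using tangent_iff[OF f(6,7)[OF that], of "Z q"] tan(3)[OF that] Z'(5)[OF that] by simp
    qed (use V'(5) u tV in simp)
    moreover have "D V' \<xi> ?p = vector_derivative_at ?p (V u) \<xi>"
      using D_eq_vector_derivative_at[OF f(1) p V'(4) f(4)] V'(5)[OF u] by simp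
    ultimately show ?thesis
      using metric_compatible[OF f(1) p V'(4) Z'(4) f(4)] Z'(5)[OF u] by (simp add: second_form_def)
  qed
  have nabla2: "induced_connection A g D \<iota> S V (induced_connection A g D \<iota> S Y Z) u
      = ?pr (D V' (D Y' Z') ?p) + second_form u \<xi> (Y u) (Z u) *\<^sub>R shape_operator u \<xi> N (V u)"
    if V: "extends_on W U V V'" and Y: "extends_on W U Y Y'" and tV: "\<And>q. q \<in> U \<Longrightarrow> V q \<in> T q"
      and tY: "\<And>q. q \<in> U \<Longrightarrow> Y q \<in> T q" for V V' Y Y'
  proof -
    note V' = extends_onD[OF V] and Y' = extends_onD[OF Y]
    let ?h = "\<lambda>p. g p (D Y' Z' p) (\<xi> p)"
    have h: "smooth_function_on A W ?h" by (intro g_smooth D_smooth f Y' Z')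
    have "ambient_derivative A D \<iota> V (induced_connection A g D \<iota> S Y Z) u = D V' (\<lambda>p. D Y' Z' p - ?h p *\<^sub>R N p) ?p"
      by (rule ambient_derivative_eq[OF V induced_connection_extends[OF fr Y Z tY] u tV[OF u]])
    also have "\<dots> = D V' (D Y' Z') ?p - D V' (\<lambda>p. ?h p *\<^sub>R N p) ?p"
      by (rule D_diff_right[OF f(1) p]) (intro smooth_field_on_scale h D_smooth f V' Y' Z')+
    also have "D V' (\<lambda>p. ?h p *\<^sub>R N p) ?p = differential A ?h ?p (V' ?p) *\<^sub>R N ?p + ?h ?p *\<^sub>R D V' N ?p"
      by (rule D_leibniz[OF f(1) p h V'(4) f(5)])
    also have "D V' N ?p = vector_derivative_at ?p (V u) N"
      using D_eq_vector_derivative_at[OF f(1) p V'(4) f(5)] V'(5)[OF u] by simp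
    also have "?h ?p = second_form u \<xi> (Y u) (Z u)" by (rule coefficient[OF Y tY[OF u]])
    finally show ?thesis
      unfolding induced_connection_eq[OF fr u] shape_operator_def
      by (simp add: linear_diff[OF lin] linear_add[OF lin] linear_scale[OF lin] prN)
  qed
  have bracket: "extends_on W U (tangent_bracket A \<iota> X Y) (lie_bracket A X' Y')"
    unfolding extends_on_def
  proof (intro conjI ballI)
    show "smooth_field_on A W (lie_bracket A X' Y')" by (rule lie_bracket_smooth[OF f(1) X'(4) Y'(4)])
    show "tangent_bracket A \<iota> X Y q = lie_bracket A X' Y' (\<iota> q)" if "q \<in> U" for q
      by (rule tangent_bracket_eq[OF X Y that tan(1,2)[OF that]])
  qed (fact f)+
  have "tangent_bracket A \<iota> X Y u \<in> T u"
    using lie_bracket_tangent[OF X Y u tan(1,2)] extends_onD(5)[OF bracket u] by simp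
  then have nabla_bracket: "induced_connection A g D \<iota> S (tangent_bracket A \<iota> X Y) Z u = ?pr (D (lie_bracket A X' Y') Z' ?p)"
    unfolding induced_connection_eq[OF fr u] using ambient_derivative_eq[OF bracket Z u] by simp
  have "?pr (ambient_curvature A D X' Y' Z' ?p)
      = ?pr (D X' (D Y' Z') ?p) - ?pr (D Y' (D X' Z') ?p) - ?pr (D (lie_bracket A X' Y') Z' ?p)"
    unfolding ambient_curvature_def by (simp add: linear_diff[OF lin])
  moreover have "ambient_curvature A D X' Y' Z' ?p
      = c *\<^sub>R (g ?p (Y u) (Z u) *\<^sub>R X u - g ?p (X u) (Z u) *\<^sub>R Y u)"
    using cc[unfolded constant_curvature_def, THEN spec[of _ W], THEN spec[of _ X'], THEN spec[of _ Y'],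
        THEN spec[of _ Z']] p f X' Y' Z' u by simp
  moreover have "?pr (c *\<^sub>R (g ?p (Y u) (Z u) *\<^sub>R X u - g ?p (X u) (Z u) *\<^sub>R Y u))
      = c *\<^sub>R (g ?p (Y u) (Z u) *\<^sub>R X u - g ?p (X u) (Z u) *\<^sub>R Y u)"
    by (simp add: linear_scale[OF lin] linear_diff[OF lin] prT tan u)
  ultimately show ?thesis
    using nabla2[OF X Y tan(1,2)] nabla2[OF Y X tan(2,1)]
    unfolding induced_curvature_field_def Let_def nabla_bracket by simp
qed

lemma linear_shape_operator:
  assumes "adapted_frame W U \<xi> N" "u \<in> U" shows "linear (shape_operator u \<xi> N)"
proof -
  note f = adapted_frameD[OF assms(1)]
  have "linear (\<lambda>v. vector_derivative_at (\<iota> u) v N)"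
    by (rule linear_vector_derivative_at[OF f(1) _ f(5)]) (use f assms in auto)
  then have "linear (\<lambda>v. tangent_part (\<iota> u) (\<xi> (\<iota> u)) (N (\<iota> u)) (vector_derivative_at (\<iota> u) v N))"
    using linear_compose[OF _ linear_tangent_part] by (simp add: o_def)
  then show ?thesis unfolding shape_operator_def by (rule linear_compose_neg)
qed

lemma bilinear_second_form:
  assumes "adapted_frame W U \<xi> N" "u \<in> U" shows "bilinear (second_form u \<xi>)"
proof -
  note f = adapted_frameD[OF assms(1)]
  have lin: "linear (\<lambda>v. vector_derivative_at (\<iota> u) v \<xi>)"
    by (rule linear_vector_derivative_at[OF f(1) _ f(4)]) (use f assms in auto)
  show ?thesis
    unfolding second_form_def bilinear_def
    by (auto intro!: linearI simp: linear_add[OF lin] linear_scale[OF lin])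
qed

text \<open>Differentiating \<open>g N N = 0\<close> shows that the derivative of \<open>N\<close> is orthogonal to \<open>N\<close>. A tangent vector
  orthogonal to \<open>N\<close> lies in the screen.\<close>

lemma shape_operator_screen:
  assumes "adapted_frame W U \<xi> N" "u \<in> U" "x \<in> T u"
  shows "shape_operator u \<xi> N x \<in> T u" "g (\<iota> u) (N (\<iota> u)) (shape_operator u \<xi> N x) = 0"
proof -
  note f = adapted_frameD[OF assms(1)]
  let ?p = "\<iota> u"
  have tr: "is_transversal u (\<xi> ?p) (N ?p)" using f assms by blast
  have p: "?p \<in> W" using f assms by blast
  have N\<xi>: "g ?p (N ?p) (\<xi> ?p) = 1" using tr g_sym[of ?p "N ?p" "\<xi> ?p"] by (simp add: is_transversal_def)
  show "shape_operator u \<xi> N x \<in> T u"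
    unfolding tangent_iff[OF f(6,7)[OF assms(2)]] by (simp add: shape_operator_def tangent_part_def N\<xi>)
  let ?c = "chart_at A ?p"
  let ?V = "W \<inter> fst ?c"
  have V: "open ?V" "?p \<in> ?V" using f(1) p chart_at open_chart_domain[OF chart_at(1)] by auto
  have F: "smooth_field_on A ?V (constant_field ?p x)" "smooth_field_on A ?V N"
    by (auto intro: smooth_field_on_subset[OF smooth_constant_field] smooth_field_on_subset[OF f(5)])
  have "differential A (\<lambda>q. g q (N q) (N q)) ?p x = 0"
  proof (rule differential_zero_along[OF f(1-3) g_smooth[OF f(1,5,5)] _ assms(2,3)])
    show "g (\<iota> q) (N (\<iota> q)) (N (\<iota> q)) = 0" if "q \<in> U" for q using f(8)[OF that] by (simp add: is_transversal_def)
  qed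
  then have "g ?p (N ?p) (vector_derivative_at ?p x N) = 0"
    using metric_compatible[OF V F(1,2,2)] g_sym[of ?p "N ?p" "vector_derivative_at ?p x N"]
    by (simp add: vector_derivative_at_def)
  then show "g ?p (N ?p) (shape_operator u \<xi> N x) = 0"
    using tr by (simp add: shape_operator_def tangent_part_def is_transversal_def)
qed

text \<open>The right-hand side of the Gauss equation depends only on the values of the fields at \<open>u\<close>. This is
  the tensoriality that makes the description of the curvature on single vectors
  unambiguous; the sections through given vectors come from \<open>tangent_extendable\<close>.\<close>

lemma induced_curvature_gauss:
  assumes cc: "constant_curvature A g D c" and fr: "adapted_frame W U \<xi> N" and u: "u \<in> U"
  defines "R \<equiv> \<lambda>x y z. c *\<^sub>R (g (\<iota> u) y z *\<^sub>R x - g (\<iota> u) x z *\<^sub>R y)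
    + second_form u \<xi> y z *\<^sub>R shape_operator u \<xi> N x - second_form u \<xi> x z *\<^sub>R shape_operator u \<xi> N y"
  shows "open V \<Longrightarrow> u \<in> V \<Longrightarrow> {X, Y, Z} \<subseteq> sections A \<iota> T V
      \<Longrightarrow> induced_curvature_field A g D \<iota> S X Y Z u = R (X u) (Y u) (Z u)"
    and "x \<in> T u \<Longrightarrow> y \<in> T u \<Longrightarrow> z \<in> T u \<Longrightarrow> induced_curvature A g D \<iota> S u x y z = R x y z"
proof -
  show field: "induced_curvature_field A g D \<iota> S X Y Z u = R (X u) (Y u) (Z u)"
    if V: "open V" "u \<in> V" and sec: "{X, Y, Z} \<subseteq> sections A \<iota> T V" for V X Y Z
  proof -
    have "\<exists>X'. extends_near A \<iota> u X X'" "\<exists>Y'. extends_near A \<iota> u Y Y'" "\<exists>Z'. extends_near A \<iota> u Z Z'"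
      using sec V(2) by (auto simp: sections_def smooth_along_def)
    then obtain X' Y' Z' W1 U1 W2 U2 W3 U3 where
      X: "u \<in> U1" "extends_on W1 U1 X X'" and Y: "u \<in> U2" "extends_on W2 U2 Y Y'"
      and Z: "u \<in> U3" "extends_on W3 U3 Z Z'"
      unfolding extends_near_iff by blast
    note X' = extends_onD[OF X(2)] and Y' = extends_onD[OF Y(2)] and Z' = extends_onD[OF Z(2)]
      and f = adapted_frameD[OF fr]
    define W' where "W' = W \<inter> W1 \<inter> W2 \<inter> W3"
    define U' where "U' = U \<inter> V \<inter> U1 \<inter> U2 \<inter> U3"
    have o: "open W'" "open U'" "\<iota> ` U' \<subseteq> W'" "u \<in> U'"
      using f(1-3) X'(1-3) Y'(1-3) Z'(1-3) V X(1) Y(1) Z(1) u by (auto simp: W'_def U'_def)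
    have fr': "adapted_frame W' U' \<xi> N"
      by (rule adapted_frame_subset[OF fr o(1,2) _ _ o(3)]) (auto simp: W'_def U'_def)
    have "extends_on W' U' X X'" "extends_on W' U' Y Y'" "extends_on W' U' Z Z'"
      using o X(2) Y(2) Z(2) unfolding extends_on_def
      by (auto simp: W'_def U'_def intro: smooth_field_on_subset)
    moreover have "X q \<in> T q" "Y q \<in> T q" "Z q \<in> T q" if "q \<in> U'" for q
      using that sec by (auto simp: U'_def sections_def)
    ultimately show ?thesis
      unfolding R_def by (rule gauss_equation[OF cc fr' o(4)])
  qed
  show "induced_curvature A g D \<iota> S u x y z = R x y z" if x: "x \<in> T u" and y: "y \<in> T u" and z: "z \<in> T u"
  proof -
    have sect: "\<exists>U X. open U \<and> u \<in> U \<and> X \<in> sections A \<iota> T U \<and> X u = x" if x: "x \<in> T u" for x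
    proof -
      obtain W U X' where X: "open W" "open U" "u \<in> U" "\<iota> ` U \<subseteq> W" "smooth_field_on A W X'" "X' (\<iota> u) = x"
        "\<And>q. q \<in> U \<Longrightarrow> X' (\<iota> q) \<in> T q"
        using tangent_extendable[OF x] unfolding extendable_def by blast
      have "extends_near A \<iota> q (X' \<circ> \<iota>) X'" if "q \<in> U" for q
        using X that unfolding extends_near_def by (intro exI[of _ W] exI[of _ U]) auto
      then have "X' \<circ> \<iota> \<in> sections A \<iota> T U"
        using X(7) by (auto simp: sections_def smooth_along_def)
      then show ?thesis using X by (intro exI[of _ U] exI[of _ "X' \<circ> \<iota>"]) auto
    qed
    obtain U1 X where X: "open U1" "u \<in> U1" "X \<in> sections A \<iota> T U1" "X u = x" using sect[OF x] by blast
    obtain U2 Y where Y: "open U2" "u \<in> U2" "Y \<in> sections A \<iota> T U2" "Y u = y" using sect[OF y] by blast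
    obtain U3 Z where Z: "open U3" "u \<in> U3" "Z \<in> sections A \<iota> T U3" "Z u = z" using sect[OF z] by blast
    let ?V = "U1 \<inter> U2 \<inter> U3"
    have V: "open ?V" "u \<in> ?V" "{X, Y, Z} \<subseteq> sections A \<iota> T ?V"
      using X Y Z by (auto simp: sections_def smooth_along_def)
    show ?thesis
      unfolding induced_curvature_def
    proof (rule the_equality)
      show "\<exists>U X Y Z. open U \<and> u \<in> U \<and> {X, Y, Z} \<subseteq> sections A \<iota> T U \<and> X u = x \<and> Y u = y \<and> Z u = z \<and>
          R x y z = induced_curvature_field A g D \<iota> S X Y Z u"
        using V field[OF V] X(4) Y(4) Z(4)
        by (intro exI[of _ ?V] exI[of _ X] exI[of _ Y] exI[of _ Z]) simp
    qed (use field in blast)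
  qed
qed

end

section \<open>Traces, the Osserman condition and Ricci curvature\<close>

lemma sum_skip_index:
  fixes f :: "nat \<Rightarrow> 'a::ab_group_add"
  shows "i \<le> m \<Longrightarrow> (\<Sum>a<m. f (if a < i then a else Suc a)) = (\<Sum>a<Suc m. f a) - f i"
proof (induction m)
  case (Suc m)
  show ?case
  proof (cases "i \<le> m")
    case True
    then show ?thesis using Suc.IH by simp
  next
    case False
    then have "i = Suc m" using Suc.prems by simp
    then have "(\<Sum>a<Suc m. f (if a < i then a else Suc a)) = (\<Sum>a<Suc m. f a)" by (intro sum.cong) auto
    then show ?thesis using \<open>i = Suc m\<close> by simp
  qed
qed simp

text \<open>The derivative of the characteristic polynomial is the sum of the characteristic polynomials of
  the submatrices with one row and the same column deleted. So the coefficient follows by induction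
  on the size: each diagonal entry occurs in all of these submatrices but one.\<close>

lemma char_poly_coeff_trace:
  fixes M :: "real Matrix.mat"
  shows "M \<in> carrier_mat (Suc n) (Suc n) \<Longrightarrow> coeff (char_poly M) n = - (\<Sum>i<Suc n. M $$ (i, i))"
proof (induction n arbitrary: M)
  case 0
  have "char_poly_matrix M \<in> carrier_mat 1 1" using 0 by (simp add: char_poly_matrix_def)
  from det_single[OF this] have "char_poly M = char_poly_matrix M $$ (0, 0)"
    by (simp add: char_poly_def)
  also have "\<dots> = [:- (M $$ (0, 0)), 1:]"
    using carrier_matD[OF 0] by (simp add: char_poly_matrix_def)
  finally show ?case by simp
next
  case (Suc n)
  let ?t = "\<Sum>i<Suc (Suc n). M $$ (i, i)"
  have "coeff (char_poly (mat_delete M i i)) n = M $$ (i, i) - ?t" if i: "i < Suc (Suc n)" for i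
  proof -
    have "mat_delete M i i \<in> carrier_mat (Suc n) (Suc n)" using mat_delete_carrier[OF Suc.prems, of i i] by simp
    then have "coeff (char_poly (mat_delete M i i)) n = - (\<Sum>a<Suc n. mat_delete M i i $$ (a, a))"
      by (rule Suc.IH)
    also have "(\<Sum>a<Suc n. mat_delete M i i $$ (a, a))
        = (\<Sum>a<Suc n. (\<lambda>j. M $$ (j, j)) (if a < i then a else Suc a))"
      using Suc.prems by (intro sum.cong) (auto simp: mat_delete_def)
    also have "\<dots> = ?t - M $$ (i, i)" by (rule sum_skip_index) (use i in auto)
    finally show ?thesis by simp
  qed
  then have "coeff (pderiv (char_poly M)) n = (\<Sum>i<Suc (Suc n). M $$ (i, i) - ?t)"
    unfolding pderiv_char_poly[OF Suc.prems] coeff_sum by (intro sum.cong) auto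
  also have "\<dots> = - (real (Suc n) * ?t)"
    unfolding sum_subtractf by (simp add: algebra_simps)
  finally have "real (Suc n) * coeff (char_poly M) (Suc n) = real (Suc n) * (- ?t)"
    unfolding coeff_pderiv by (simp only: mult_minus_right)
  then show ?case by (simp only: mult_cancel_left of_nat_eq_0_iff) simp
qed

lemma trace_eq_if_char_poly_eq:
  fixes M M' :: "real Matrix.mat"
  assumes "M \<in> carrier_mat n n" "M' \<in> carrier_mat n n" "char_poly M = char_poly M'"
  shows "(\<Sum>i<n. M $$ (i, i)) = (\<Sum>i<n. M' $$ (i, i))"
proof (cases n)
  case (Suc m)
  then show ?thesis using char_poly_coeff_trace[of M m] char_poly_coeff_trace[of M' m] assms by simp
qed simp

lemma trace_on_eq_if_char_poly_on_eq:
  assumes "char_poly_on V L = char_poly_on V L'" shows "trace_on V L = trace_on V L'"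
proof -
  have M: "matrix_on V L \<in> carrier_mat (length (basis_list V)) (length (basis_list V))" for L
    by (simp add: matrix_on_def Let_def)
  show ?thesis
    using trace_eq_if_char_poly_eq[OF M M assms[unfolded char_poly_on_def]]
    unfolding trace_on_def carrier_matD(1)[OF M] .
qed

lemma basis_list:
  fixes V :: "'b::euclidean_space set"
  assumes "subspace V"
  shows "distinct (basis_list V)" "independent (set (basis_list V))" "span (set (basis_list V)) = V"
proof -
  obtain B where B: "B \<subseteq> V" "independent B" "V \<subseteq> span B" using basis_exists by metis
  have "finite B" using B(2) by (rule independent_imp_finite)
  then obtain bs where "set bs = B" "distinct bs" using finite_distinct_list by blast
  moreover have "span B = V" using B assms by (simp add: span_minimal subset_antisym)
  ultimately have "\<exists>bs. distinct bs \<and> independent (set bs) \<and> span (set bs) = V" using B by blast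
  then have "distinct (basis_list V) \<and> independent (set (basis_list V)) \<and> span (set (basis_list V)) = V"
    unfolding basis_list_def by (rule someI_ex)
  then show "distinct (basis_list V)" "independent (set (basis_list V))" "span (set (basis_list V)) = V" by auto
qed

lemma trace_on_basis:
  assumes "subspace V"
  shows "trace_on V L = (\<Sum>b\<in>set (basis_list V). representation (set (basis_list V)) (L b) b)"
proof -
  let ?bs = "basis_list V"
  have "trace_on V L = (\<Sum>i<length ?bs. representation (set ?bs) (L (?bs ! i)) (?bs ! i))"
    by (simp add: trace_on_def matrix_on_def Let_def)
  also have "\<dots> = (\<Sum>b\<in>set ?bs. representation (set ?bs) (L b) b)"
    using sum.reindex_bij_betw[OF bij_betw_nth[OF basis_list(1)[OF assms] refl refl],
        of "\<lambda>b. representation (set ?bs) (L b) b"] by simp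
  finally show ?thesis .
qed

lemma trace_on_cong:
  assumes "subspace V" "\<And>z. z \<in> V \<Longrightarrow> L z = L' z"
  shows "trace_on V L = trace_on V L'"
  unfolding trace_on_basis[OF assms(1)]
proof (rule sum.cong[OF refl])
  fix b assume "b \<in> set (basis_list V)"
  then have "b \<in> V" using span_base basis_list(3)[OF assms(1)] by metis
  then show "representation (set (basis_list V)) (L b) b = representation (set (basis_list V)) (L' b) b"
    using assms(2) by simp
qed

text \<open>The trace of the map \<open>z \<mapsto> \<phi> z v\<close> is \<open>\<phi> v\<close>, whatever basis is used. This replaces a
  change of basis: every decomposition of the operator into such maps computes its trace.\<close>

lemma trace_on_rank_one_sum:
  assumes V: "subspace V" and "\<And>i. i \<in> I \<Longrightarrow> linear (\<phi> i)" "\<And>i. i \<in> I \<Longrightarrow> v i \<in> V"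
    "\<And>z. z \<in> V \<Longrightarrow> L z = (\<Sum>i\<in>I. \<phi> i z *\<^sub>R v i)"
  shows "trace_on V L = (\<Sum>i\<in>I. \<phi> i (v i))"
proof -
  let ?B = "set (basis_list V)"
  note B = basis_list(2,3)[OF V]
  have v: "v i \<in> span ?B" if "i \<in> I" for i using assms(3) that B(2) by simp
  have "trace_on V L = (\<Sum>b\<in>?B. \<Sum>i\<in>I. \<phi> i b * representation ?B (v i) b)"
    unfolding trace_on_basis[OF V]
  proof (rule sum.cong[OF refl])
    fix b assume "b \<in> ?B"
    then have "b \<in> V" using span_base[of b ?B] B(2) by simp
    then have "representation ?B (L b) b = representation ?B (\<Sum>i\<in>I. \<phi> i b *\<^sub>R v i) b" using assms(4) by simp
    also have "\<dots> = (\<Sum>i\<in>I. representation ?B (\<phi> i b *\<^sub>R v i) b)"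
      using representation_sum[OF B(1), of I "\<lambda>i. \<phi> i b *\<^sub>R v i"] v by (simp add: span_scale)
    also have "\<dots> = (\<Sum>i\<in>I. \<phi> i b * representation ?B (v i) b)"
      by (rule sum.cong[OF refl]) (simp add: representation_scale[OF B(1) v])
    finally show "representation ?B (L b) b = (\<Sum>i\<in>I. \<phi> i b * representation ?B (v i) b)" .
  qed
  also have "\<dots> = (\<Sum>i\<in>I. \<Sum>b\<in>?B. \<phi> i b * representation ?B (v i) b)" by (rule sum.swap)
  also have "\<dots> = (\<Sum>i\<in>I. \<phi> i (v i))"
  proof (rule sum.cong[OF refl])
    fix i assume i: "i \<in> I"
    have "(\<Sum>b\<in>?B. \<phi> i b * representation ?B (v i) b) = \<phi> i (\<Sum>b\<in>?B. representation ?B (v i) b *\<^sub>R b)"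
      by (simp add: linear_sum[OF assms(2)[OF i]] linear_scale[OF assms(2)[OF i]] mult.commute)
    also have "(\<Sum>b\<in>?B. representation ?B (v i) b *\<^sub>R b) = v i"
      by (rule sum_representation_eq[OF B(1) v[OF i]]) auto
    finally show "(\<Sum>b\<in>?B. \<phi> i b * representation ?B (v i) b) = \<phi> i (v i)" .
  qed
  finally show ?thesis .
qed

text \<open>By scaling, the form \<open>q = r - k b\<close> with \<open>k = \<epsilon> r(x,x)\<close> vanishes on the open cone of the vectors
  whose square has the sign of \<open>\<epsilon>\<close>. For any \<open>y\<close> the points \<open>x + t y\<close> and \<open>x - t y\<close> lie in that cone
  for small \<open>t\<close>; since \<open>q(x,x) = 0\<close>, adding the two values of \<open>q\<close> leaves \<open>2 t\<^sup>2 q(y,y) = 0\<close>.\<close>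

lemma proportional_if_constant_on_level:
  fixes b r :: "'b::real_vector \<Rightarrow> 'b \<Rightarrow> real"
  assumes V: "subspace V" and b: "bilinear b" and r: "bilinear r"
    and b_sym: "\<And>x y. b x y = b y x" and r_sym: "\<And>x y. x \<in> V \<Longrightarrow> y \<in> V \<Longrightarrow> r x y = r y x"
    and x: "x \<in> V" "b x x = \<epsilon>" and \<epsilon>: "\<epsilon> = 1 \<or> \<epsilon> = - 1"
    and const: "\<And>y. y \<in> V \<Longrightarrow> b y y = \<epsilon> \<Longrightarrow> r y y = r x x"
    and y: "y \<in> V" and z: "z \<in> V"
  shows "r y z = \<epsilon> * r x x * b y z"
proof -
  define k where "k = \<epsilon> * r x x"
  define q where "q = (\<lambda>y z. r y z - k * b y z)"
  have \<epsilon>\<epsilon>: "\<epsilon> * \<epsilon> = 1" using \<epsilon> by auto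
  note bl = bilinear_ladd[OF b] bilinear_radd[OF b] bilinear_lmul[OF b] bilinear_rmul[OF b]
    bilinear_ladd[OF r] bilinear_radd[OF r] bilinear_lmul[OF r] bilinear_rmul[OF r]
  have q_sym: "q y z = q z y" if "y \<in> V" "z \<in> V" for y z
    using r_sym[OF that] b_sym[of y z] by (simp add: q_def)
  have cone: "q y y = 0" if y: "y \<in> V" and pos: "\<epsilon> * b y y > 0" for y
  proof -
    define s where "s = inverse (sqrt (\<epsilon> * b y y))"
    have s: "s * s * (\<epsilon> * b y y) = 1" "s \<noteq> 0"
      using pos by (auto simp: s_def field_simps)
    have "b (s *\<^sub>R y) (s *\<^sub>R y) = \<epsilon> * \<epsilon> * (s * s * b y y)" using \<epsilon>\<epsilon> by (simp add: bl)
    also have "\<dots> = \<epsilon>" using s(1) by (simp add: algebra_simps)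
    finally have "r (s *\<^sub>R y) (s *\<^sub>R y) = r x x" using const y V by (simp add: subspace_scale)
    then have "s * s * r y y = r x x" by (simp add: bl)
    also have "\<dots> = s * s * (k * b y y)" using s(1) by (simp add: k_def algebra_simps)
    finally show ?thesis using s(2) by (simp add: q_def)
  qed
  have diag: "q y y = 0" if y: "y \<in> V" for y
  proof -
    define a where "a = \<bar>b x y\<bar> + \<bar>b y y\<bar>"
    \<comment> \<open>so small that the square of \<open>x \<plusminus> t y\<close> differs from that of \<open>x\<close> by at most \<open>1/2\<close>\<close>
    define t where "t = 1 / (4 * (1 + a))"
    have a: "a \<ge> 0" by (simp add: a_def)
    have t: "0 < t" "t \<le> 1" "2 * t * a \<le> 1/2" using a by (auto simp: t_def field_simps)
    have dir: "q (x + (\<sigma> * t) *\<^sub>R y) (x + (\<sigma> * t) *\<^sub>R y) = 0" if \<sigma>: "\<sigma> = 1 \<or> \<sigma> = - 1" for \<sigma>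
    proof (rule cone)
      show "x + (\<sigma> * t) *\<^sub>R y \<in> V" using V x y by (intro subspace_add subspace_scale)
      define P where "P = 2 * (\<sigma> * t) * b x y + t * t * b y y"
      have "b (x + (\<sigma> * t) *\<^sub>R y) (x + (\<sigma> * t) *\<^sub>R y) = \<epsilon> + P"
        unfolding P_def using \<sigma> x(2) b_sym[of y x] by (auto simp: bl algebra_simps)
      moreover have "\<bar>P\<bar> \<le> 1/2"
      proof -
        have "\<bar>2 * (\<sigma> * t) * b x y + t * t * b y y\<bar> \<le> 2 * t * \<bar>b x y\<bar> + t * t * \<bar>b y y\<bar>"
          using \<sigma> t by (intro order_trans[OF abs_triangle_ineq]) (auto simp: abs_mult)
        also have "t * t * \<bar>b y y\<bar> \<le> 2 * t * \<bar>b y y\<bar>"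
          using t by (intro mult_right_mono) (auto simp: field_simps)
        finally show ?thesis using t(3) by (simp add: P_def a_def algebra_simps)
      qed
      ultimately show "0 < \<epsilon> * b (x + (\<sigma> * t) *\<^sub>R y) (x + (\<sigma> * t) *\<^sub>R y)"
        using \<epsilon> by (auto simp: abs_le_iff)
    qed
    have "q x x = 0" using cone[OF x(1)] x(2) \<epsilon>\<epsilon> by simp
    then have "2 * (\<sigma> * t) * q x y + t * t * q y y = 0" if "\<sigma> = 1 \<or> \<sigma> = - 1" for \<sigma>
      using dir[OF that] that r_sym[OF y x(1)] b_sym[of y x] by (auto simp: q_def bl algebra_simps)
    from this[OF disjI1[OF refl]] this[OF disjI2[OF refl]] have "t * t * q y y = 0" by argo
    then show ?thesis using t by simp
  qed
  have "q (y + z) (y + z) = 0" using diag V y z by (simp add: subspace_add)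
  then have "q y z = 0" using diag[OF y] diag[OF z] q_sym[OF y z] by (simp add: q_def bl algebra_simps)
  then show ?thesis by (simp add: q_def k_def)
qed

context screened_hypersurface
begin

lemma adapted_at:
  assumes "adapted_frame W U \<xi> N" "u \<in> U"
  shows "\<xi> (\<iota> u) \<in> T u" "\<And>y. y \<in> T u \<Longrightarrow> g (\<iota> u) (\<xi> (\<iota> u)) y = 0"
    "\<And>y. y \<in> T u \<Longrightarrow> g (\<iota> u) y (\<xi> (\<iota> u)) = 0" "g (\<iota> u) (N (\<iota> u)) (\<xi> (\<iota> u)) = 1"
    "\<And>w. w \<in> S u \<Longrightarrow> g (\<iota> u) (N (\<iota> u)) w = 0"
proof -
  note f = adapted_frameD[OF assms(1)]
  note x = f(6)[OF assms(2)]
  show "\<xi> (\<iota> u) \<in> T u" by (rule rad_tangent[OF x])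
  show "g (\<iota> u) (\<xi> (\<iota> u)) y = 0" "g (\<iota> u) y (\<xi> (\<iota> u)) = 0" if "y \<in> T u" for y
    using rad_orthogonal[OF x that] g_sym by metis+
  show "g (\<iota> u) (N (\<iota> u)) (\<xi> (\<iota> u)) = 1"
    using f(8)[OF assms(2)] g_sym[of "\<iota> u" "N (\<iota> u)" "\<xi> (\<iota> u)"] by (simp add: is_transversal_def)
  show "g (\<iota> u) (N (\<iota> u)) w = 0" if "w \<in> S u" for w
    using f(8)[OF assms(2)] that by (simp add: is_transversal_def)
qed

lemma tangent_expansion:
  assumes fr: "adapted_frame W U \<xi> N" "u \<in> U"
    and E: "finite E" "E \<subseteq> S u" "S u \<subseteq> span E" "\<And>e. e \<in> E \<Longrightarrow> g (\<iota> u) e e \<noteq> 0"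
      "\<And>e f. e \<in> E \<Longrightarrow> f \<in> E \<Longrightarrow> e \<noteq> f \<Longrightarrow> g (\<iota> u) e f = 0"
    and z: "z \<in> T u"
  shows "z = (\<Sum>e\<in>E. (g (\<iota> u) z e / g (\<iota> u) e e) *\<^sub>R e) + g (\<iota> u) (N (\<iota> u)) z *\<^sub>R \<xi> (\<iota> u)"
proof -
  note a = adapted_at[OF fr]
  obtain s r where sr: "s \<in> S u" "r \<in> Rad u" "z = s + r" using tangent_decompose[OF z] by blast
  have "s = (\<Sum>e\<in>E. (g (\<iota> u) s e / g (\<iota> u) e e) *\<^sub>R e)"
    using orthogonal_family(3)[OF g_bilinear[of "\<iota> u"] E(1), of "\<lambda>e. e" s] E(3-5) sr(1) by auto
  also have "\<dots> = (\<Sum>e\<in>E. (g (\<iota> u) z e / g (\<iota> u) e e) *\<^sub>R e)"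
  proof (rule sum.cong[OF refl])
    fix e assume "e \<in> E"
    then have "e \<in> T u" using E(2) screen_tangent by blast
    then have "g (\<iota> u) r e = 0" using rad_orthogonal[OF sr(2)] by blast
    then show "(g (\<iota> u) s e / g (\<iota> u) e e) *\<^sub>R e = (g (\<iota> u) z e / g (\<iota> u) e e) *\<^sub>R e" by (simp add: sr(3))
  qed
  finally have s: "s = (\<Sum>e\<in>E. (g (\<iota> u) z e / g (\<iota> u) e e) *\<^sub>R e)" .
  obtain t where t: "r = t *\<^sub>R \<xi> (\<iota> u)"
    using rad_multiple[OF adapted_frameD(6,7)[OF fr(1) fr(2)] sr(2)] by blast
  have "g (\<iota> u) (N (\<iota> u)) z = t" using a(4,5) sr(1) by (simp add: sr(3) t)
  then show ?thesis using s sr(3) t by metis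
qed

text \<open>The screen basis together with \<open>\<xi>\<close> is a basis of \<open>T u\<close>, whose dual basis is given by the products
  with the elements of \<open>E\<close>, divided by their squares, and by the product with \<open>N\<close>.\<close>

lemma trace_on_tangent:
  assumes fr: "adapted_frame W U \<xi> N" "u \<in> U"
    and E: "finite E" "E \<subseteq> S u" "S u \<subseteq> span E" "\<And>e. e \<in> E \<Longrightarrow> g (\<iota> u) e e \<noteq> 0"
      "\<And>e f. e \<in> E \<Longrightarrow> f \<in> E \<Longrightarrow> e \<noteq> f \<Longrightarrow> g (\<iota> u) e f = 0"
    and L: "linear L" "\<And>z. z \<in> T u \<Longrightarrow> L z \<in> T u"
  shows "trace_on (T u) L
    = (\<Sum>e\<in>E. g (\<iota> u) (L e) e / g (\<iota> u) e e) + g (\<iota> u) (N (\<iota> u)) (L (\<xi> (\<iota> u)))"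
proof -
  note a = adapted_at[OF fr]
  let ?I = "insert None (Some ` E)"
  define \<phi> where "\<phi> = (\<lambda>i z. case i of None \<Rightarrow> g (\<iota> u) (N (\<iota> u)) z | Some e \<Rightarrow> g (\<iota> u) z e / g (\<iota> u) e e)"
  define v where "v = (\<lambda>i. case i of None \<Rightarrow> L (\<xi> (\<iota> u)) | Some e \<Rightarrow> L e)"
  have split: "(\<Sum>i\<in>?I. F i) = (\<Sum>e\<in>E. F (Some e)) + F None" for F :: "'b option \<Rightarrow> 'c::ab_group_add"
    using E(1) by (simp add: sum.reindex add.commute)
  have "trace_on (T u) L = (\<Sum>i\<in>?I. \<phi> i (v i))"
  proof (rule trace_on_rank_one_sum[OF subspace_tangent])
    show "linear (\<phi> i)" for i
      by (cases i) (auto simp: \<phi>_def add_divide_distrib intro!: linearI)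
    show "v i \<in> T u" if "i \<in> ?I" for i
      using that E(2) screen_tangent L(2) a(1) by (auto simp: v_def)
    fix z assume z: "z \<in> T u"
    have "L z = L ((\<Sum>e\<in>E. (g (\<iota> u) z e / g (\<iota> u) e e) *\<^sub>R e) + g (\<iota> u) (N (\<iota> u)) z *\<^sub>R \<xi> (\<iota> u))"
      using tangent_expansion[OF fr E z] by simp
    also have "\<dots> = (\<Sum>i\<in>?I. \<phi> i z *\<^sub>R v i)"
      unfolding split by (simp add: \<phi>_def v_def linear_add[OF L(1)] linear_sum[OF L(1)] linear_scale[OF L(1)])
    finally show "L z = (\<Sum>i\<in>?I. \<phi> i z *\<^sub>R v i)" .
  qed
  then show ?thesis unfolding split by (simp add: \<phi>_def v_def)
qed

text \<open>If one argument is orthogonal to \<open>N\<close>, then \<open>g_tilde\<close> agrees with \<open>g\<close>, so the projection of \<open>v\<close> onto the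
  screen along \<open>\<xi>\<close> satisfies the defining equation. For uniqueness, testing with \<open>\<xi>\<close> shows that every
  solution is orthogonal to \<open>N\<close>; two solutions then differ by a multiple of \<open>\<xi>\<close> that is orthogonal
  to \<open>N\<close>.\<close>

lemma pseudo_jacobi_eq:
  assumes fr: "adapted_frame W U \<xi> N" "u \<in> U" and v: "induced_curvature A g D \<iota> S u y x x = v" "v \<in> T u"
  shows "pseudo_jacobi A g D \<iota> S (\<xi> \<circ> \<iota>) u x y = v - g (\<iota> u) (N (\<iota> u)) v *\<^sub>R \<xi> (\<iota> u)"
    (is "_ = ?J")
proof -
  note a = adapted_at[OF fr] and f = adapted_frameD[OF fr(1)]
  have tr: "transversal g \<iota> S (\<xi> \<circ> \<iota>) u = N (\<iota> u)"
    by (rule transversal_eq) (use f fr(2) in auto)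
  have gt: "g_tilde g \<iota> S (\<xi> \<circ> \<iota>) u x y = g (\<iota> u) x y + g (\<iota> u) (N (\<iota> u)) x * g (\<iota> u) (N (\<iota> u)) y" for x y
    by (simp add: g_tilde_def tr Let_def)
  have R: "induced_curvature4 A g D \<iota> S u y x x w = g (\<iota> u) v w" for w
    by (simp add: induced_curvature4_def v)
  have J: "?J \<in> T u" using v(2) a(1) by (intro subspace_diff subspace_scale subspace_tangent)
  have gJ: "g (\<iota> u) ?J w = g (\<iota> u) v w" if "w \<in> T u" for w using a(2)[OF that] by simp
  have NJ: "g (\<iota> u) (N (\<iota> u)) ?J = 0" using a(4) by simp
  show ?thesis
    unfolding pseudo_jacobi_def
  proof (rule the_equality)
    show "?J \<in> T u \<and> (\<forall>w\<in>T u. g_tilde g \<iota> S (\<xi> \<circ> \<iota>) u ?J w = induced_curvature4 A g D \<iota> S u y x x w)"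
      unfolding gt R NJ using J gJ by simp
  next
    fix v' assume "v' \<in> T u \<and> (\<forall>w\<in>T u. g_tilde g \<iota> S (\<xi> \<circ> \<iota>) u v' w = induced_curvature4 A g D \<iota> S u y x x w)"
    then have v': "v' \<in> T u" "\<And>w. w \<in> T u \<Longrightarrow>
        g (\<iota> u) v' w + g (\<iota> u) (N (\<iota> u)) v' * g (\<iota> u) (N (\<iota> u)) w = g (\<iota> u) v w"
      unfolding gt R by auto
    have Nv': "g (\<iota> u) (N (\<iota> u)) v' = 0"
      using v'(2)[OF a(1)] a(3)[OF v'(1)] a(3)[OF v(2)] a(4) by simp
    have "g (\<iota> u) (v' - ?J) w = 0" if "w \<in> T u" for w
      using v'(2)[OF that] Nv' gJ[OF that] bilinear_lsub[OF g_bilinear, of "\<iota> u" v' ?J w] by simp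
    then have "v' - ?J \<in> Rad u" by (simp add: rad_normal normal_def)
    then obtain t where t: "v' - ?J = t *\<^sub>R \<xi> (\<iota> u)"
      using rad_multiple[OF f(6,7)[OF fr(2)]] by blast
    have "t = g (\<iota> u) (N (\<iota> u)) (v' - ?J)" unfolding t using a(4) by simp
    also have "\<dots> = g (\<iota> u) (N (\<iota> u)) v' - g (\<iota> u) (N (\<iota> u)) ?J" by (rule bilinear_rsub[OF g_bilinear])
    also have "\<dots> = 0" unfolding Nv' NJ by simp
    finally show "v' = ?J" using t by simp
  qed
qed

text \<open>Both the Ricci tensor and the trace of the pseudo-Jacobi operator reduce to the form \<open>r\<close> below, the
  contraction of the curvature over the screen. If no tangent vector has a nonzero square, then the
  screen is trivial and \<open>r = 0\<close>.\<close>

lemma ricci_proportional: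
  assumes cc: "constant_curvature A g D c" and adm: "admissible_screen A g D \<iota> S"
    and oss: "osserman_sign_at A g D \<iota> 1 u" "osserman_sign_at A g D \<iota> (- 1) u"
  shows "\<exists>\<kappa>. \<forall>x\<in>T u. \<forall>y\<in>T u. ricci A g D \<iota> S u x y = \<kappa> * g (\<iota> u) x y"
proof -
  obtain W U \<xi> N where fr: "adapted_frame W U \<xi> N" "u \<in> U" using adapted_frame_exists by blast
  note a = adapted_at[OF fr] and f = adapted_frameD[OF fr(1)]
  let ?g = "g (\<iota> u)" and ?\<xi> = "\<xi> (\<iota> u)" and ?N = "N (\<iota> u)"
  have "\<exists>E. finite E \<and> E \<subseteq> S u \<and> S u \<subseteq> span E \<and> (\<forall>e\<in>E. ?g e e \<noteq> 0) \<and>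
    (\<forall>e\<in>E. \<forall>f\<in>E. e \<noteq> f \<longrightarrow> ?g e f = 0)"
    by (rule orthogonal_basis_exists[OF g_bilinear g_sym subspace_screen screen_nondegenerate]) auto
  then obtain E where E: "finite E" "E \<subseteq> S u" "S u \<subseteq> span E" "\<And>e. e \<in> E \<Longrightarrow> ?g e e \<noteq> 0"
    "\<And>e f. e \<in> E \<Longrightarrow> f \<in> E \<Longrightarrow> e \<noteq> f \<Longrightarrow> ?g e f = 0"
    by blast
  have ET: "e \<in> T u" if "e \<in> E" for e using that E(2) screen_tangent by blast
  define h where "h = second_form u \<xi>"
  define B where "B = shape_operator u \<xi> N"
  define R where "R = (\<lambda>x y z. c *\<^sub>R (?g y z *\<^sub>R x - ?g x z *\<^sub>R y) + h y z *\<^sub>R B x - h x z *\<^sub>R B y)"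
  have R: "induced_curvature A g D \<iota> S u x y z = R x y z" if "x \<in> T u" "y \<in> T u" "z \<in> T u" for x y z
    unfolding R_def h_def B_def by (rule induced_curvature_gauss(2)[OF cc fr that])
  have hb: "bilinear h" and Bl: "linear B"
    unfolding h_def B_def using bilinear_second_form[OF fr] linear_shape_operator[OF fr] .
  have B: "B x \<in> T u" "?g ?N (B x) = 0" if "x \<in> T u" for x
    unfolding B_def using shape_operator_screen[OF fr that] by auto
  have RT: "R x y z \<in> T u" if "x \<in> T u" "y \<in> T u" for x y z
    unfolding R_def using that B by (intro subspace_add subspace_diff subspace_scale subspace_tangent) auto
  note lin = bilinear_ladd[OF hb] bilinear_radd[OF hb] bilinear_lmul[OF hb] bilinear_rmul[OF hb]
    linear_add[OF Bl] linear_scale[OF Bl]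
  have R_add: "R (x + x') y z = R x y z + R x' y z" "R x (y + y') z = R x y z + R x y' z"
    "R x y (z + z') = R x y z + R x y z'" for x x' y y' z z'
    unfolding R_def by (simp_all add: lin algebra_simps)
  have R_scale: "R (t *\<^sub>R x) y z = t *\<^sub>R R x y z" "R x (t *\<^sub>R y) z = t *\<^sub>R R x y z"
    "R x y (t *\<^sub>R z) = t *\<^sub>R R x y z" for t x y z
    unfolding R_def by (simp_all add: lin algebra_simps)
  have sym: "?g (R x y z) w = - ?g (R y x z) w" "?g (R x y z) w = ?g (R z w x) y"
    if "x \<in> T u" "y \<in> T u" "z \<in> T u" "w \<in> T u" for x y z w
    using adm that R unfolding admissible_screen_def Let_def induced_curvature4_def by metis+
  \<comment> \<open>the shape operator does not contribute, since it maps into the complement of \<open>N\<close>\<close>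
  have NR: "?g ?N (R x ?\<xi> y) = - c * ?g x y" if "x \<in> T u" "y \<in> T u" for x y
    using B[OF that(1)] B[OF a(1)] a(2)[OF that(2)] a(4) by (simp add: R_def)
  define r where "r = (\<lambda>x y. \<Sum>e\<in>E. ?g (R x e y) e / ?g e e)"
  have r_bilinear: "bilinear r"
    unfolding bilinear_def r_def
    by (auto intro!: linearI simp: R_add R_scale add_divide_distrib sum.distrib sum_distrib_left)
  have r_sym: "r x y = r y x" if "x \<in> T u" "y \<in> T u" for x y
    unfolding r_def by (rule sum.cong[OF refl]) (use sym(2) that ET in simp)
  have ric: "ricci A g D \<iota> S u x y = r x y - c * ?g x y" if x: "x \<in> T u" and y: "y \<in> T u" for x y
  proof -
    have "ricci A g D \<iota> S u x y = trace_on (T u) (\<lambda>z. R x z y)"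
      unfolding ricci_def by (rule trace_on_cong[OF subspace_tangent]) (rule R[OF x _ y])
    also have "\<dots> = r x y + ?g ?N (R x ?\<xi> y)"
      unfolding r_def
      by (rule trace_on_tangent[OF fr E]) (auto intro!: linearI RT x simp: R_add R_scale)
    finally show ?thesis using NR[OF x y] by simp
  qed
  have jac: "trace_on (T u) (pseudo_jacobi A g D \<iota> S (\<xi> \<circ> \<iota>) u x) = - r x x" if x: "x \<in> T u" for x
  proof -
    let ?J = "\<lambda>y. R y x x - ?g ?N (R y x x) *\<^sub>R ?\<xi>"
    have "trace_on (T u) (pseudo_jacobi A g D \<iota> S (\<xi> \<circ> \<iota>) u x) = trace_on (T u) ?J"
      by (rule trace_on_cong[OF subspace_tangent], rule pseudo_jacobi_eq[OF fr R RT]) (use x in auto)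
    also have "\<dots> = (\<Sum>e\<in>E. ?g (?J e) e / ?g e e) + ?g ?N (?J ?\<xi>)"
    proof (rule trace_on_tangent[OF fr E])
      show "linear ?J" by (rule linearI) (simp_all add: R_add R_scale algebra_simps)
      show "?J z \<in> T u" if "z \<in> T u" for z
        by (intro subspace_diff subspace_scale subspace_tangent RT that x a(1))
    qed
    also have "?g ?N (?J ?\<xi>) = 0" using a(4) by simp
    also have "(\<Sum>e\<in>E. ?g (?J e) e / ?g e e) = - r x x"
      unfolding r_def sum_negf[symmetric]
    proof (rule sum.cong[OF refl])
      fix e assume e: "e \<in> E"
      show "?g (?J e) e / ?g e e = - (?g (R x e x) e / ?g e e)"
        using sym(1)[OF ET[OF e] x x ET[OF e]] a(2)[OF ET[OF e]] by simp
    qed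
    finally show ?thesis by (simp only: add_0_right)
  qed
  have const: "r y y = r x x"
    if \<epsilon>: "\<epsilon> = 1 \<or> \<epsilon> = - 1" and xy: "x \<in> T u" "y \<in> T u" "?g x x = \<epsilon>" "?g y y = \<epsilon>" for \<epsilon> x y
  proof -
    have "osserman_sign_at A g D \<iota> \<epsilon> u" using \<epsilon> oss by auto
    then have "char_poly_on (T u) (pseudo_jacobi A g D \<iota> S (\<xi> \<circ> \<iota>) u x)
        = char_poly_on (T u) (pseudo_jacobi A g D \<iota> S (\<xi> \<circ> \<iota>) u y)"
      unfolding osserman_sign_at_def using adm adapted_rad_frame[OF fr(1)] fr(2) xy by blast
    from trace_on_eq_if_char_poly_on_eq[OF this] show ?thesis using jac xy by simp
  qed
  have "\<exists>\<kappa>. \<forall>x\<in>T u. \<forall>y\<in>T u. r x y = \<kappa> * ?g x y"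
  proof (cases "\<exists>x\<in>T u. ?g x x \<noteq> 0")
    case True
    then obtain x where x: "x \<in> T u" "?g x x \<noteq> 0" by blast
    define x1 where "x1 = inverse (sqrt \<bar>?g x x\<bar>) *\<^sub>R x"
    have x1: "x1 \<in> T u" unfolding x1_def by (intro subspace_scale subspace_tangent x)
    have "?g x1 x1 = ?g x x / \<bar>?g x x\<bar>"
      by (simp add: x1_def field_simps)
    then have "?g x1 x1 = 1 \<or> ?g x1 x1 = - 1" using x(2) by (auto simp: abs_if)
    then have "r y z = ?g x1 x1 * r x1 x1 * ?g y z" if "y \<in> T u" "z \<in> T u" for y z
      using proportional_if_constant_on_level[OF subspace_tangent g_bilinear r_bilinear g_sym r_sym x1 refl _ _ that]
        const[OF _ x1 _ refl] by blast
    then show ?thesis by blast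
  next
    case False
    then have "E = {}" using E(4) ET by blast
    moreover have "?g x y = 0" if x: "x \<in> T u" and y: "y \<in> T u" for x y
    proof -
      obtain t where "x = t *\<^sub>R ?\<xi>" using tangent_expansion[OF fr E x] \<open>E = {}\<close> by auto
      then show ?thesis using a(2)[OF y] by simp
    qed
    ultimately show ?thesis by (simp add: r_def)
  qed
  then obtain \<kappa> where "\<forall>x\<in>T u. \<forall>y\<in>T u. r x y = \<kappa> * ?g x y" by blast
  then have "\<forall>x\<in>T u. \<forall>y\<in>T u. ricci A g D \<iota> S u x y = (\<kappa> - c) * ?g x y"
    using ric by (simp add: algebra_simps)
  then show ?thesis by blast
qed

text \<open>With a Ricci tensor proportional to \<open>g\<close> at each point, the condition says that the curvature operators
  are skew with respect to \<open>g\<close>. This follows from pair symmetry and from antisymmetry in the first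
  two arguments. The factor may vary from point to point, because the condition is pointwise.\<close>

lemma ricci_semi_symmetric_if_osserman:
  assumes cc: "constant_curvature A g D c" and adm: "admissible_screen A g D \<iota> S"
    and oss: "pointwise_osserman A g D \<iota>"
  shows "ricci_semi_symmetric A g D \<iota> S"
  unfolding ricci_semi_symmetric_def
proof (intro allI impI ballI)
  fix V V1 V2 X Y u
  assume V: "open V \<and> {V1, V2, X, Y} \<subseteq> sections A \<iota> T V" and u: "u \<in> V"
  let ?R = "induced_curvature A g D \<iota> S u"
  obtain W U \<xi> N where fr: "adapted_frame W U \<xi> N" "u \<in> U" using adapted_frame_exists by blast
  have t: "V1 u \<in> T u" "V2 u \<in> T u" "X u \<in> T u" "Y u \<in> T u" using V u by (auto simp: sections_def)
  have field: "induced_curvature_field A g D \<iota> S V1 V2 Z u = ?R (V1 u) (V2 u) (Z u)"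
    if "Z \<in> sections A \<iota> T V" for Z
    using induced_curvature_gauss(1)[OF cc fr, of V V1 V2 Z] induced_curvature_gauss(2)[OF cc fr t(1,2), of "Z u"]
      V u that by (auto simp: sections_def)
  have RT: "?R (V1 u) (V2 u) z \<in> T u" if "z \<in> T u" for z
    unfolding induced_curvature_gauss(2)[OF cc fr t(1,2) that]
    by (intro subspace_add subspace_diff subspace_scale subspace_tangent shape_operator_screen(1)[OF fr] t)
  obtain \<kappa> where \<kappa>: "\<And>x y. x \<in> T u \<Longrightarrow> y \<in> T u \<Longrightarrow> ricci A g D \<iota> S u x y = \<kappa> * g (\<iota> u) x y"
    using ricci_proportional[OF cc adm] oss unfolding pointwise_osserman_def by blast
  have sym: "g (\<iota> u) (?R x y z) w = - g (\<iota> u) (?R y x z) w" "g (\<iota> u) (?R x y z) w = g (\<iota> u) (?R z w x) y"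
    if "x \<in> T u" "y \<in> T u" "z \<in> T u" "w \<in> T u" for x y z w
    using adm that unfolding admissible_screen_def Let_def induced_curvature4_def by metis+
  have "g (\<iota> u) (?R (V1 u) (V2 u) (X u)) (Y u) = - g (\<iota> u) (?R (V1 u) (V2 u) (Y u)) (X u)"
    using sym(2)[OF t] sym(1)[OF t(3,4,1,2)] sym(2)[OF t(4,3,1,2)] by simp
  moreover have "g (\<iota> u) (X u) (?R (V1 u) (V2 u) (Y u)) = g (\<iota> u) (?R (V1 u) (V2 u) (Y u)) (X u)" by (rule g_sym)
  ultimately show "let R = induced_curvature_field A g D \<iota> S V1 V2
      in - ricci A g D \<iota> S u (R X u) (Y u) - ricci A g D \<iota> S u (X u) (R Y u) = 0"
    using V t field[of X] field[of Y] by (simp add: \<kappa> RT Let_def)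
qed

end

theorem theorem5p5:
  fixes A :: "('m::{t2_space, second_countable_topology}, 'b::euclidean_space) chart set"
    and gbar :: "'m \<Rightarrow> 'b \<Rightarrow> 'b \<Rightarrow> real"
    and nablabar :: "('m \<Rightarrow> 'b) \<Rightarrow> ('m \<Rightarrow> 'b) \<Rightarrow> 'm \<Rightarrow> 'b"
    and \<iota> :: "'h::{t2_space, second_countable_topology} \<Rightarrow> 'm"
    and S :: "'h \<Rightarrow> 'b set"
    and c :: real
  assumes "semi_riemannian_manifold A gbar"
    and "levi_civita A gbar nablabar"
    and "constant_curvature A gbar nablabar c"
    and "lightlike_hypersurface A gbar \<iota>"
    and "pointwise_osserman A gbar nablabar \<iota>"
    and "admissible_screen A gbar nablabar \<iota> S"
  shows "ricci_semi_symmetric A gbar nablabar \<iota> S"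
proof -
  interpret screened_hypersurface A nablabar gbar \<iota> S
    by unfold_locales
      (use assms in \<open>auto simp: semi_riemannian_manifold_def levi_civita_def lightlike_hypersurface_def
        admissible_screen_def\<close>)
  show ?thesis using ricci_semi_symmetric_if_osserman assms by blast
qed

end
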